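(* Let $E$ be a Banach space. The map $C_h(\mathbb{R}^+,\mathcal{L}(E))\to G_s(E)$, $A\mapsto W_A^s$, is continuous.
   Context: $\mathcal{L}(E)$ is the space of bounded linear operators on $E$ with the operator norm. $C_h(\mathbb{R}^+,\mathcal{L}(E))$ is the set of continuous $A\colon[0,+\infty)\to\mathcal{L}(E)$ having a norm limit $A(+\infty)$ as $t\to+\infty$ with $\sigma(A(+\infty))\cap i\mathbb{R}=\emptyset$ (for real $E$, spectra are those of the complexification), endowed with the uniform topology given by $\sup_{t\ge0}\|A(t)\|$. $X_A$ is the solution of $X'=AX$, $X(0)=I$ in $\mathcal{L}(E)$, and $W_A^s=\{x\in E:\lim_{t\to+\infty}X_A(t)x=0\}$ is the stable space, which is a closed complemented subspace of $E$ for $A\in C_h(\mathbb{R}^+,\mathcal{L}(E))$. $G_s(E)$ is the set of closed complemented subspaces of $E$ with the metric $\delta(Y,Z)=\max\{\rho(Y,Z),\rho(Z,Y)\}$, where $\rho(Y,Z)=\sup_{y\in D(Y)}\operatorname{dist}(y,D(Z))$ and $D(\cdot)$ denotes the closed unit ball of a subspace. *)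

theory Defs
  imports "HOL-Analysis.Analysis"
begin

text \<open>
  The scalar field of the Banach space may be the reals or the complex numbers. The notions that
  depend on it take the scalar multiplication as an argument: \<^term>\<open>(*\<^sub>R)\<close> for a real space, and a
  multiplication satisfying the locale below for a complex space. The latter lives on a type of
  class \<^class>\<open>banach\<close>, whose real structure is the restriction of scalars.
\<close>

locale complex_banach = vector_space smul
  for smul :: "complex \<Rightarrow> 'a::banach \<Rightarrow> 'a" +
  assumes smul_of_real: "smul (complex_of_real r) x = r *\<^sub>R x"
    and norm_smul: "norm (smul c x) = cmod c * norm x"

definition linops :: "('k::field \<Rightarrow> 'a::real_normed_vector \<Rightarrow> 'a) \<Rightarrow> ('a \<Rightarrow>\<^sub>L 'a) set"
  where "linops smul = {T. Vector_Spaces.linear smul smul (blinfun_apply T)}"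

lemma linops_scaleR [simp]: "linops (*\<^sub>R) = UNIV"
  by (auto simp: linops_def linear_def[symmetric] blinfun.bounded_linear_right bounded_linear.linear)

subsection \<open>Spectrum\<close>

definition spectrum :: "(complex \<Rightarrow> 'a::real_normed_vector \<Rightarrow> 'a) \<Rightarrow> ('a \<Rightarrow>\<^sub>L 'a) \<Rightarrow> complex set"
  where "spectrum smul T =
    {z. \<not> (\<exists>S\<in>linops smul. (\<forall>x. S (T x - smul z x) = x) \<and> (\<forall>x. T (S x) - smul z (S x) = x))}"

text \<open>
  The complexification is modelled on the product, a pair \<open>(x, y)\<close> standing for \<open>x + \<i> y\<close>. The
  product norm is not complex-homogeneous, but it is equivalent to the usual complexification
  norms. Hence it gives the same bounded operators and the same spectrum.
\<close>

definition complexify_scale :: "complex \<Rightarrow> 'a::real_normed_vector \<times> 'a \<Rightarrow> 'a \<times> 'a"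
  where "complexify_scale c p =
    (Re c *\<^sub>R fst p - Im c *\<^sub>R snd p, Re c *\<^sub>R snd p + Im c *\<^sub>R fst p)"

lemma vector_space_complexify_scale: "vector_space complexify_scale"
  by unfold_locales (auto simp: complexify_scale_def algebra_simps)

definition complexify :: "('a::real_normed_vector \<Rightarrow>\<^sub>L 'a) \<Rightarrow> ('a \<times> 'a) \<Rightarrow>\<^sub>L ('a \<times> 'a)"
  where "complexify T = Blinfun (\<lambda>p. (T (fst p), T (snd p)))"

lemma complexify_apply [simp]: "complexify T p = (T (fst p), T (snd p))"
  unfolding complexify_def
  by (subst bounded_linear_Blinfun_apply) (auto intro!: bounded_linear_intros)

lemma complexify_in_linops: "complexify T \<in> linops complexify_scale"
  by (simp add: linops_def Vector_Spaces.linear_iff vector_space_complexify_scale)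
     (auto simp: complexify_scale_def blinfun.bilinear_simps)

definition real_spectrum :: "('a::real_normed_vector \<Rightarrow>\<^sub>L 'a) \<Rightarrow> complex set"
  where "real_spectrum T = spectrum complexify_scale (complexify T)"

subsection \<open>The space of asymptotically hyperbolic paths\<close>

text \<open>
  \<open>\<sigma>\<close> is the spectrum that goes with \<open>smul\<close>. Paths are extensional, so that two of them are equal
  as soon as they agree on \<open>[0, +\<infinity>)\<close>.
\<close>

definition C_h :: "('k::field \<Rightarrow> 'a::real_normed_vector \<Rightarrow> 'a) \<Rightarrow> (('a \<Rightarrow>\<^sub>L 'a) \<Rightarrow> complex set)
    \<Rightarrow> (real \<Rightarrow> 'a \<Rightarrow>\<^sub>L 'a) set"
  where "C_h smul \<sigma> = {A \<in> extensional {0..}.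
    A \<in> {0..} \<rightarrow> linops smul \<and> continuous_on {0..} A \<and>
    (\<exists>T\<in>linops smul. (A \<longlongrightarrow> T) at_top \<and> \<sigma> T \<inter> {z. Re z = 0} = {})}"

definition C_h_metric :: "('k::field \<Rightarrow> 'a::real_normed_vector \<Rightarrow> 'a) \<Rightarrow> (('a \<Rightarrow>\<^sub>L 'a) \<Rightarrow> complex set)
    \<Rightarrow> (real \<Rightarrow> 'a \<Rightarrow>\<^sub>L 'a) metric"
  where "C_h_metric smul \<sigma> =
    submetric (cfunspace (top_of_set {0..}) euclidean_metric) (C_h smul \<sigma>)"

lemma C_h_bounded:
  assumes "A \<in> C_h smul \<sigma>"
  shows "bounded (A ` {0..})"
proof -
  from assms obtain T where cont: "continuous_on {0..} A" and T: "(A \<longlongrightarrow> T) at_top"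
    by (auto simp: C_h_def)
  from tendstoD[OF T, of 1] obtain N where N: "\<And>t. t \<ge> N \<Longrightarrow> dist (A t) T < 1"
    by (auto simp: eventually_at_top_linorder)
  have "compact (A ` {0..N})"
    by (intro compact_continuous_image continuous_on_subset[OF cont]) auto
  then have "bounded (A ` {0..N} \<union> cball T 1)"
    by (simp add: compact_imp_bounded)
  moreover have "A ` {0..} \<subseteq> A ` {0..N} \<union> cball T 1"
  proof (intro image_subsetI)
    fix t :: real assume "t \<in> {0..}"
    then show "A t \<in> A ` {0..N} \<union> cball T 1"
      using N[of t] by (cases "t \<le> N") (auto simp: dist_commute less_imp_le)
  qed
  ultimately show ?thesis
    by (rule bounded_subset)
qed

lemma mspace_C_h_metric [simp]: "mspace (C_h_metric smul \<sigma>) = C_h smul \<sigma>"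
proof -
  have "Met_TC.mbounded (A ` {0..})" if "A \<in> C_h smul \<sigma>" for A
    using C_h_bounded[OF that] by simp
  then show ?thesis
    by (auto simp: C_h_metric_def C_h_def)
qed

lemma mdist_C_h_metric:
  assumes "A \<in> C_h smul \<sigma>" "B \<in> C_h smul \<sigma>"
  shows "mdist (C_h_metric smul \<sigma>) A B = (SUP t\<in>{0..}. norm (A t - B t))"
proof -
  have "A \<in> Met_TC.fspace {0..}" "B \<in> Met_TC.fspace {0..}"
    using assms C_h_bounded[OF assms(1)] C_h_bounded[OF assms(2)]
    by (auto simp: Met_TC.fspace_def C_h_def)
  then show ?thesis
    by (simp add: C_h_metric_def mdist_cfunspace_eq_mdist_funspace Met_TC.fdist_def dist_norm)
qed

subsection \<open>The stable space\<close>

text \<open>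
  The solution operator is the unique solution among the paths that are extensional on
  \<open>[0, +\<infinity>)\<close>. In the complex case it takes values in the complex linear operators.
\<close>

definition sol_op :: "(real \<Rightarrow> 'a::real_normed_vector \<Rightarrow>\<^sub>L 'a) \<Rightarrow> real \<Rightarrow> 'a \<Rightarrow>\<^sub>L 'a"
  where "sol_op A = (THE X. X \<in> extensional {0..} \<and> X 0 = id_blinfun \<and>
    (\<forall>t\<ge>0. (X has_vector_derivative (A t o\<^sub>L X t)) (at t within {0..})))"

definition stable_space :: "(real \<Rightarrow> 'a::real_normed_vector \<Rightarrow>\<^sub>L 'a) \<Rightarrow> 'a set"
  where "stable_space A = {x. ((\<lambda>t. sol_op A t x) \<longlongrightarrow> 0) at_top}"

subsection \<open>The Grassmannian of closed complemented subspaces\<close>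

definition G_s :: "('k::field \<Rightarrow> 'a::real_normed_vector \<Rightarrow> 'a) \<Rightarrow> 'a set set"
  where "G_s smul = {Y. module.subspace smul Y \<and> closed Y \<and>
    (\<exists>Z. module.subspace smul Z \<and> closed Z \<and> Y \<inter> Z = {0} \<and> {y + z | y z. y \<in> Y \<and> z \<in> Z} = UNIV)}"

text \<open>
  The case distinction only serves to make \<open>gap_dist\<close> nonnegative on all sets, as the locale
  \<^locale>\<open>Metric_space\<close> demands; it never applies to subspaces.
\<close>

definition gap_excess :: "'a::real_normed_vector set \<Rightarrow> 'a set \<Rightarrow> real"
  where "gap_excess Y Z = (if Y \<inter> cball 0 1 = {} then 0
    else (SUP y\<in>Y \<inter> cball 0 1. infdist y (Z \<inter> cball 0 1)))"

definition gap_dist :: "'a::real_normed_vector set \<Rightarrow> 'a set \<Rightarrow> real"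
  where "gap_dist Y Z = max (gap_excess Y Z) (gap_excess Z Y)"

definition G_s_metric :: "('k::field \<Rightarrow> 'a::real_normed_vector \<Rightarrow> 'a) \<Rightarrow> 'a set metric"
  where "G_s_metric smul = metric (G_s smul, gap_dist)"

lemma gap_excess_eq:
  assumes "0 \<in> Y"
  shows "gap_excess Y Z = (SUP y\<in>Y \<inter> cball 0 1. infdist y (Z \<inter> cball 0 1))"
proof -
  have "0 \<in> Y \<inter> cball 0 1"
    using assms by simp
  then show ?thesis
    unfolding gap_excess_def by (metis empty_iff)
qed

lemma infdist_le_gap_excess:
  assumes "y \<in> Y" "norm y \<le> 1"
  shows "infdist y (Z \<inter> cball 0 1) \<le> gap_excess Y Z"
proof -
  have y: "y \<in> Y \<inter> cball 0 1"
    using assms by simp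
  have "infdist x (Z \<inter> cball 0 1) \<le> 2" if "norm x \<le> 1" for x
  proof (cases "Z \<inter> cball 0 1 = {}")
    case False
    then obtain z where z: "z \<in> Z \<inter> cball 0 1"
      by blast
    have "dist x z \<le> 2"
      using that z norm_triangle_ineq4[of x z] by (simp add: dist_norm)
    then show ?thesis
      using z by (rule infdist_le2[rotated])
  qed (simp add: infdist_def)
  then have "bdd_above ((\<lambda>y. infdist y (Z \<inter> cball 0 1)) ` (Y \<inter> cball 0 1))"
    by (intro bdd_aboveI2[where M = 2]) auto
  with y have "infdist y (Z \<inter> cball 0 1) \<le> (SUP y\<in>Y \<inter> cball 0 1. infdist y (Z \<inter> cball 0 1))"
    by (intro cSUP_upper)
  moreover have "Y \<inter> cball 0 1 \<noteq> {}"
    using y by blast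
  ultimately show ?thesis
    by (simp only: gap_excess_def if_False)
qed

lemma gap_excess_nonneg: "0 \<le> gap_excess Y Z"
proof (cases "Y \<inter> cball 0 1 = {}")
  case True
  then show ?thesis
    by (simp add: gap_excess_def)
next
  case False
  then obtain y where "y \<in> Y" "norm y \<le> 1"
    by auto
  then show ?thesis
    using infdist_le_gap_excess[of y Y Z] infdist_nonneg[of y "Z \<inter> cball 0 1"] by linarith
qed

lemma gap_excess_triangle:
  assumes "0 \<in> X" "0 \<in> Y" "0 \<in> Z"
  shows "gap_excess X Z \<le> gap_excess X Y + gap_excess Y Z"
  unfolding gap_excess_eq[OF assms(1), of Z]
proof (rule cSUP_least)
  fix x assume x: "x \<in> X \<inter> cball 0 1"
  have "infdist x (Z \<inter> cball 0 1) - gap_excess Y Z \<le> infdist x (Y \<inter> cball 0 1)"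
  proof (subst (2) infdist_notempty, use assms in force, rule cINF_greatest, use assms in force)
    fix y assume y: "y \<in> Y \<inter> cball 0 1"
    have "infdist x (Z \<inter> cball 0 1) \<le> infdist y (Z \<inter> cball 0 1) + dist x y"
      by (rule infdist_triangle)
    moreover have "infdist y (Z \<inter> cball 0 1) \<le> gap_excess Y Z"
      using y assms by (intro infdist_le_gap_excess) auto
    ultimately show "infdist x (Z \<inter> cball 0 1) - gap_excess Y Z \<le> dist x y"
      by simp
  qed
  moreover have "infdist x (Y \<inter> cball 0 1) \<le> gap_excess X Y"
    using x assms by (intro infdist_le_gap_excess) auto
  ultimately show "infdist x (Z \<inter> cball 0 1) \<le> gap_excess X Y + gap_excess Y Z"
    by simp
qed (use assms in force)

lemma gap_excess_eq_0_imp_subset: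
  assumes Y: "subspace Y" and Z: "subspace Z" "closed Z" and 0: "gap_excess Y Z \<le> 0"
  shows "Y \<subseteq> Z"
proof
  fix y assume y: "y \<in> Y"
  define u where "u = inverse (1 + norm y) *\<^sub>R y"
  have n: "1 + norm y > 0"
    by (simp add: add_pos_nonneg)
  have u: "u \<in> Y" "norm u \<le> 1"
    using y n by (auto simp: u_def Y subspace_scale field_simps)
  have "infdist u (Z \<inter> cball 0 1) \<le> 0"
    using infdist_le_gap_excess[OF u, of Z] 0 by simp
  then have "infdist u (Z \<inter> cball 0 1) = 0"
    using infdist_nonneg[of u] by (simp add: antisym)
  moreover have "closed (Z \<inter> cball 0 1)" "Z \<inter> cball 0 1 \<noteq> {}"
    using Z subspace_0[OF Z(1)] by (auto intro!: exI[of _ 0])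
  ultimately have "u \<in> Z"
    using in_closed_iff_infdist_zero by blast
  then have "(1 + norm y) *\<^sub>R u \<in> Z"
    by (simp add: Z subspace_scale)
  then show "y \<in> Z"
    using n by (simp add: u_def)
qed

lemma gap_excess_self:
  assumes "0 \<in> Y"
  shows "gap_excess Y Y = 0"
proof -
  have "gap_excess Y Y = (SUP y\<in>Y \<inter> cball 0 1. 0)"
    unfolding gap_excess_eq[OF assms] by (rule SUP_cong) auto
  also have "\<dots> = 0"
    using assms by (intro cSUP_const) force
  finally show ?thesis .
qed

lemma Metric_space_gap_dist: "Metric_space {Y. subspace Y \<and> closed Y} gap_dist"
proof
  fix X Y Z :: "'a set"
  assume "X \<in> {Y. subspace Y \<and> closed Y}" "Y \<in> {Y. subspace Y \<and> closed Y}"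
    "Z \<in> {Y. subspace Y \<and> closed Y}"
  then show "gap_dist X Z \<le> gap_dist X Y + gap_dist Y Z"
    using gap_excess_triangle[of X Y Z] gap_excess_triangle[of Z Y X]
    by (auto simp: gap_dist_def subspace_0)
next
  fix X Y :: "'a set"
  assume "X \<in> {Y. subspace Y \<and> closed Y}" "Y \<in> {Y. subspace Y \<and> closed Y}"
  then have X: "subspace X" "closed X" and Y: "subspace Y" "closed Y"
    by auto
  show "gap_dist X Y = 0 \<longleftrightarrow> X = Y"
  proof
    assume "gap_dist X Y = 0"
    then have "gap_excess X Y \<le> 0" "gap_excess Y X \<le> 0"
      by (auto simp: gap_dist_def max_def split: if_splits)
    then show "X = Y"
      using gap_excess_eq_0_imp_subset X Y by blast
  next
    assume "X = Y"
    then show "gap_dist X Y = 0"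
      by (simp add: gap_dist_def gap_excess_self subspace_0 Y)
  qed
next
  fix X Y :: "'a set"
  show "gap_dist X Y = gap_dist Y X"
    by (simp add: gap_dist_def max.commute)
  show "0 \<le> gap_dist X Y"
    using gap_excess_nonneg[of X Y] by (auto simp: gap_dist_def)
qed

lemma Metric_space_G_s:
  assumes "\<And>Y. module.subspace smul Y \<Longrightarrow> subspace Y"
  shows "Metric_space (G_s smul) gap_dist"
  by (rule Metric_space.subspace[OF Metric_space_gap_dist]) (auto simp: G_s_def assms)

lemma Metric_space_G_s_real: "Metric_space (G_s (*\<^sub>R)) gap_dist"
  by (rule Metric_space_G_s) (simp add: subspace_raw_def)

lemma (in complex_banach) Metric_space_G_s_complex: "Metric_space (G_s smul) gap_dist"
proof (rule Metric_space_G_s)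
  fix Y assume "module.subspace smul Y"
  then have Y: "subspace Y" .
  show "Real_Vector_Spaces.subspace Y"
  proof (rule real_vector.subspaceI)
    fix c :: real and x assume "x \<in> Y"
    then show "c *\<^sub>R x \<in> Y"
      using subspace_scale[OF Y, of x "complex_of_real c"] by (simp add: smul_of_real)
  qed (use Y in \<open>auto simp: subspace_def\<close>)
qed

end

theory Submission
  imports Defs
begin

text \<open>
  Write \<open>X\<^sub>A\<close> for the solution operator of \<open>X' = A X\<close> and \<open>T\<close> for the limit of the path \<open>A\<close>.
  The stable space of \<open>A\<close> is a graph over the stable space of the constant path \<open>T\<close>, pulled back
  along the isomorphism \<open>X\<^sub>A(t\<^sub>0)\<close> for a late time \<open>t\<^sub>0\<close>. The graph and the isomorphism both depend on
  \<open>A\<close> in a locally Lipschitz way, hence so does the stable space.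

  The first ingredient is the exponential dichotomy of \<open>T\<close>: a projection \<open>P\<close> that commutes with
  everything commuting with \<open>T\<close> such that, at some time \<open>\<tau>\<close>, \<open>e\<^bsup>\<tau>T\<^esup>\<close> is a strong contraction on the
  range of \<open>P\<close> and its inverse is one on the kernel of \<open>P\<close>. Usually \<open>P\<close> is a Riesz projection, but here
  no holomorphic functional calculus is used. The spectrum of \<open>T\<close> avoids the imaginary axis iff
  \<open>T\<^sup>2 + w\<^sup>2\<close> is invertible for every real \<open>w\<close> (on the real space itself, so that the real and the
  complex case become one; complex linearity is just commutation with certain operators). Now
  \<open>P\<close> is the limit of \<open>(1 - e\<^bsup>tT\<^esup>)\<^bsup>-1\<^esup>\<close> as \<open>t \<rightarrow> \<infinity>\<close>, because \<open>1 / (1 - e\<^bsup>tz\<^esup>)\<close> tends to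
  \<open>1\<close> for \<open>Re z < 0\<close> and to \<open>0\<close> for \<open>Re z > 0\<close>. The inverse is controlled by the partial fractions of the
  hyperbolic cotangent,
  \<open>1 / (1 - e\<^bsup>S\<^esup>) = 1/2 - \<Sum> S / (S\<^sup>2 + (2 \<pi> k)\<^sup>2)\<close>, summed over all integers \<open>k\<close>, which comes
  from evaluating the Fourier series of \<open>s \<mapsto> e\<^bsup>sS\<^esup>\<close> on \<open>[0, 1]\<close> at its jump; Cesaro summation with
  the Fejer kernel proves it for operators (\<open>one_minus_expo_inverse\<close>). For \<open>S = t (T + e)\<close> the sum is a
  Riemann sum, which gives bounds uniform in \<open>t\<close> and Lipschitz in the shift \<open>e\<close>
  (\<open>periodic_resolvent_bound\<close>). Purely algebraic identities between the inverses then yield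
  convergence, idempotency and independence of \<open>e\<close> of the limit, and comparing the shifts \<open>e > 0\<close> and
  \<open>- e < 0\<close> yields exponential rates (\<open>exponential_dichotomy\<close>).

  The second ingredient is a Lyapunov-Perron argument in discrete time. After a late time \<open>t\<^sub>0\<close> the
  transition operators of every path near \<open>A\<close> over intervals of length \<open>\<tau>\<close> are close to
  \<open>e\<^bsup>\<tau>T\<^esup>\<close>. For such a recursion the bounded orbits tend to \<open>0\<close>, and their initial values
  are parametrized by the range of \<open>P\<close>; both facts come from one contraction estimate
  (\<open>bounded_solution_bound\<close>, \<open>ex_bounded_orbit\<close>), which also measures how the initial value moves
  with the recursion (\<open>bounded_orbits_diff\<close>). Therefore the stable space is closed, the preimage of the
  kernel of \<open>P\<close> is a closed complement, and two nearby paths have nearby stable spaces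
  (\<open>stable_space_Lipschitz\<close>).
\<close>

section \<open>Hyperbolic elements of a Banach algebra\<close>

text \<open>
  The class \<^class>\<open>ring_1\<close> would demand \<open>0 \<noteq> 1\<close>, which excludes the operators on the zero space.
  For the same reason \<open>norm 1 = 1\<close> is not demanded, and \<open>norm 1\<close> occurs in the constants below.
\<close>

class unital_banach_algebra = real_normed_algebra + monoid_mult + banach

definition inverses :: "'a::{ring, monoid_mult} \<Rightarrow> 'a \<Rightarrow> bool"
  where "inverses a b \<longleftrightarrow> a * b = 1 \<and> b * a = 1"

lemma inverses_mult:
  assumes "inverses a b" "inverses c d"
  shows "inverses (a * c) (d * b)"
proof -
  have "a * c * (d * b) = a * (c * d) * b" "d * b * (a * c) = d * (b * a) * c"
    by (simp_all only: mult.assoc)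
  then show ?thesis using assms by (simp add: inverses_def)
qed

lemma inverses_commute:
  assumes ab: "inverses a b" and ca: "c * a = a * c"
  shows "c * b = b * c"
proof -
  have "c * b = b * a * (c * b)" using ab by (simp add: inverses_def)
  also have "\<dots> = b * (a * c) * b" by (simp only: mult.assoc)
  also have "\<dots> = b * c * (a * b)" by (simp only: ca[symmetric] mult.assoc)
  also have "\<dots> = b * c" using ab by (simp add: inverses_def)
  finally show ?thesis .
qed

text \<open>
  The one-sided inverses are the fixed points of \<open>b \<mapsto> 1 + x b\<close> and \<open>c \<mapsto> 1 + c x\<close>, two contractions.
\<close>

lemma inverses_one_minus:
  fixes x :: "'a::unital_banach_algebra"
  assumes x: "norm x < 1"
  shows "\<exists>b. inverses (1 - x) b"
proof -
  have "dist (1 + x * u) (1 + x * v) \<le> norm x * dist u v" for u v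
    by (simp add: dist_norm right_diff_distrib[symmetric] norm_mult_ineq)
  then have "\<exists>!b. 1 + x * b = b"
    using x by (intro banach_fix_type[where c = "norm x"]) auto
  then obtain b where b: "1 + x * b = b" by blast
  have "dist (1 + u * x) (1 + v * x) \<le> norm x * dist u v" for u v
    using norm_mult_ineq[of "u - v" x]
    by (simp add: dist_norm left_diff_distrib[symmetric] mult.commute)
  then have "\<exists>!c. 1 + c * x = c"
    using x by (intro banach_fix_type[where c = "norm x"]) auto
  then obtain c where c: "1 + c * x = c" by blast
  have 1: "(1 - x) * b = 1" using b by (simp add: algebra_simps)
  have 2: "c * (1 - x) = 1" using c by (simp add: algebra_simps)
  have "c = c * ((1 - x) * b)" by (simp add: 1)
  also have "\<dots> = b" by (simp only: mult.assoc[symmetric] 2 mult_1_left)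
  finally show ?thesis using 1 2 by (auto simp: inverses_def)
qed

text \<open>
  Factor \<open>c = a (1 - x)\<close> with \<open>x = - b (c - a)\<close> of norm at most \<open>1 / 2\<close>.
\<close>

lemma inverses_perturb:
  fixes a :: "'a::unital_banach_algebra"
  assumes ab: "inverses a b" and c: "norm b * norm (c - a) \<le> 1 / 2"
  obtains d where "inverses c d" "norm d \<le> 2 * norm b"
proof -
  define x where "x = - (b * (c - a))"
  have x: "norm x \<le> 1 / 2"
    using c norm_mult_ineq[of b "c - a"] by (simp add: x_def)
  then obtain e where e: "inverses (1 - x) e"
    using inverses_one_minus[of x] by auto
  have "a * (b * (c - a)) = c - a"
    using ab by (simp add: inverses_def mult.assoc[symmetric])
  then have "c = a * (1 - x)"
    by (simp add: x_def algebra_simps)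
  then have inv: "inverses c (e * b)"
    using inverses_mult[OF ab e] by simp
  have "e = 1 + x * e" using e by (simp add: inverses_def algebra_simps)
  then have "e * b = b + x * (e * b)" by (metis distrib_right mult.assoc mult_1_left)
  then have "norm (e * b) \<le> norm b + norm x * norm (e * b)"
    by (metis norm_mult_ineq norm_triangle_le add_left_mono)
  also have "\<dots> \<le> norm b + 1 / 2 * norm (e * b)"
    using x by (intro add_left_mono mult_right_mono) auto
  finally show thesis using inv by (intro that) auto
qed

text \<open>
  For an operator this says that the spectrum of its complexification misses the imaginary axis,
  since \<open>T\<^sup>2 + w\<^sup>2 = (T - i w) (T + i w)\<close>.
\<close>

definition hyperbolic :: "'a::{real_normed_algebra, monoid_mult} \<Rightarrow> bool"
  where "hyperbolic T \<longleftrightarrow> (\<forall>w::real. \<exists>R. inverses (T * T + w\<^sup>2 *\<^sub>R 1) R)"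

lemma hyperbolic_local_bound:
  fixes T :: "'a::unital_banach_algebra"
  assumes "hyperbolic T"
  shows "\<exists>C. \<exists>r>0. \<forall>S v. norm (S - T) < r \<longrightarrow> \<bar>v - w\<bar> < r \<longrightarrow>
    (\<exists>R. inverses (S * S + v\<^sup>2 *\<^sub>R 1) R \<and> norm R \<le> C)"
proof -
  obtain R0 where R0: "inverses (T * T + w\<^sup>2 *\<^sub>R 1) R0"
    using assms by (auto simp: hyperbolic_def)
  define f where "f p = norm R0 * norm ((fst p * fst p + (snd p)\<^sup>2 *\<^sub>R 1) - (T * T + w\<^sup>2 *\<^sub>R 1))"
    for p :: "'a \<times> real"
  have "continuous_on UNIV f"
    unfolding f_def by (intro continuous_intros)
  then have "open (f -` {..<1/2})"
    by (simp add: open_vimage)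
  moreover have "(T, w) \<in> f -` {..<1/2}" by (simp add: f_def)
  ultimately obtain r where r: "r > 0" "ball (T, w) r \<subseteq> f -` {..<1/2}"
    by (meson openE)
  show ?thesis
  proof (rule exI[of _ "2 * norm R0"], rule exI[of _ "r / 2"], safe)
    fix S :: 'a and v :: real assume S: "norm (S - T) < r / 2" and v: "\<bar>v - w\<bar> < r / 2"
    have "dist (T, w) (S, v) \<le> dist T S + dist w v"
      using sqrt_sum_squares_le_sum[of "dist T S" "dist w v"] by (simp add: dist_Pair_Pair)
    then have "dist (T, w) (S, v) < r"
      using S v by (simp add: dist_norm[of T S] norm_minus_commute[of T S] dist_real_def abs_minus_commute)
    then have "f (S, v) \<le> 1 / 2" using r by (force simp: subset_iff)
    then show "\<exists>R. inverses (S * S + v\<^sup>2 *\<^sub>R 1) R \<and> norm R \<le> 2 * norm R0"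
      using inverses_perturb[OF R0] unfolding f_def fst_conv snd_conv by metis
  qed (use r in auto)
qed

text \<open>
  For large \<open>w\<close> the element \<open>S\<^sup>2 + w\<^sup>2\<close> is a small relative perturbation of \<open>w\<^sup>2\<close>.
\<close>

lemma hyperbolic_far_bound:
  fixes S :: "'a::unital_banach_algebra"
  assumes S: "norm S \<le> m" and w: "2 * norm (1::'a) * m\<^sup>2 \<le> w\<^sup>2" "w \<noteq> 0"
  shows "\<exists>R. inverses (S * S + w\<^sup>2 *\<^sub>R 1) R \<and> norm R \<le> 2 * norm (1::'a) / w\<^sup>2"
proof -
  have inv: "inverses (w\<^sup>2 *\<^sub>R 1) ((1 / w\<^sup>2) *\<^sub>R (1::'a))"
    using w by (simp add: inverses_def)
  have "norm ((1 / w\<^sup>2) *\<^sub>R (1::'a)) * norm (S * S) \<le> norm (1::'a) / w\<^sup>2 * m\<^sup>2"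
  proof (intro mult_mono)
    show "norm (S * S) \<le> m\<^sup>2"
      using norm_mult_ineq[of S S] power_mono[OF S, of 2] by (simp add: power2_eq_square)
  qed (auto simp: divide_simps)
  also have "\<dots> \<le> 1 / 2" using w by (simp add: field_simps)
  finally obtain d where d: "inverses (S * S + w\<^sup>2 *\<^sub>R 1) d"
      "norm d \<le> 2 * norm ((1 / w\<^sup>2) *\<^sub>R (1::'a))"
    using inverses_perturb[OF inv, of "S * S + w\<^sup>2 *\<^sub>R 1"] by auto
  then show ?thesis by (intro exI[of _ d]) (auto simp: field_simps)
qed

text \<open>
  Compactness of an interval \<open>[-W, W]\<close> makes the local bounds uniform there, and the bound for large
  \<open>w\<close> gives the decay outside. The decay makes the sums over frequencies converge later on; the
  neighbourhood of \<open>T\<close> allows the spectral shifts \<open>T + e\<close>.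
\<close>

lemma hyperbolic_uniform_bound:
  fixes T :: "'a::unital_banach_algebra"
  assumes T: "hyperbolic T"
  obtains C r where "C > 0" "r > 0"
    "\<And>S w. norm (S - T) < r \<Longrightarrow> \<exists>R. inverses (S * S + w\<^sup>2 *\<^sub>R 1) R \<and> norm R \<le> C / (1 + w\<^sup>2)"
proof -
  define m where "m = norm T + 1"
  define W where "W = 1 + 2 * norm (1::'a) * m\<^sup>2"
  have W: "W \<ge> 1" by (simp add: W_def)
  obtain C r where Cr: "\<And>w. r w > (0::real)" "\<And>w S v. norm (S - T) < r w \<Longrightarrow> \<bar>v - w\<bar> < r w \<Longrightarrow>
    \<exists>R. inverses (S * S + v\<^sup>2 *\<^sub>R 1) R \<and> norm R \<le> C w"
    using hyperbolic_local_bound[OF T] by metis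
  have "compact {-W..W}" by simp
  then obtain D where D: "D \<subseteq> {-W..W}" "finite D" "{-W..W} \<subseteq> (\<Union>w\<in>D. ball w (r w))"
    by (rule compactE_image[where f = "\<lambda>w. ball w (r w)" and C = "{-W..W}"]) (use Cr(1) in auto)
  define r0 where "r0 = Min (insert 1 (r ` D))"
  define C0 where "C0 = Max (insert 1 (C ` D))"
  have r0: "r0 > 0" "r0 \<le> 1" "\<And>w. w \<in> D \<Longrightarrow> r0 \<le> r w"
    using D(2) Cr(1) by (auto simp: r0_def)
  have C0: "C0 \<ge> 1" "\<And>w. w \<in> D \<Longrightarrow> C w \<le> C0"
    using D(2) by (auto simp: C0_def)
  define K where "K = C0 * (1 + W\<^sup>2) + 4 * norm (1::'a)"
  have K: "K > 0" using C0 by (auto simp: K_def intro!: add_pos_nonneg mult_pos_pos)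
  show thesis
  proof (rule that[OF K r0(1)])
    fix S :: 'a and w :: real assume S: "norm (S - T) < r0"
    show "\<exists>R. inverses (S * S + w\<^sup>2 *\<^sub>R 1) R \<and> norm R \<le> K / (1 + w\<^sup>2)"
    proof (cases "\<bar>w\<bar> \<le> W")
      case True
      then have "w \<in> {-W..W}" by auto
      then obtain v where v: "v \<in> D" "dist v w < r v" using D(3) by auto
      then obtain R where R: "inverses (S * S + w\<^sup>2 *\<^sub>R 1) R" "norm R \<le> C v"
        using Cr(2)[of S v w] S r0(3)[OF v(1)] by (auto simp: dist_real_def abs_minus_commute)
      have w2: "w\<^sup>2 \<le> W\<^sup>2" using True W by (metis abs_ge_zero power2_abs power_mono)
      have "norm R * (1 + w\<^sup>2) \<le> C0 * (1 + W\<^sup>2)"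
        using R(2) C0(2)[OF v(1)] C0(1) w2 by (intro mult_mono) auto
      also have "\<dots> \<le> K" by (simp add: K_def)
      finally show ?thesis
        using R(1) by (intro exI[of _ R]) (simp add: field_simps add_pos_nonneg)
    next
      case False
      then have w1: "\<bar>w\<bar> \<ge> W" by simp
      have "W \<le> W\<^sup>2" using W by (simp add: self_le_power)
      also have "W\<^sup>2 \<le> w\<^sup>2" using w1 W by (metis power2_abs power_mono order.trans zero_le_one)
      finally have w2: "W \<le> w\<^sup>2" .
      have "norm S \<le> m" using S r0(2) norm_triangle_sub[of S T] by (simp add: m_def)
      moreover have "2 * norm (1::'a) * m\<^sup>2 \<le> w\<^sup>2" using w2 by (simp add: W_def)
      ultimately obtain R where R: "inverses (S * S + w\<^sup>2 *\<^sub>R 1) R" "norm R \<le> 2 * norm (1::'a) / w\<^sup>2"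
        using hyperbolic_far_bound[of S m w] W w1 by fastforce
      have "2 * norm (1::'a) / w\<^sup>2 * (1 + w\<^sup>2) \<le> 4 * norm (1::'a)"
      proof -
        have "norm (1::'a) * (1 + w\<^sup>2) \<le> norm (1::'a) * (2 * w\<^sup>2)"
          using w2 W by (intro mult_left_mono) auto
        moreover have "w\<^sup>2 > 0" using w2 W by linarith
        ultimately show ?thesis by (simp add: field_simps)
      qed
      moreover have "norm R * (1 + w\<^sup>2) \<le> 2 * norm (1::'a) / w\<^sup>2 * (1 + w\<^sup>2)"
        using R(2) by (intro mult_right_mono) auto
      ultimately have "norm R * (1 + w\<^sup>2) \<le> K" using C0 by (auto simp: K_def intro: order.trans)
      then show ?thesis
        using R(1) by (intro exI[of _ R]) (simp add: field_simps add_pos_nonneg)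
    qed
  qed
qed

section \<open>Linear differential equations in a Banach algebra\<close>

lemma increment_bound:
  fixes f :: "real \<Rightarrow> 'a::real_normed_vector"
  assumes b: "b \<ge> 0"
    and f: "\<And>t. t \<in> {0..b} \<Longrightarrow> (f has_vector_derivative f' t) (at t within {0..b})"
    and g: "\<And>t. t \<in> {0..b} \<Longrightarrow> (g has_real_derivative g' t) (at t within {0..b})"
    and le: "\<And>t. t \<in> {0..b} \<Longrightarrow> norm (f' t) \<le> g' t"
  shows "norm (f b - f 0) \<le> g b - g 0"
proof (cases "b = 0")
  case False
  then have b: "0 < b" using b by simp
  have int: "at t within {0..b} = at t" if "0 < t" "t < b" for t :: real
    using that by (intro at_within_interior) auto
  show ?thesis
  proof (rule differentiable_bound_general[OF b])
    show "continuous_on {0..b} f"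
      using f by (rule continuous_on_vector_derivative)
    show "continuous_on {0..b} g"
      using g by (rule DERIV_continuous_on)
    fix t assume t: "0 < t" "t < b"
    show "(f has_vector_derivative f' t) (at t)" using f[of t] t by (simp add: int)
    show "(g has_vector_derivative g' t) (at t)"
      using g[of t] t by (simp add: int has_real_derivative_iff_has_vector_derivative)
    show "norm (f' t) \<le> g' t" using le t by simp
  qed
qed simp

text \<open>
  The maximum \<open>m\<close> of \<open>e\<^bsup>-2Kt\<^esup> \<parallel>Y(t)\<parallel>\<close> satisfies \<open>m \<le> \<parallel>Y(0)\<parallel> + c b + m / 2\<close>, by integrating the hypothesis.
  The weight \<open>2 K\<close> in place of \<open>K\<close> costs a factor in the constant, but makes the term with \<open>m\<close>
  absorbable.
\<close>

lemma gronwall: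
  fixes Y :: "real \<Rightarrow> 'a::real_normed_vector"
  assumes b: "0 \<le> b" and K: "0 \<le> K" and c: "0 \<le> c"
    and Y: "\<And>t. t \<in> {0..b} \<Longrightarrow> (Y has_vector_derivative Y' t) (at t within {0..b})"
    and le: "\<And>t. t \<in> {0..b} \<Longrightarrow> norm (Y' t) \<le> K * norm (Y t) + c"
  shows "norm (Y b) \<le> 2 * (norm (Y 0) + c * b) * exp (2 * K * b)"
proof -
  \<comment> \<open>The weighted norm whose maximum is to be estimated.\<close>
  define \<phi> where "\<phi> t = exp (- (2 * K * t)) * norm (Y t)" for t
  have contY: "continuous_on {0..b} Y"
    using Y by (rule continuous_on_vector_derivative)
  have "continuous_on {0..b} \<phi>"
    unfolding \<phi>_def by (intro continuous_intros contY)
  then obtain u where u: "u \<in> {0..b}" "\<And>t. t \<in> {0..b} \<Longrightarrow> \<phi> t \<le> \<phi> u"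
    using continuous_attains_sup[of "{0..b}" \<phi>] b by auto
  define m where "m = \<phi> u"
  have Ym: "norm (Y t) \<le> m * exp (2 * K * t)" if "t \<in> {0..b}" for t
    using u(2)[OF that] by (simp add: m_def \<phi>_def exp_minus field_simps)
  have m0: "0 \<le> m" by (simp add: m_def \<phi>_def)
  have "norm (Y u - Y 0) \<le> (m / 2 * exp (2 * K * u) + c * u) - (m / 2 * exp (2 * K * 0) + c * 0)"
  proof (rule increment_bound)
    show "(Y has_vector_derivative Y' t) (at t within {0..u})" if "t \<in> {0..u}" for t
      using that u(1) by (intro has_vector_derivative_within_subset[OF Y]) auto
    show "((\<lambda>t. m / 2 * exp (2 * K * t) + c * t) has_real_derivative (K * (m * exp (2 * K * t)) + c))
            (at t within {0..u})" for t
      by (auto intro!: derivative_eq_intros)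
    show "norm (Y' t) \<le> K * (m * exp (2 * K * t)) + c" if "t \<in> {0..u}" for t
    proof -
      have t: "t \<in> {0..b}" using that u(1) by auto
      show ?thesis using le[OF t] mult_left_mono[OF Ym[OF t] K] by linarith
    qed
  qed (use u in auto)
  then have "norm (Y u) \<le> norm (Y 0) + m / 2 * exp (2 * K * u) + c * u"
    using norm_triangle_sub[of "Y u" "Y 0"] m0 by simp
  also have "\<dots> \<le> norm (Y 0) + m / 2 * exp (2 * K * u) + c * b"
    using u(1) c by (auto intro: mult_left_mono)
  finally have Yu: "norm (Y u) \<le> norm (Y 0) + m / 2 * exp (2 * K * u) + c * b" .
  have "norm (Y 0) + c * b \<le> (norm (Y 0) + c * b) * exp (2 * K * u)"
  proof -
    have "1 \<le> exp (2 * K * u)" "0 \<le> norm (Y 0) + c * b" using b c K u(1) by auto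
    then show ?thesis using mult_left_mono[of 1 "exp (2 * K * u)"] by fastforce
  qed
  then have "norm (Y u) \<le> (norm (Y 0) + c * b + m / 2) * exp (2 * K * u)"
    using Yu by (simp add: algebra_simps)
  then have "m \<le> norm (Y 0) + c * b + m / 2"
    by (simp add: m_def \<phi>_def exp_minus divide_simps mult.commute)
  then have "m \<le> 2 * (norm (Y 0) + c * b)" by simp
  then have "m * exp (2 * K * b) \<le> 2 * (norm (Y 0) + c * b) * exp (2 * K * b)"
    by (intro mult_right_mono) auto
  moreover have "norm (Y b) \<le> m * exp (2 * K * b)" using Ym[of b] b by simp
  ultimately show ?thesis by (rule order.trans[rotated])
qed

definition bounded_path :: "(real \<Rightarrow> 'a::real_normed_vector) \<Rightarrow> real \<Rightarrow> bool"
  where "bounded_path A K \<longleftrightarrow> continuous_on {0..} A \<and> (\<forall>t\<ge>0. norm (A t) \<le> K)"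

lemma bounded_path_nonneg: "bounded_path A K \<Longrightarrow> 0 \<le> K"
  unfolding bounded_path_def by (metis norm_ge_zero order.trans order_refl)

lemma bounded_path_const: "bounded_path (\<lambda>_. c) (norm c)"
  by (simp add: bounded_path_def)

lemma bounded_path_shift: "bounded_path A K \<Longrightarrow> 0 \<le> s \<Longrightarrow> bounded_path (\<lambda>u. A (s + u)) K"
  unfolding bounded_path_def
  by (auto intro!: continuous_intros continuous_on_compose2[where f = "\<lambda>u. s + u" and g = A])

lemma bounded_path_reverse: "bounded_path A K \<Longrightarrow> bounded_path (\<lambda>u. - A (max 0 (b - u))) K"
  unfolding bounded_path_def
  by (auto intro!: continuous_intros continuous_on_compose2[where f = "\<lambda>u. max 0 (b - u)" and g = A])

definition fundamental_solution :: "(real \<Rightarrow> 'a::{real_normed_algebra, monoid_mult}) \<Rightarrow> (real \<Rightarrow> 'a) \<Rightarrow> bool"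
  where "fundamental_solution A X \<longleftrightarrow> X 0 = 1 \<and>
    (\<forall>t\<ge>0. (X has_vector_derivative A t * X t) (at t within {0..}))"

lemma has_vector_derivative_antiderivative:
  fixes f :: "real \<Rightarrow> 'a::banach"
  assumes f: "continuous_on {0..} f" and t: "0 \<le> t"
  shows "((\<lambda>u. integral {0..u} f) has_vector_derivative f t) (at t within {0..})"
proof -
  have "((\<lambda>u. integral {0..u} f) has_vector_derivative f t) (at t within {0..t+1})"
    by (rule integral_has_vector_derivative) (use t in \<open>auto intro: continuous_on_subset[OF f]\<close>)
  moreover have "at t within {0..t+1} = at t within {0..}"
    by (rule at_within_nhd[where S = "{..<t+1}"]) auto
  ultimately show ?thesis by simp
qed

lemma weighted_integral_bound:
  fixes f :: "real \<Rightarrow> 'a::banach"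
  assumes f: "continuous_on {0..} f" and p: "0 \<le> p"
    and le: "\<And>s. 0 \<le> s \<Longrightarrow> norm (f s) \<le> K * m * exp (2 * K * s)" and m: "0 \<le> m"
  shows "exp (- (2 * K * p)) * norm (integral {0..p} f) \<le> m / 2"
proof -
  have "norm (integral {0..p} f - integral {0..0} f) \<le> m / 2 * exp (2 * K * p) - m / 2 * exp (2 * K * 0)"
  proof (rule increment_bound[OF p])
    show "((\<lambda>u. integral {0..u} f) has_vector_derivative f t) (at t within {0..p})" if "t \<in> {0..p}" for t
      by (rule has_vector_derivative_within_subset[OF has_vector_derivative_antiderivative[OF f]])
         (use that in auto)
    show "((\<lambda>t. m / 2 * exp (2 * K * t)) has_real_derivative (K * m * exp (2 * K * t)))
            (at t within {0..p})" for t
      by (auto intro!: derivative_eq_intros)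
  qed (use le in auto)
  then have "norm (integral {0..p} f) \<le> m / 2 * exp (2 * K * p)" using m by simp
  then show ?thesis by (simp add: exp_minus field_simps)
qed

text \<open>
  The integral equation is solved on the whole half line at once: in the unknown
  \<open>Y(t) = e\<^bsup>-2Kt\<^esup> X(t)\<close> it is a fixed point equation for a contraction, with constant
  \<open>1 / 2\<close>, of the space of bounded continuous functions.
\<close>

lemma fundamental_solution_exists:
  fixes A :: "real \<Rightarrow> 'a::unital_banach_algebra"
  assumes A0: "bounded_path A K0"
  shows "\<exists>X. fundamental_solution A X"
proof -
  define K where "K = K0 + 1"
  have K: "K > 0" and A: "continuous_on {0..} A" "\<And>t. 0 \<le> t \<Longrightarrow> norm (A t) \<le> K"
    using A0 bounded_path_nonneg[OF A0] by (auto simp: K_def bounded_path_def intro: add_increasing2)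
  define F where "F Y s = exp (2 * K * s) *\<^sub>R (A s * apply_bcontfun Y s)" for Y :: "real \<Rightarrow>\<^sub>C 'a" and s
  define G where "G Y p = exp (- (2 * K * p)) *\<^sub>R (1 + integral {0..p} (F Y))" for Y p
  have contF: "continuous_on {0..} (F Y)" for Y
    unfolding F_def by (intro continuous_intros A(1)) auto
  have intF: "F Y integrable_on {0..p}" for Y p
    by (intro integrable_continuous_real continuous_on_subset[OF contF]) auto
  have bound: "norm (F Y s) \<le> K * norm Y * exp (2 * K * s)" if "0 \<le> s" for Y s
  proof -
    have "norm (A s * apply_bcontfun Y s) \<le> K * norm Y"
      using A(2)[OF that] norm_bounded[of Y s] K
      by (intro order.trans[OF norm_mult_ineq] mult_mono) auto
    then show ?thesis by (simp add: F_def)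
  qed
  have derivI: "((\<lambda>u. integral {0..u} (F Y)) has_vector_derivative F Y t) (at t within {0..})"
    if "0 \<le> t" for t Y
    using has_vector_derivative_antiderivative[OF contF that] .
  have contG: "continuous_on {0..} (G Y)" for Y
    unfolding G_def
    by (intro continuous_intros)
       (auto simp: continuous_on_eq_continuous_within intro: has_vector_derivative_continuous derivI)
  have normG: "norm (G Y p) \<le> norm (1::'a) + norm Y / 2" if "0 \<le> p" for Y p
  proof -
    have "norm (G Y p) \<le> exp (- (2 * K * p)) * (norm (1::'a) + norm (integral {0..p} (F Y)))"
      unfolding G_def by (simp add: norm_triangle_ineq)
    also have "\<dots> \<le> norm (1::'a) + norm Y / 2"
      using weighted_integral_bound[OF contF that bound] K that
      by (simp add: distrib_left add_mono mult_left_le_one_le)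
    finally show ?thesis .
  qed
  have inC: "(\<lambda>t. G Y (max 0 t)) \<in> bcontfun" for Y
  proof (rule bcontfun_normI)
    show "continuous_on UNIV (\<lambda>t. G Y (max 0 t))"
      by (rule continuous_on_compose2[OF contG]) (auto intro!: continuous_intros)
  qed (rule normG, simp)
  define H where "H Y = Bcontfun (\<lambda>t. G Y (max 0 t))" for Y
  have H: "apply_bcontfun (H Y) t = G Y (max 0 t)" for Y t
    unfolding H_def by (simp add: Bcontfun_inverse[OF inC])
  have "dist (H Y) (H Z) \<le> 1 / 2 * dist Y Z" for Y Z
  proof (rule dist_bound)
    fix t :: real
    define p where "p = max 0 t"
    have "G Y p - G Z p = exp (- (2 * K * p)) *\<^sub>R (integral {0..p} (F Y) - integral {0..p} (F Z))"
      by (simp add: G_def algebra_simps)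
    also have "integral {0..p} (F Y) - integral {0..p} (F Z) = integral {0..p} (F (Y - Z))"
      unfolding integral_diff[OF intF intF, symmetric]
      by (rule arg_cong[where f = "integral {0..p}"]) (auto simp: F_def algebra_simps)
    finally have "norm (G Y p - G Z p) \<le> norm (Y - Z) / 2"
      using weighted_integral_bound[OF contF _ bound, of p] by (simp add: p_def)
    then show "dist (apply_bcontfun (H Y) t) (apply_bcontfun (H Z) t) \<le> 1 / 2 * dist Y Z"
      by (simp add: H p_def dist_norm)
  qed
  then have "\<exists>!Y. H Y = Y"
    by (intro banach_fix_type[where c = "1/2"]) auto
  then obtain Y where Y: "H Y = Y" by blast
  define X where "X t = 1 + integral {0..t} (F Y)" for t
  have X: "X t = exp (2 * K * t) *\<^sub>R apply_bcontfun Y t" if "0 \<le> t" for t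
    using H[of Y t] that by (simp add: Y X_def G_def exp_minus)
  have "(X has_vector_derivative A t * X t) (at t within {0..})" if t: "0 \<le> t" for t
  proof -
    have "(X has_vector_derivative 0 + F Y t) (at t within {0..})"
      unfolding X_def by (intro has_vector_derivative_add derivI t) auto
    then show ?thesis by (simp add: X[OF t] F_def)
  qed
  then show ?thesis
    by (intro exI[of _ X]) (simp add: fundamental_solution_def X_def)
qed

definition fundsol :: "(real \<Rightarrow> 'a::unital_banach_algebra) \<Rightarrow> real \<Rightarrow> 'a"
  where "fundsol A = (SOME X. fundamental_solution A X)"

lemma fundsol:
  assumes "bounded_path A K"
  shows fundsol_0: "fundsol A 0 = 1"
    and fundsol_derivative: "0 \<le> t \<Longrightarrow> (fundsol A has_vector_derivative A t * fundsol A t) (at t within {0..})"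
  using someI_ex[OF fundamental_solution_exists[OF assms]]
  by (auto simp: fundsol_def fundamental_solution_def)

text \<open>
  The difference of two solutions with the same initial value is \<open>0\<close> by Gronwall. All algebraic
  identities for solutions below are instances: both sides solve the same equation.
\<close>

lemma fundsol_unique:
  fixes A :: "real \<Rightarrow> 'a::unital_banach_algebra"
  assumes A: "bounded_path A K" and b: "0 \<le> b"
    and Y: "\<And>t. t \<in> {0..b} \<Longrightarrow> (Y has_vector_derivative A t * Y t) (at t within {0..b})"
  shows "Y b = fundsol A b * Y 0"
proof -
  define D where "D t = Y t - fundsol A t * Y 0" for t
  have "norm (D b) \<le> 2 * (norm (D 0) + 0 * b) * exp (2 * K * b)"
  proof (rule gronwall[OF b bounded_path_nonneg[OF A]])
    fix t assume t: "t \<in> {0..b}"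
    have "(fundsol A has_vector_derivative A t * fundsol A t) (at t within {0..b})"
      by (rule has_vector_derivative_within_subset[OF fundsol_derivative[OF A]]) (use t in auto)
    then show "(D has_vector_derivative A t * Y t - A t * fundsol A t * Y 0) (at t within {0..b})"
      unfolding D_def using t by (intro has_vector_derivative_diff Y has_vector_derivative_mult_left) auto
    have "A t * Y t - A t * fundsol A t * Y 0 = A t * D t"
      by (simp add: D_def algebra_simps)
    then show "norm (A t * Y t - A t * fundsol A t * Y 0) \<le> K * norm (D t) + 0"
      using A t by (auto simp: bounded_path_def intro!: order.trans[OF norm_mult_ineq] mult_right_mono)
  qed simp
  then show ?thesis by (simp add: D_def fundsol_0[OF A])
qed

lemma fundsol_derivative_within:
  assumes "bounded_path A K" "t \<in> {0..b}"
  shows "(fundsol A has_vector_derivative A t * fundsol A t) (at t within {0..b})"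
  by (rule has_vector_derivative_within_subset[OF fundsol_derivative[OF assms(1)]]) (use assms in auto)

lemma norm_fundsol_le:
  fixes A :: "real \<Rightarrow> 'a::unital_banach_algebra"
  assumes A: "bounded_path A K" and b: "0 \<le> b"
  shows "norm (fundsol A b) \<le> 2 * norm (1::'a) * exp (2 * K * b)"
proof -
  have "norm (fundsol A b) \<le> 2 * (norm (fundsol A 0) + 0 * b) * exp (2 * K * b)"
  proof (rule gronwall[OF b bounded_path_nonneg[OF A]])
    fix t assume t: "t \<in> {0..b}"
    show "norm (A t * fundsol A t) \<le> K * norm (fundsol A t) + 0"
      using A t by (auto simp: bounded_path_def intro!: order.trans[OF norm_mult_ineq] mult_right_mono)
  qed (auto intro: fundsol_derivative_within[OF A])
  then show ?thesis by (simp add: fundsol_0[OF A])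
qed

lemma norm_fundsol_diff_le:
  fixes A B :: "real \<Rightarrow> 'a::unital_banach_algebra"
  assumes A: "bounded_path A K" and B: "bounded_path B K" and b: "0 \<le> b"
    and d: "\<And>t. 0 \<le> t \<Longrightarrow> norm (A t - B t) \<le> d"
  shows "norm (fundsol A b - fundsol B b) \<le> 4 * norm (1::'a) * b * exp (4 * K * b) * d"
proof -
  define W where "W t = fundsol A t - fundsol B t" for t
  define c where "c = d * (2 * norm (1::'a) * exp (2 * K * b))"
  have K: "K \<ge> 0" using bounded_path_nonneg[OF A] .
  have d0: "d \<ge> 0" using d[of 0] norm_ge_zero[of "A 0 - B 0"] by linarith
  have "norm (W b) \<le> 2 * (norm (W 0) + c * b) * exp (2 * K * b)"
  proof (rule gronwall[OF b K])
    show "0 \<le> c" using d0 by (simp add: c_def)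
    fix t assume t: "t \<in> {0..b}"
    show "(W has_vector_derivative A t * fundsol A t - B t * fundsol B t) (at t within {0..b})"
      unfolding W_def using t
      by (intro has_vector_derivative_diff fundsol_derivative_within[OF A] fundsol_derivative_within[OF B])
    have "A t * fundsol A t - B t * fundsol B t = A t * W t + (A t - B t) * fundsol B t"
      by (simp add: W_def algebra_simps)
    moreover have "norm (A t * W t) \<le> K * norm (W t)"
      using A t by (auto simp: bounded_path_def intro!: order.trans[OF norm_mult_ineq] mult_right_mono)
    moreover have "norm ((A t - B t) * fundsol B t) \<le> c"
    proof -
      have "norm (fundsol B t) \<le> 2 * norm (1::'a) * exp (2 * K * t)"
        using norm_fundsol_le[OF B] t by auto
      also have "\<dots> \<le> 2 * norm (1::'a) * exp (2 * K * b)"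
        using t K by (auto intro!: mult_left_mono)
      finally show ?thesis
        unfolding c_def using d[of t] t d0 by (intro order.trans[OF norm_mult_ineq] mult_mono) auto
    qed
    ultimately show "norm (A t * fundsol A t - B t * fundsol B t) \<le> K * norm (W t) + c"
      by (auto intro: norm_triangle_le)
  qed
  also have "\<dots> = 4 * norm (1::'a) * b * (exp (2 * K * b) * exp (2 * K * b)) * d"
    by (simp add: c_def W_def fundsol_0[OF A] fundsol_0[OF B])
  also have "exp (2 * K * b) * exp (2 * K * b) = exp (4 * K * b)"
    by (simp add: exp_add[symmetric])
  finally show ?thesis by (simp add: W_def)
qed

lemma fundsol_add:
  fixes A :: "real \<Rightarrow> 'a::unital_banach_algebra"
  assumes A: "bounded_path A K" and s: "0 \<le> s" and t: "0 \<le> t"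
  shows "fundsol A (s + t) = fundsol (\<lambda>u. A (s + u)) t * fundsol A s"
proof -
  define Y where "Y u = fundsol A (s + u)" for u
  have "Y t = fundsol (\<lambda>u. A (s + u)) t * Y 0"
  proof (rule fundsol_unique[OF bounded_path_shift[OF A s] t])
    fix u assume u: "u \<in> {0..t}"
    have "(fundsol A has_vector_derivative A (s + u) * fundsol A (s + u)) (at (s + u) within (+) s ` {0..t})"
      by (rule has_vector_derivative_within_subset[OF fundsol_derivative[OF A]]) (use u s in auto)
    then have "(fundsol A \<circ> (+) s has_vector_derivative 1 *\<^sub>R (A (s + u) * fundsol A (s + u))) (at u within {0..t})"
      by (intro vector_diff_chain_within) (auto intro!: derivative_eq_intros)
    then show "(Y has_vector_derivative A (s + u) * Y u) (at u within {0..t})"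
      by (simp add: Y_def[abs_def] o_def)
  qed
  then show ?thesis by (simp add: Y_def)
qed

text \<open>
  Running the equation backwards from time \<open>b\<close> is again an equation of the same kind, so a left inverse
  of every fundamental solution is available. Reversing twice restores \<open>A\<close> on \<open>[0, b]\<close>, hence the
  left inverse of the reversed solution is the original solution.
\<close>

lemma fundsol_reverse:
  fixes A :: "real \<Rightarrow> 'a::unital_banach_algebra"
  assumes A: "bounded_path A K" and b: "0 \<le> b"
  shows "inverses (fundsol A b) (fundsol (\<lambda>u. - A (max 0 (b - u))) b)"
proof -
  have left: "fundsol (\<lambda>u. - A (max 0 (b - u))) b * fundsol A b = 1" if A: "bounded_path A K" for A
  proof -
    define Y where "Y u = fundsol A (b - u)" for u
    have "Y b = fundsol (\<lambda>u. - A (max 0 (b - u))) b * Y 0"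
    proof (rule fundsol_unique[OF bounded_path_reverse[OF A] b])
      fix u assume u: "u \<in> {0..b}"
      have "(fundsol A has_vector_derivative A (b - u) * fundsol A (b - u)) (at (b - u) within (-) b ` {0..b})"
        by (rule has_vector_derivative_within_subset[OF fundsol_derivative[OF A]]) (use u in auto)
      then have "(fundsol A \<circ> (-) b has_vector_derivative (-1) *\<^sub>R (A (b - u) * fundsol A (b - u))) (at u within {0..b})"
        by (intro vector_diff_chain_within) (auto intro!: derivative_eq_intros)
      then show "(Y has_vector_derivative - A (max 0 (b - u)) * Y u) (at u within {0..b})"
        using u by (simp add: Y_def[abs_def] o_def)
    qed
    then show ?thesis by (simp add: Y_def fundsol_0[OF A])
  qed
  define B where "B u = - A (max 0 (b - u))" for u
  \<comment> \<open>The twice reversed path agrees with \<open>A\<close> on \<open>[0, b]\<close>, though not beyond.\<close>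
  define C where "C u = - B (max 0 (b - u))" for u
  have B: "bounded_path B K" unfolding B_def using bounded_path_reverse[OF A] .
  have C: "bounded_path C K" unfolding C_def using bounded_path_reverse[OF B] .
  have CA: "C u = A u" if "u \<in> {0..b}" for u
    using that by (simp add: C_def B_def)
  have "fundsol A b = fundsol C b * fundsol A 0"
    by (rule fundsol_unique[OF C b]) (simp add: CA fundsol_derivative_within[OF A])
  then have "fundsol C b = fundsol A b" by (simp add: fundsol_0[OF A])
  moreover have "fundsol B b * fundsol A b = 1" unfolding B_def using left[OF A] .
  moreover have "fundsol C b * fundsol B b = 1" unfolding C_def using left[OF B] .
  ultimately show ?thesis unfolding B_def[symmetric] by (simp add: inverses_def)
qed

lemma fundsol_commute:
  fixes A :: "real \<Rightarrow> 'a::unital_banach_algebra"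
  assumes A: "bounded_path A K" and b: "0 \<le> b" and c: "\<And>t. 0 \<le> t \<Longrightarrow> c * A t = A t * c"
  shows "c * fundsol A b = fundsol A b * c"
proof -
  define Y where "Y t = c * fundsol A t" for t
  have "Y b = fundsol A b * Y 0"
  proof (rule fundsol_unique[OF A b])
    fix t assume t: "t \<in> {0..b}"
    have "c * (A t * fundsol A t) = A t * Y t"
      using c[of t] t by (simp add: Y_def mult.assoc[symmetric])
    then show "(Y has_vector_derivative A t * Y t) (at t within {0..b})"
      unfolding Y_def using has_vector_derivative_mult_right[OF fundsol_derivative_within[OF A t]] by metis
  qed
  then show ?thesis by (simp add: Y_def fundsol_0[OF A])
qed

text \<open>
  The exponential of an algebra element. In contrast to \<^const>\<open>exp\<close> it makes sense without
  \<open>norm 1 = 1\<close>.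
\<close>

definition expo :: "'a::unital_banach_algebra \<Rightarrow> 'a"
  where "expo S = fundsol (\<lambda>_. S) 1"

lemma fundsol_const:
  fixes T :: "'a::unital_banach_algebra"
  assumes t: "0 \<le> t"
  shows "fundsol (\<lambda>_. T) t = expo (t *\<^sub>R T)"
proof -
  define Y where "Y u = fundsol (\<lambda>_. T) (t * u)" for u
  have "Y 1 = fundsol (\<lambda>_. t *\<^sub>R T) 1 * Y 0"
  proof (rule fundsol_unique[OF bounded_path_const])
    fix u :: real assume u: "u \<in> {0..1}"
    have "(fundsol (\<lambda>_. T) has_vector_derivative T * fundsol (\<lambda>_. T) (t * u)) (at (t * u) within (*) t ` {0..1})"
      by (rule has_vector_derivative_within_subset[OF fundsol_derivative[OF bounded_path_const]])
         (use u t in auto)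
    then have "(fundsol (\<lambda>_. T) \<circ> (*) t has_vector_derivative t *\<^sub>R (T * fundsol (\<lambda>_. T) (t * u))) (at u within {0..1})"
      by (intro vector_diff_chain_within) (auto intro!: derivative_eq_intros)
    then show "(Y has_vector_derivative t *\<^sub>R T * Y u) (at u within {0..1})"
      by (simp add: Y_def[abs_def] o_def)
  qed simp
  then show ?thesis by (simp add: Y_def expo_def fundsol_0[OF bounded_path_const])
qed

lemma expo_commute: "c * S = S * c \<Longrightarrow> c * expo S = expo S * c"
  unfolding expo_def by (rule fundsol_commute[OF bounded_path_const]) auto

lemma expo_add:
  fixes S T :: "'a::unital_banach_algebra"
  assumes ST: "S * T = T * S"
  shows "expo (S + T) = expo S * expo T"
proof -
  define X where "X = fundsol (\<lambda>_. S)"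
  define Z where "Z = fundsol (\<lambda>_. T)"
  define Y where "Y u = X u * Z u" for u
  have "Y 1 = fundsol (\<lambda>_. S + T) 1 * Y 0"
  proof (rule fundsol_unique[OF bounded_path_const])
    fix u :: real assume u: "u \<in> {0..1}"
    have "T * X u = X u * T"
      unfolding X_def using u ST by (intro fundsol_commute[OF bounded_path_const]) auto
    then have "X u * (T * Z u) = T * (X u * Z u)" by (metis mult.assoc)
    then have "X u * (T * Z u) + S * X u * Z u = (S + T) * Y u"
      by (simp add: Y_def distrib_right mult.assoc add.commute)
    moreover have "(Y has_vector_derivative X u * (T * Z u) + S * X u * Z u) (at u within {0..1})"
      unfolding Y_def X_def Z_def using u
      by (intro has_vector_derivative_mult fundsol_derivative_within[OF bounded_path_const])
    ultimately show "(Y has_vector_derivative (S + T) * Y u) (at u within {0..1})" by simp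
  qed simp
  then show ?thesis
    by (simp add: Y_def X_def Z_def expo_def fundsol_0[OF bounded_path_const])
qed

lemma expo_scaleR_1: "expo (c *\<^sub>R 1) = exp c *\<^sub>R (1::'a::unital_banach_algebra)"
proof -
  define Y where "Y u = exp (c * u) *\<^sub>R (1::'a)" for u
  have "Y 1 = fundsol (\<lambda>_. c *\<^sub>R 1) 1 * Y 0"
  proof (rule fundsol_unique[OF bounded_path_const])
    fix u :: real assume u: "u \<in> {0..1}"
    show "(Y has_vector_derivative c *\<^sub>R 1 * Y u) (at u within {0..1})"
      unfolding Y_def by (auto intro!: derivative_eq_intros)
  qed simp
  then show ?thesis by (simp add: Y_def expo_def)
qed

lemma expo_0: "expo 0 = (1::'a::unital_banach_algebra)"
  using expo_scaleR_1[of 0] by simp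

lemma expo_shift: "expo (S + c *\<^sub>R 1) = exp c *\<^sub>R expo (S::'a::unital_banach_algebra)"
  by (subst expo_add) (simp_all add: expo_scaleR_1)

lemma expo_minus: "inverses (expo S) (expo (- S :: 'a::unital_banach_algebra))"
  using expo_add[of S "- S"] expo_add[of "- S" S] by (simp add: inverses_def expo_0)

section \<open>Partial fractions for the inverse of one minus an exponential\<close>

text \<open>
  The Fejer kernel of period \<open>1\<close>, that is the Cesaro mean of the first \<open>n\<close> partial sums of the series
  of the exponentials \<open>e\<^bsup>2 \<pi> i k s\<^esup>\<close>.
\<close>

definition fejer :: "nat \<Rightarrow> real \<Rightarrow> real"
  where "fejer n s = 1 + 2 * (\<Sum>k\<in>{1..<n}. (1 - real k / real n) * cos (2 * pi * real k * s))"

lemma dirichlet_kernel: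
  "sin x * (1 + 2 * (\<Sum>k\<in>{1..<Suc n}. cos (2 * real k * x))) = sin ((2 * real n + 1) * x)" for x :: real
proof (induction n)
  case (Suc n)
  define y where "y = 2 * real (Suc n) * x"
  have "(2 * real (Suc n) + 1) * x = y + x" "(2 * real n + 1) * x = y - x"
    by (simp_all add: y_def algebra_simps)
  then have "sin ((2 * real (Suc n) + 1) * x) - sin ((2 * real n + 1) * x) = 2 * sin x * cos y"
    by (simp add: sin_add sin_diff)
  then have "sin ((2 * real (Suc n) + 1) * x) - sin ((2 * real n + 1) * x) = 2 * sin x * cos (2 * real (Suc n) * x)"
    by (simp only: y_def)
  moreover have "{1..<Suc (Suc n)} = insert (Suc n) {1..<Suc n}" by auto
  ultimately show ?case using Suc by (simp add: algebra_simps)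
qed simp

text \<open>
  Passing from \<open>n\<close> to \<open>n + 1\<close> in \<open>n\<close> times the kernel adds the Dirichlet kernel, and
  \<open>sin b sin (2 a + b) = sin\<^sup>2 (a + b) - sin\<^sup>2 a\<close>.
\<close>

lemma sin_squared_fejer:
  "n > 0 \<Longrightarrow> (sin (pi * s))\<^sup>2 * fejer n s = (sin (pi * n * s))\<^sup>2 / n"
proof -
  define N where "N n = n + 2 * (\<Sum>k\<in>{1..<n}. (real n - k) * cos (2 * real k * (pi * s)))" for n :: nat
  have "(sin (pi * s))\<^sup>2 * N n = (sin (real n * (pi * s)))\<^sup>2" for n
  proof (induction n)
    case (Suc n)
    have "N (Suc n) = N n + (1 + 2 * (\<Sum>k\<in>{1..<Suc n}. cos (2 * real k * (pi * s))))"
    proof -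
      have "(\<Sum>k\<in>{1..<Suc n}. (real (Suc n) - k) * cos (2 * real k * (pi * s)))
          = (\<Sum>k\<in>{1..<Suc n}. (real n - k) * cos (2 * real k * (pi * s))) + (\<Sum>k\<in>{1..<Suc n}. cos (2 * real k * (pi * s)))"
        by (simp add: sum.distrib[symmetric] algebra_simps del: sum.op_ivl_Suc)
      moreover have "(\<Sum>k\<in>{1..<Suc n}. (real n - k) * cos (2 * real k * (pi * s)))
          = (\<Sum>k\<in>{1..<n}. (real n - k) * cos (2 * real k * (pi * s)))"
        by (cases "n = 0") (auto simp: atLeastLessThanSuc)
      ultimately show ?thesis by (simp add: N_def del: sum.op_ivl_Suc)
    qed
    then have "(sin (pi * s))\<^sup>2 * N (Suc n) = (sin (real n * (pi * s)))\<^sup>2 + sin (pi * s) * sin ((2 * real n + 1) * (pi * s))"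
    proof -
      assume N: "N (Suc n) = N n + (1 + 2 * (\<Sum>k\<in>{1..<Suc n}. cos (2 * real k * (pi * s))))"
      have "a\<^sup>2 * (x + d) = a\<^sup>2 * x + a * (a * d)" for a x d :: real
        by (simp add: algebra_simps power2_eq_square)
      then show ?thesis unfolding N Suc[symmetric] dirichlet_kernel[of "pi * s" n, symmetric] .
    qed
    also have "\<dots> = (sin (Suc n * (pi * s)))\<^sup>2"
    proof -
      define a b where "a = n * (pi * s)" and "b = pi * s"
      have "sin b * sin (2 * a + b) = (sin (a + b))\<^sup>2 - (sin a)\<^sup>2"
      proof -
        define c where "c = a + b"
        have sins: "sin b = sin (c - a)" "sin (2 * a + b) = sin (c + a)"
          by (simp_all add: c_def algebra_simps)
        have "sin b * sin (2 * a + b) = (sin c)\<^sup>2 * (cos a)\<^sup>2 - (cos c)\<^sup>2 * (sin a)\<^sup>2"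
          unfolding sins unfolding sin_add sin_diff by (simp add: power2_eq_square algebra_simps)
        also have "\<dots> = (sin c)\<^sup>2 - (sin a)\<^sup>2"
          by (simp add: cos_squared_eq algebra_simps)
        finally show ?thesis by (simp add: c_def)
      qed
      then show ?thesis by (simp add: a_def b_def algebra_simps)
    qed
    finally show ?case .
  qed (simp add: N_def)
  moreover assume "n > 0"
  then have w: "(1 - real k / real n) = (real n - k) / n" for k :: nat
    by (simp add: field_simps)
  have "fejer n s = 1 + 2 * ((\<Sum>k\<in>{1..<n}. (real n - k) * cos (2 * real k * (pi * s))) / n)"
    unfolding fejer_def w sum_divide_distrib by (simp add: mult_ac)
  then have "fejer n s = N n / n" using \<open>n > 0\<close> by (simp add: N_def field_simps)
  ultimately show ?thesis by (simp add: mult.commute mult.left_commute)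
qed

lemma fejer_nonneg:
  assumes "s \<in> {0..1}" "n > 0"
  shows "fejer n s \<ge> 0"
proof (cases "sin (pi * s) = 0")
  case False
  then have "0 < (sin (pi * s))\<^sup>2" by simp
  moreover have "0 \<le> (sin (pi * s))\<^sup>2 * fejer n s"
    by (simp add: sin_squared_fejer[OF assms(2)])
  ultimately show ?thesis by (simp add: zero_le_mult_iff)
next
  case True
  have s: "s = 0 \<or> s = 1"
  proof (rule ccontr)
    assume "\<not> (s = 0 \<or> s = 1)"
    then have "0 < pi * s" "pi * s < pi" using assms by auto
    then show False using sin_gt_zero True by fastforce
  qed
  have "cos (2 * pi * real k * s) = 1" for k :: nat
    using s cos_2npi[of k] by (auto simp: mult.commute mult.left_commute)
  then have "fejer n s = 1 + 2 * (\<Sum>k\<in>{1..<n}. 1 - real k / real n)"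
    by (simp add: fejer_def)
  then show ?thesis
    using assms by (auto intro!: add_nonneg_nonneg sum_nonneg)
qed

lemma continuous_on_fejer: "continuous_on A (fejer n)"
  unfolding fejer_def[abs_def] by (intro continuous_intros)

lemma has_integral_cos_period:
  assumes "k > (0::nat)"
  shows "((\<lambda>s. cos (2 * pi * real k * s)) has_integral 0) {0..1}"
    and "((\<lambda>s. cos (2 * pi * real k * s) * s) has_integral 0) {0..1}"
proof -
  define a where "a = 2 * pi * k"
  have a: "a \<noteq> 0" "sin a = 0" "cos a = 1"
    using assms sin_2npi[of k] cos_2npi[of k] by (auto simp: a_def mult_ac)
  have "((\<lambda>s. cos (a * s)) has_integral (sin (a * 1) / a - sin (a * 0) / a)) {0..1}"
    by (rule fundamental_theorem_of_calculus)
       (use a in \<open>auto intro!: derivative_eq_intros simp flip: has_real_derivative_iff_has_vector_derivative\<close>)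
  then show "((\<lambda>s. cos (2 * pi * real k * s)) has_integral 0) {0..1}"
    using a unfolding a_def[symmetric] by simp
  have "((\<lambda>s. cos (a * s) * s) has_integral
      ((1 * sin (a * 1) / a + cos (a * 1) / a\<^sup>2) - (0 * sin (a * 0) / a + cos (a * 0) / a\<^sup>2))) {0..1}"
    by (rule fundamental_theorem_of_calculus)
       (use a in \<open>auto intro!: derivative_eq_intros
          simp: field_simps power2_eq_square simp flip: has_real_derivative_iff_has_vector_derivative\<close>)
  then show "((\<lambda>s. cos (2 * pi * real k * s) * s) has_integral 0) {0..1}"
    using a unfolding a_def[symmetric] by simp
qed

lemma fejer_integral: "(fejer n has_integral 1) {0..1}"
proof -
  have "((\<lambda>s. 1 + 2 * (\<Sum>k\<in>{1..<n}. (1 - real k / real n) * cos (2 * pi * real k * s))) has_integral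
      1 + 2 * (\<Sum>k\<in>{1..<n}. (1 - real k / real n) * 0)) {0..1}"
  proof (intro has_integral_add has_integral_mult_right has_integral_sum)
    show "((\<lambda>s. 1) has_integral (1::real)) {0..1::real}"
      using has_integral_const_real[of "1::real" 0 1] by simp
  qed (auto intro: has_integral_cos_period)
  then show ?thesis by (simp add: fejer_def[abs_def])
qed

text \<open>
  Since \<open>h\<close> vanishes at both ends, \<open>\<parallel>h\<parallel> \<le> e / 2 + C sin\<^sup>2 (\<pi> s)\<close> with some constant \<open>C\<close>. The kernel is
  nonnegative with integral \<open>1\<close>, and its integral against \<open>sin\<^sup>2 (\<pi> s)\<close> is at most \<open>1 / n\<close>.
\<close>

lemma fejer_tendsto_0:
  fixes h :: "real \<Rightarrow> 'a::banach"
  assumes h: "continuous_on {0..1} h" and h0: "h 0 = 0" and h1: "h 1 = 0"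
  shows "(\<lambda>n. integral {0..1} (\<lambda>s. fejer n s *\<^sub>R h s)) \<longlonglongrightarrow> 0"
proof (rule LIMSEQ_I)
  fix e :: real assume e: "e > 0"
  have "\<exists>C\<ge>0. \<forall>s\<in>{0..1}. norm (h s) \<le> e / 2 + C * (sin (pi * s))\<^sup>2"
  proof -
    \<comment> \<open>On this compact set the sine is bounded away from zero, because \<open>h\<close> vanishes at the ends.\<close>
    define Z where "Z = {s \<in> {0..1}. e / 2 \<le> norm (h s)}"
    have "closed Z"
      unfolding Z_def by (intro continuous_on_closed_Collect_le continuous_intros h) auto
    moreover have "Z = {0..1} \<inter> Z" by (auto simp: Z_def)
    ultimately have Z: "compact Z" by (metis compact_Int_closed compact_Icc)
    have pos: "sin (pi * s) > 0" if "s \<in> Z" for s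
    proof -
      have "s \<noteq> 0" "s \<noteq> 1" "s \<in> {0..1}" using that h0 h1 e by (auto simp: Z_def)
      then show ?thesis by (intro sin_gt_zero) auto
    qed
    have "continuous_on Z (\<lambda>s. norm (h s) / (sin (pi * s))\<^sup>2)"
      by (intro continuous_intros continuous_on_subset[OF h]) (use pos in \<open>force simp: Z_def\<close>)+
    then have "bounded ((\<lambda>s. norm (h s) / (sin (pi * s))\<^sup>2) ` Z)"
      by (intro compact_imp_bounded compact_continuous_image Z)
    then obtain C where C: "C > 0" "\<And>s. s \<in> Z \<Longrightarrow> norm (norm (h s) / (sin (pi * s))\<^sup>2) \<le> C"
      by (auto simp: bounded_pos)
    have "norm (h s) \<le> e / 2 + C * (sin (pi * s))\<^sup>2" if s: "s \<in> {0..1}" for s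
    proof (cases "s \<in> Z")
      case True
      then have "norm (h s) \<le> C * (sin (pi * s))\<^sup>2"
        using C(2)[OF True] pos[OF True] by (simp add: field_simps)
      then show ?thesis using e by simp
    next
      case False
      moreover have "0 \<le> C * (sin (pi * s))\<^sup>2" using C by simp
      ultimately show ?thesis using s unfolding Z_def mem_Collect_eq by linarith
    qed
    then show ?thesis using C(1) by (intro exI[of _ C]) auto
  qed
  then obtain C where C: "C \<ge> 0" "\<And>s. s \<in> {0..1} \<Longrightarrow> norm (h s) \<le> e / 2 + C * (sin (pi * s))\<^sup>2"
    by blast
  obtain n0 where n0: "real n0 > 2 * C / e" using reals_Archimedean2 by blast
  show "\<exists>n0. \<forall>n\<ge>n0. norm (integral {0..1} (\<lambda>s. fejer n s *\<^sub>R h s) - 0) < e"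
  proof (intro exI allI impI)
    fix n assume n: "n \<ge> Suc n0"
    then have n': "n > 0" "2 * C / e < n" using n0 by auto
    have "norm (integral {0..1} (\<lambda>s. fejer n s *\<^sub>R h s))
        \<le> integral {0..1} (\<lambda>s. e / 2 * fejer n s + C / n)"
    proof (rule integral_norm_bound_integral)
      show "(\<lambda>s. fejer n s *\<^sub>R h s) integrable_on {0..1}"
        by (intro integrable_continuous_real continuous_intros continuous_on_fejer h)
      show "(\<lambda>s. e / 2 * fejer n s + C / n) integrable_on {0..1}"
        by (intro integrable_continuous_real continuous_intros continuous_on_fejer)
      fix s :: real assume s: "s \<in> {0..1}"
      have "norm (fejer n s *\<^sub>R h s) = fejer n s * norm (h s)"
        using fejer_nonneg[OF s n'(1)] by simp
      also have "\<dots> \<le> fejer n s * (e / 2 + C * (sin (pi * s))\<^sup>2)"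
        using fejer_nonneg[OF s n'(1)] C(2)[OF s] by (rule mult_left_mono[rotated])
      also have "\<dots> = e / 2 * fejer n s + C * ((sin (pi * n * s))\<^sup>2 / n)"
        unfolding sin_squared_fejer[OF n'(1), symmetric] by (simp add: algebra_simps)
      also have "(sin (pi * n * s))\<^sup>2 / n \<le> 1 / n"
        using n' by (intro divide_right_mono) (auto simp: abs_square_le_1)
      finally show "norm (fejer n s *\<^sub>R h s) \<le> e / 2 * fejer n s + C / n"
        using C(1) by (simp add: mult_left_mono)
    qed
    also have "\<dots> = e / 2 * 1 + C / n"
    proof (rule integral_unique, intro has_integral_add has_integral_mult_right fejer_integral)
      show "((\<lambda>s. C / real n) has_integral C / real n) {0..1::real}"
        using has_integral_const_real[of "C / real n" 0 1] by simp
    qed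
    also have "\<dots> < e" using n' e by (simp add: field_simps)
    finally show "norm (integral {0..1} (\<lambda>s. fejer n s *\<^sub>R h s) - 0) < e" by simp
  qed
qed

text \<open>
  Integration by parts twice. The Fourier coefficients of \<open>s \<mapsto> e\<^bsup>sS\<^esup>\<close> involve exactly the
  inverses that hyperbolicity provides.
\<close>

lemma has_integral_cos_fundsol:
  fixes S :: "'a::unital_banach_algebra" and a :: real
  assumes R: "inverses (S * S + a\<^sup>2 *\<^sub>R 1) R" and a: "cos a = 1" "sin a = 0"
  shows "((\<lambda>s. cos (a * s) *\<^sub>R fundsol (\<lambda>_. S) s) has_integral R * S * (expo S - 1)) {0..1}"
proof -
  define E where "E = fundsol (\<lambda>_. S)"
  \<comment> \<open>An antiderivative, found by integrating by parts twice.\<close>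
  define \<Phi> where "\<Phi> s = R * (cos (a * s) *\<^sub>R (S * E s) + (a * sin (a * s)) *\<^sub>R E s)" for s
  have "((\<lambda>s. cos (a * s) *\<^sub>R E s) has_integral \<Phi> 1 - \<Phi> 0) {0..1}"
  proof (rule fundamental_theorem_of_calculus)
    fix s :: real assume s: "s \<in> {0..1}"
    have E: "(E has_vector_derivative S * E s) (at s within {0..1})"
      unfolding E_def by (rule fundsol_derivative_within[OF bounded_path_const s])
    have "(\<Phi> has_vector_derivative
      R * ((cos (a * s) *\<^sub>R (S * (S * E s)) + (- sin (a * s) * a) *\<^sub>R (S * E s))
        + ((a * sin (a * s)) *\<^sub>R (S * E s) + (a * (cos (a * s) * a)) *\<^sub>R E s))) (at s within {0..1})"
      unfolding \<Phi>_def
      by (intro has_vector_derivative_mult_right has_vector_derivative_add has_vector_derivative_scaleR E)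
         (auto intro!: derivative_eq_intros)
    also have "R * ((cos (a * s) *\<^sub>R (S * (S * E s)) + (- sin (a * s) * a) *\<^sub>R (S * E s))
        + ((a * sin (a * s)) *\<^sub>R (S * E s) + (a * (cos (a * s) * a)) *\<^sub>R E s))
      = R * (S * S + a\<^sup>2 *\<^sub>R 1) * (cos (a * s) *\<^sub>R E s)"
      by (simp add: algebra_simps power2_eq_square)
    also have "\<dots> = cos (a * s) *\<^sub>R E s"
      using R by (simp add: inverses_def)
    finally show "(\<Phi> has_vector_derivative cos (a * s) *\<^sub>R E s) (at s within {0..1})" .
  qed simp
  moreover have "E 1 = expo S" "E 0 = 1"
    by (simp_all add: E_def expo_def fundsol_0[OF bounded_path_const])
  ultimately show ?thesis
    using a by (simp add: \<Phi>_def E_def[symmetric] algebra_simps)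
qed

text \<open>
  The sequence \<open>1/2 - G\<^sub>n\<close> is the sequence of Cesaro means of \<open>1/2 - \<Sum> S / (S\<^sup>2 + (2 \<pi> k)\<^sup>2)\<close>. To stay
  clear of the jump of the periodic extension of \<open>e\<^bsup>sS\<^esup>\<close>, the linear interpolation of its boundary
  values is subtracted; all Fourier cosine coefficients of an affine function vanish except the mean.
\<close>

lemma coth_partial_sums:
  fixes S :: "'a::unital_banach_algebra" and R :: "nat \<Rightarrow> 'a"
  assumes R: "\<And>k::nat. inverses (S * S + (2 * pi * k)\<^sup>2 *\<^sub>R 1) (R k)"
  defines "G \<equiv> \<lambda>n. R 0 * S + 2 *\<^sub>R (\<Sum>k\<in>{1..<n}. (1 - real k / real n) *\<^sub>R (R k * S))"
  shows "(\<lambda>n. ((1/2) *\<^sub>R 1 - G n) * (1 - expo S)) \<longlonglongrightarrow> 1"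
proof -
  define E where "E = fundsol (\<lambda>_. S)"
  define X where "X = expo S"
  \<comment> \<open>Subtracting the interpolation of the boundary values makes \<open>h\<close> vanish at \<open>0\<close> and \<open>1\<close>.\<close>
  define h where "h s = E s - (1 + s *\<^sub>R (X - 1))" for s
  have E1: "E 1 = X" "E 0 = 1"
    by (simp_all add: E_def X_def expo_def fundsol_0[OF bounded_path_const])
  have "continuous_on {0..1} E"
    unfolding E_def by (rule continuous_on_vector_derivative[OF fundsol_derivative_within[OF bounded_path_const]])
  then have h: "continuous_on {0..1} h"
    unfolding h_def by (intro continuous_intros)
  have trig: "cos (2 * pi * k) = 1" "sin (2 * pi * k) = 0" for k :: nat
    using sin_2npi[of k] cos_2npi[of k] by (auto simp: mult_ac)
  have intE: "((\<lambda>s. cos (2 * pi * real k * s) *\<^sub>R E s) has_integral R k * S * (X - 1)) {0..1}" for k :: nat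
    unfolding E_def X_def by (rule has_integral_cos_fundsol[OF R trig])
  have int_h: "((\<lambda>s. cos (2 * pi * real k * s) *\<^sub>R h s) has_integral R k * S * (X - 1)) {0..1}" if "k > 0" for k :: nat
  proof -
    have "((\<lambda>s. cos (2 * pi * real k * s) *\<^sub>R E s - (cos (2 * pi * real k * s) *\<^sub>R 1 + (cos (2 * pi * real k * s) * s) *\<^sub>R (X - 1)))
        has_integral R k * S * (X - 1) - (0 *\<^sub>R 1 + 0 *\<^sub>R (X - 1))) {0..1}"
      by (intro has_integral_diff has_integral_add intE has_integral_scaleR_left has_integral_cos_period that)
    then show ?thesis by (simp add: h_def algebra_simps)
  qed
  have int_h0: "(h has_integral R 0 * S * (X - 1) - (1/2) *\<^sub>R (1 + X)) {0..1}"
  proof -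
    have id: "((\<lambda>s. s) has_integral (1/2 :: real)) {0..1::real}"
      using ident_has_integral[of 0 1] by simp
    have "((\<lambda>s. 1) has_integral (1::'a)) {0..1::real}"
      using has_integral_const_real[of "1::'a" 0 1] by simp
    then have "((\<lambda>s. E s - (1 + s *\<^sub>R (X - 1))) has_integral
        R 0 * S * (X - 1) - (1 + (1/2) *\<^sub>R (X - 1))) {0..1}"
      using intE[of 0] by (intro has_integral_diff has_integral_add has_integral_scaleR_left id) auto
    moreover have "1 + (1/2) *\<^sub>R (X - 1) = (1/2) *\<^sub>R (1 + X)"
      by (simp add: algebra_simps flip: scaleR_left_distrib[of "1/2" "1/2" "1::'a"])
    ultimately show ?thesis by (simp add: h_def[abs_def])
  qed
  have "integral {0..1} (\<lambda>s. fejer n s *\<^sub>R h s) = G n * (X - 1) - (1/2) *\<^sub>R (1 + X)" for n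
  proof -
    have "((\<lambda>s. h s + 2 *\<^sub>R (\<Sum>k\<in>{1..<n}. (1 - real k / real n) *\<^sub>R (cos (2 * pi * real k * s) *\<^sub>R h s))) has_integral
      (R 0 * S * (X - 1) - (1/2) *\<^sub>R (1 + X)) + 2 *\<^sub>R (\<Sum>k\<in>{1..<n}. (1 - real k / real n) *\<^sub>R (R k * S * (X - 1)))) {0..1}"
      by (intro has_integral_add has_integral_cmul has_integral_sum int_h int_h0) auto
    moreover have "h s + 2 *\<^sub>R (\<Sum>k\<in>{1..<n}. (1 - real k / real n) *\<^sub>R (cos (2 * pi * real k * s) *\<^sub>R h s)) = fejer n s *\<^sub>R h s" for s
      by (simp add: fejer_def scaleR_left_distrib scaleR_sum_left scaleR_sum_right sum_distrib_left algebra_simps)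
    moreover have "(R 0 * S * (X - 1) - (1/2) *\<^sub>R (1 + X)) + 2 *\<^sub>R (\<Sum>k\<in>{1..<n}. (1 - real k / real n) *\<^sub>R (R k * S * (X - 1)))
        = G n * (X - 1) - (1/2) *\<^sub>R (1 + X)"
      by (simp add: G_def distrib_right sum_distrib_right)
    ultimately show ?thesis by (simp add: integral_unique)
  qed
  then have "(\<lambda>n. G n * (X - 1) - (1/2) *\<^sub>R (1 + X)) \<longlonglongrightarrow> 0"
    using fejer_tendsto_0[OF h] by (simp add: h_def E1)
  then have "(\<lambda>n. (G n * (X - 1) - (1/2) *\<^sub>R (1 + X)) + 1) \<longlonglongrightarrow> 0 + 1"
    by (intro tendsto_intros)
  moreover have "(G n * (X - 1) - (1/2) *\<^sub>R (1 + X)) + 1 = ((1/2) *\<^sub>R 1 - G n) * (1 - X)" for n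
    by (simp add: algebra_simps flip: scaleR_left_distrib[of "1/2" "1/2" "1::'a"])
  ultimately show ?thesis by (simp add: X_def)
qed

text \<open>
  An approximate left inverse that commutes with \<open>e\<^bsup>S\<^esup>\<close> is an approximate inverse, so it makes
  \<open>1 - e\<^bsup>S\<^esup>\<close> invertible.
\<close>

lemma one_minus_expo_inverse:
  fixes S :: "'a::unital_banach_algebra" and R :: "nat \<Rightarrow> 'a"
  assumes R: "\<And>k::nat. inverses (S * S + (2 * pi * k)\<^sup>2 *\<^sub>R 1) (R k)"
  obtains Q where "inverses (1 - expo S) Q"
    "(\<lambda>n. (1/2) *\<^sub>R 1 - (R 0 * S + 2 *\<^sub>R (\<Sum>k\<in>{1..<n}. (1 - real k / real n) *\<^sub>R (R k * S)))) \<longlonglongrightarrow> Q"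
proof -
  define B where "B n = (1/2) *\<^sub>R 1 - (R 0 * S + 2 *\<^sub>R (\<Sum>k\<in>{1..<n}. (1 - real k / real n) *\<^sub>R (R k * S)))" for n
  define X where "X = expo S"
  have lim: "(\<lambda>n. B n * (1 - X)) \<longlonglongrightarrow> 1"
    unfolding B_def X_def by (rule coth_partial_sums[OF R])
  have XS: "S * X = X * S" unfolding X_def by (rule expo_commute) simp
  have XSS: "X * (S * S) = S * S * X" by (metis XS mult.assoc)
  have "X * R k = R k * X" for k
    by (rule inverses_commute[OF R[of k]]) (simp add: XSS distrib_left distrib_right)
  then have XRS: "X * (R k * S) = R k * S * X" for k
    by (metis XS mult.assoc)
  have "X * (\<Sum>k\<in>{1..<n}. (1 - real k / real n) *\<^sub>R (R k * S)) = (\<Sum>k\<in>{1..<n}. (1 - real k / real n) *\<^sub>R (R k * S)) * X" for n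
    unfolding sum_distrib_left sum_distrib_right by (intro sum.cong) (simp_all add: XRS)
  then have XB: "X * B n = B n * X" for n
    unfolding B_def by (simp add: left_diff_distrib right_diff_distrib distrib_left distrib_right XRS)
  from LIMSEQ_D[OF lim zero_less_one] obtain n where "norm (1 - B n * (1 - X)) < 1"
    by (metis norm_minus_commute order_refl)
  then obtain e where e: "inverses (B n * (1 - X)) e"
    using inverses_one_minus by fastforce
  have BX: "B n * (1 - X) = (1 - X) * B n" by (simp add: algebra_simps XB)
  have left: "(e * B n) * (1 - X) = 1" using e by (simp add: inverses_def mult.assoc)
  have right: "(1 - X) * (B n * e) = 1" using e BX by (simp add: inverses_def mult.assoc[symmetric])
  have "e * B n = (e * B n) * ((1 - X) * (B n * e))" by (simp add: right)
  also have "\<dots> = B n * e" by (simp only: mult.assoc[symmetric] left) simp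
  finally have Q: "inverses (1 - X) (e * B n)"
    using left right by (simp add: inverses_def)
  have "(\<lambda>m. B m * (1 - X) * (e * B n)) \<longlonglongrightarrow> 1 * (e * B n)"
    by (intro tendsto_intros lim)
  moreover have "B m * (1 - X) * (e * B n) = B m" for m
    using Q by (simp add: inverses_def mult.assoc)
  ultimately have "B \<longlonglongrightarrow> e * B n" by simp
  with Q show thesis unfolding X_def B_def by (rule that)
qed

section \<open>Bounds that are uniform in the period\<close>

text \<open>
  A lower Riemann sum of the decreasing function \<open>1 / (1 + x\<^sup>2)\<close> on \<open>[0, h n]\<close>.
\<close>

lemma arctan_riemann_sum:
  assumes h: "h > 0"
  shows "h * (\<Sum>k\<in>{1..<Suc n}. 1 / (1 + (h * real k)\<^sup>2)) \<le> arctan (h * n)"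
proof (induction n)
  case (Suc n)
  define x y where "x = h * real n" and "y = h * real (Suc n)"
  have xy: "0 \<le> x" "x < y" "y - x = h" using h by (auto simp: x_def y_def algebra_simps)
  have "\<exists>z>x. z < y \<and> arctan y - arctan x = (y - x) * inverse (1 + z\<^sup>2)"
    by (rule MVT2) (use xy in \<open>auto intro!: derivative_eq_intros\<close>)
  then obtain z where z: "x < z" "z < y" "arctan y - arctan x = h * inverse (1 + z\<^sup>2)"
    using xy by auto
  have "1 / (1 + y\<^sup>2) \<le> inverse (1 + z\<^sup>2)"
    using z xy by (auto simp: divide_simps add_pos_nonneg intro!: power_mono)
  then have "h * (1 / (1 + y\<^sup>2)) \<le> arctan y - arctan x"
    unfolding z(3) using h by (intro mult_left_mono) auto
  moreover have "{1..<Suc (Suc n)} = insert (Suc n) {1..<Suc n}" by auto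
  ultimately show ?case using Suc by (simp add: x_def y_def distrib_left)
qed simp

text \<open>
  With mesh \<open>h = 2 \<pi> / t\<close> the sum is \<open>1 / \<pi>\<close> times a Riemann sum of an integrand bounded by
  \<open>c / (1 + x\<^sup>2)\<close>. This is why no constant depends on \<open>t\<close>.
\<close>

lemma weighted_sum_bound:
  fixes f :: "nat \<Rightarrow> 'a::real_normed_vector"
  assumes t: "t \<ge> 1" and f: "\<And>k. norm (f k) \<le> c / (1 + (2 * pi * real k / t)\<^sup>2)"
  shows "norm ((1 / t) *\<^sub>R (f 0 + 2 *\<^sub>R (\<Sum>k\<in>{1..<n}. (1 - real k / real n) *\<^sub>R f k))) \<le> 2 * c"
proof -
  define h where "h = 2 * pi / t"
  define \<sigma> where "\<sigma> = (\<Sum>k\<in>{1..<n}. 1 / (1 + (h * real k)\<^sup>2))"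
  have h: "h > 0" using t by (simp add: h_def)
  have f': "norm (f k) \<le> c * (1 / (1 + (h * real k)\<^sup>2))" for k
    using f[of k] by (simp add: h_def)
  have c: "0 \<le> c" using f'[of 0] by simp (metis norm_ge_zero order.trans)
  have "h * \<sigma> \<le> pi / 2"
  proof (cases n)
    case (Suc m)
    then have "h * \<sigma> \<le> arctan (h * m)"
      using arctan_riemann_sum[OF h, of m] by (simp add: \<sigma>_def)
    then show ?thesis using arctan_ubound[of "h * m"] by linarith
  qed (simp add: \<sigma>_def)
  then have "\<sigma> / t \<le> 1 / 4" using t by (simp add: h_def field_simps)
  have "norm (\<Sum>k\<in>{1..<n}. (1 - real k / real n) *\<^sub>R f k) \<le> (\<Sum>k\<in>{1..<n}. c * (1 / (1 + (h * real k)\<^sup>2)))"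
  proof (rule sum_norm_le)
    fix k assume k: "k \<in> {1..<n}"
    then have "\<bar>1 - real k / real n\<bar> \<le> 1" by simp
    then have "norm ((1 - real k / real n) *\<^sub>R f k) \<le> norm (f k)"
      by (simp add: mult_left_le_one_le)
    then show "norm ((1 - real k / real n) *\<^sub>R f k) \<le> c * (1 / (1 + (h * real k)\<^sup>2))"
      using f'[of k] by linarith
  qed
  also have "\<dots> = c * \<sigma>" by (simp only: \<sigma>_def sum_distrib_left)
  finally have "norm (2 *\<^sub>R (\<Sum>k\<in>{1..<n}. (1 - real k / real n) *\<^sub>R f k)) \<le> 2 * (c * \<sigma>)" by simp
  moreover have "norm (f 0) \<le> c" using f'[of 0] by simp
  ultimately have "norm (f 0 + 2 *\<^sub>R (\<Sum>k\<in>{1..<n}. (1 - real k / real n) *\<^sub>R f k)) \<le> c + 2 * (c * \<sigma>)"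
    by (intro order.trans[OF norm_triangle_ineq] add_mono)
  then have "norm ((1 / t) *\<^sub>R (f 0 + 2 *\<^sub>R (\<Sum>k\<in>{1..<n}. (1 - real k / real n) *\<^sub>R f k)))
      \<le> (c + 2 * (c * \<sigma>)) / t"
    using t by (simp add: divide_right_mono)
  also have "\<dots> = c * (1 / t) + 2 * (c * (\<sigma> / t))" by (simp add: add_divide_distrib)
  also have "\<dots> \<le> c * 1 + 2 * (c * (1 / 4))"
    using t c \<open>\<sigma> / t \<le> 1 / 4\<close> by (intro add_mono mult_left_mono) auto
  also have "\<dots> \<le> 2 * c" using c by simp
  finally show ?thesis .
qed

text \<open>
  Both estimates pass to the limit from the partial fractions. For the dependence on \<open>e\<close>, with
  \<open>a = T + e\<close> and \<open>b = T + e'\<close>, one uses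
  \<open>a / (a\<^sup>2 + v\<^sup>2) - b / (b\<^sup>2 + v\<^sup>2) = (a - b) (v\<^sup>2 - a b) / ((a\<^sup>2 + v\<^sup>2) (b\<^sup>2 + v\<^sup>2))\<close>,
  which again decays like \<open>1 / (1 + v\<^sup>2)\<close>.
\<close>

lemma periodic_resolvent_bound:
  fixes T :: "'a::unital_banach_algebra"
  assumes T: "hyperbolic T"
  obtains r K L Q where "r > 0" "K \<ge> 0" "L \<ge> 0"
    "\<And>e t. \<bar>e\<bar> < r \<Longrightarrow> 1 \<le> t \<Longrightarrow> inverses (1 - expo (t *\<^sub>R (T + e *\<^sub>R 1))) (Q e t)"
    "\<And>e t. \<bar>e\<bar> < r \<Longrightarrow> 1 \<le> t \<Longrightarrow> norm (Q e t) \<le> K"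
    "\<And>e e' t. \<bar>e\<bar> < r \<Longrightarrow> \<bar>e'\<bar> < r \<Longrightarrow> 1 \<le> t \<Longrightarrow> norm (Q e t - Q e' t) \<le> L * \<bar>e - e'\<bar>"
proof -
  obtain C r0 where C: "C > 0" "r0 > 0"
    "\<And>S w. norm (S - T) < r0 \<Longrightarrow> \<exists>R. inverses (S * S + w\<^sup>2 *\<^sub>R 1) R \<and> norm R \<le> C / (1 + w\<^sup>2)"
    using hyperbolic_uniform_bound[OF T] by metis
  define r where "r = min 1 (r0 / (norm (1::'a) + 1))"
  have r: "r > 0" "r \<le> 1" using C(2) by (auto simp: r_def add_nonneg_pos)
  define S where "S e = T + e *\<^sub>R 1" for e
  have "norm (S e - T) < r0" if "\<bar>e\<bar> < r" for e
  proof -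
    have "norm (S e - T) \<le> \<bar>e\<bar> * (norm (1::'a) + 1)"
      by (simp add: S_def algebra_simps)
    also have "\<dots> < r0"
    proof -
      have "\<bar>e\<bar> < r0 / (norm (1::'a) + 1)" using that by (simp add: r_def)
      moreover have "0 < norm (1::'a) + 1" by (simp add: add_nonneg_pos)
      ultimately show ?thesis by (simp only: pos_less_divide_eq)
    qed
    finally show ?thesis .
  qed
  then have "\<exists>R. \<bar>e\<bar> < r \<longrightarrow> inverses (S e * S e + w\<^sup>2 *\<^sub>R 1) R \<and> norm R \<le> C / (1 + w\<^sup>2)" for e w
    using C(3) by blast
  then obtain R where R: "\<And>e w. \<bar>e\<bar> < r \<Longrightarrow> inverses (S e * S e + w\<^sup>2 *\<^sub>R 1) (R e w)"
      "\<And>e w. \<bar>e\<bar> < r \<Longrightarrow> norm (R e w) \<le> C / (1 + w\<^sup>2)"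
    by metis
  define m where "m = norm T + norm (1::'a)"
  have m: "norm (S e) \<le> m" if "\<bar>e\<bar> < r" for e
  proof -
    have "\<bar>e\<bar> * norm (1::'a) \<le> norm (1::'a)" using that r by (intro mult_left_le_one_le) auto
    then show ?thesis unfolding S_def m_def by (intro norm_triangle_le) simp
  qed
  define w where "w t k = 2 * pi * real k / t" for t :: real and k :: nat
  define f where "f e t k = R e (w t k) * S e" for e t k
  define B where "B e t n = (1/2) *\<^sub>R (1::'a) -
    (1 / t) *\<^sub>R (f e t 0 + 2 *\<^sub>R (\<Sum>k\<in>{1..<n}. (1 - real k / real n) *\<^sub>R f e t k))" for e t n
  have "\<exists>Q. \<bar>e\<bar> < r \<longrightarrow> 1 \<le> t \<longrightarrow> inverses (1 - expo (t *\<^sub>R S e)) Q \<and> B e t \<longlonglongrightarrow> Q" for e t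
  proof (cases "\<bar>e\<bar> < r \<and> 1 \<le> t")
    case True
    then have e: "\<bar>e\<bar> < r" and t: "t \<ge> 1" by auto
    define R' where "R' k = (1 / t\<^sup>2) *\<^sub>R R e (w t k)" for k
    have inv: "inverses (t *\<^sub>R S e * t *\<^sub>R S e + (2 * pi * real k)\<^sup>2 *\<^sub>R 1) (R' k)" for k
    proof -
      have "t *\<^sub>R S e * t *\<^sub>R S e + (2 * pi * real k)\<^sup>2 *\<^sub>R 1 = t\<^sup>2 *\<^sub>R (S e * S e + (w t k)\<^sup>2 *\<^sub>R 1)"
        using t by (simp add: scaleR_right_distrib w_def power_divide power2_eq_square)
      then show ?thesis using R(1)[OF e, of "w t k"] t by (simp add: inverses_def R'_def)
    qed
    have R'S: "R' k * t *\<^sub>R S e = (1 / t) *\<^sub>R f e t k" for k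
      using t by (simp add: R'_def f_def power2_eq_square)
    have "B e t n = (1/2) *\<^sub>R 1 - (R' 0 * t *\<^sub>R S e
        + 2 *\<^sub>R (\<Sum>k\<in>{1..<n}. (1 - real k / real n) *\<^sub>R (R' k * t *\<^sub>R S e)))" for n
      unfolding B_def R'S by (simp add: scaleR_right_distrib scaleR_sum_right mult.commute)
    then have "B e t = (\<lambda>n. (1/2) *\<^sub>R 1 - (R' 0 * t *\<^sub>R S e
        + 2 *\<^sub>R (\<Sum>k\<in>{1..<n}. (1 - real k / real n) *\<^sub>R (R' k * t *\<^sub>R S e))))"
      by auto
    then show ?thesis using one_minus_expo_inverse[of "t *\<^sub>R S e" R'] inv by metis
  qed auto
  then obtain Q where Q: "\<And>e t. \<bar>e\<bar> < r \<Longrightarrow> 1 \<le> t \<Longrightarrow> inverses (1 - expo (t *\<^sub>R S e)) (Q e t)"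
      "\<And>e t. \<bar>e\<bar> < r \<Longrightarrow> 1 \<le> t \<Longrightarrow> B e t \<longlonglongrightarrow> Q e t"
    by metis
  define K where "K = 1 / 2 * norm (1::'a) + 2 * (C * m)"
  define L where "L = 2 * (C\<^sup>2 * (norm (1::'a) + m\<^sup>2))"
  have m0: "m \<ge> 0" by (simp add: m_def)
  show thesis
  proof (rule that[of r K L Q])
    show "r > 0" "K \<ge> 0" "L \<ge> 0" using r C(1) m0 by (auto simp: K_def L_def)
    show "inverses (1 - expo (t *\<^sub>R (T + e *\<^sub>R 1))) (Q e t)" if "\<bar>e\<bar> < r" "1 \<le> t" for e t
      using Q(1)[OF that] by (simp add: S_def)
    show "norm (Q e t) \<le> K" if e: "\<bar>e\<bar> < r" and t: "1 \<le> t" for e t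
    proof (rule LIMSEQ_le_const2[OF tendsto_norm[OF Q(2)[OF e t]]], intro exI allI impI)
      fix n
      have "norm (f e t k) \<le> C * m / (1 + (2 * pi * real k / t)\<^sup>2)" for k
        using mult_mono[OF R(2)[OF e, of "w t k"] m[OF e]] norm_mult_ineq[of "R e (w t k)" "S e"] C(1)
        by (simp add: f_def w_def)
      from weighted_sum_bound[OF t this, of n] show "norm (B e t n) \<le> K"
        unfolding B_def K_def by (intro order.trans[OF norm_triangle_ineq4] add_mono) auto
    qed
    show "norm (Q e t - Q e' t) \<le> L * \<bar>e - e'\<bar>" if e: "\<bar>e\<bar> < r" and e': "\<bar>e'\<bar> < r" and t: "1 \<le> t" for e e' t
    proof (rule LIMSEQ_le_const2[OF tendsto_norm[OF tendsto_diff[OF Q(2)[OF e t] Q(2)[OF e' t]]]], intro exI allI impI)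
      fix n
      define c where "c = C\<^sup>2 * (norm (1::'a) + m\<^sup>2) * \<bar>e - e'\<bar>"
      have g: "norm (f e' t k - f e t k) \<le> c / (1 + (2 * pi * real k / t)\<^sup>2)" for k
      proof -
        define v where "v = w t k"
        define a b x y where "a = S e" and "b = S e'" and "x = R e v" and "y = R e' v"
        have x: "x * (a * a + v\<^sup>2 *\<^sub>R 1) = 1" and y: "(b * b + v\<^sup>2 *\<^sub>R 1) * y = 1"
          using R(1)[OF e, of v] R(1)[OF e', of v] by (auto simp: inverses_def a_def b_def x_def y_def)
        have "b * y = y * b"
          using R(1)[OF e', of v] unfolding b_def y_def
          by (rule inverses_commute) (simp add: algebra_simps)
        then have "f e t k - f e' t k = x * a - b * y"
          by (simp add: f_def a_def b_def x_def y_def v_def)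
        also have "\<dots> = x * a * ((b * b + v\<^sup>2 *\<^sub>R 1) * y) - x * (a * a + v\<^sup>2 *\<^sub>R 1) * (b * y)"
          by (simp only: x y mult_1_left mult_1_right)
        also have "\<dots> = x * (a * (b * b + v\<^sup>2 *\<^sub>R 1) - (a * a + v\<^sup>2 *\<^sub>R 1) * b) * y"
          by (simp add: left_diff_distrib right_diff_distrib mult.assoc)
        also have "a * (b * b + v\<^sup>2 *\<^sub>R 1) - (a * a + v\<^sup>2 *\<^sub>R 1) * b = (e - e') *\<^sub>R (v\<^sup>2 *\<^sub>R 1 - a * b)"
          by (simp add: a_def b_def S_def algebra_simps)
        finally have eq: "f e t k - f e' t k = (e - e') *\<^sub>R (x * (v\<^sup>2 *\<^sub>R 1 - a * b) * y)"
          by simp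
        have "norm (v\<^sup>2 *\<^sub>R 1 - a * b) \<le> v\<^sup>2 * norm (1::'a) + m * m"
          using m[OF e] m[OF e'] m0 unfolding a_def b_def
          by (intro order.trans[OF norm_triangle_ineq4] add_mono order.trans[OF norm_mult_ineq] mult_mono) auto
        also have "\<dots> \<le> (1 + v\<^sup>2) * (norm (1::'a) + m\<^sup>2)"
        proof -
          have "0 \<le> v\<^sup>2 * m\<^sup>2" "0 \<le> norm (1::'a)" by simp_all
          then show ?thesis by (simp add: algebra_simps power2_eq_square)
        qed
        finally have "norm (x * (v\<^sup>2 *\<^sub>R 1 - a * b) * y)
            \<le> C / (1 + v\<^sup>2) * ((1 + v\<^sup>2) * (norm (1::'a) + m\<^sup>2)) * (C / (1 + v\<^sup>2))"
          using R(2)[OF e, of v] R(2)[OF e', of v] C(1) unfolding x_def y_def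
          by (intro order.trans[OF norm_mult_ineq] mult_mono) auto
        also have "\<dots> = C\<^sup>2 * (norm (1::'a) + m\<^sup>2) / (1 + v\<^sup>2)"
        proof -
          have "1 + v\<^sup>2 \<noteq> 0" by (metis add_pos_nonneg less_irrefl zero_le_power2 zero_less_one)
          then show ?thesis by (simp add: power2_eq_square[of C])
        qed
        finally have "\<bar>e - e'\<bar> * norm (x * (v\<^sup>2 *\<^sub>R 1 - a * b) * y)
            \<le> \<bar>e - e'\<bar> * (C\<^sup>2 * (norm (1::'a) + m\<^sup>2) / (1 + v\<^sup>2))"
          by (rule mult_left_mono) simp
        then show ?thesis
          unfolding norm_minus_commute[of "f e' t k"] eq norm_scaleR by (simp add: c_def v_def w_def mult_ac)
      qed
      have "B e t n - B e' t n = (1 / t) *\<^sub>R ((f e' t 0 - f e t 0)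
          + 2 *\<^sub>R (\<Sum>k\<in>{1..<n}. (1 - real k / real n) *\<^sub>R (f e' t k - f e t k)))"
        unfolding B_def by (simp add: scaleR_right_diff_distrib scaleR_right_distrib sum_subtractf)
      then show "norm (B e t n - B e' t n) \<le> L * \<bar>e - e'\<bar>"
        using weighted_sum_bound[OF t g, of n] by (simp add: L_def c_def)
    qed
  qed
qed

section \<open>The spectral projection of a hyperbolic element\<close>

text \<open>
  For \<open>U = e\<^bsup>t(T + e)\<^esup>\<close> and \<open>U' = e\<^bsup>t(T + e')\<^esup>\<close> with \<open>e > e'\<close> the factor \<open>c = e\<^bsup>t(e - e')\<^esup>\<close>
  is huge, so bounds on \<open>Q - Q'\<close> force \<open>Q (Q' - 1)\<close> to be small.
\<close>

lemma resolvent_identity: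
  fixes U U' :: "'a::{real_algebra, monoid_mult}"
  assumes Q: "inverses (1 - U) Q" and Q': "inverses (1 - U') Q'" and U: "U = c *\<^sub>R U'"
  shows "Q - Q' = (c - 1) *\<^sub>R (Q * (Q' - 1))" and "Q - Q' = (c - 1) *\<^sub>R ((Q' - 1) * Q)"
proof -
  have 1: "U' * Q' = Q' - 1" "Q' * U' = Q' - 1"
    using Q' by (auto simp: inverses_def algebra_simps)
  have "Q - Q' = Q * ((1 - U') * Q') - Q * (1 - U) * Q'"
    using Q Q' by (simp add: inverses_def)
  also have "\<dots> = (c - 1) *\<^sub>R (Q * (U' * Q'))"
    by (simp add: U algebra_simps)
  finally show "Q - Q' = (c - 1) *\<^sub>R (Q * (Q' - 1))" by (simp only: 1)
  have "Q - Q' = Q' * (1 - U') * Q - Q' * ((1 - U) * Q)"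
    using Q Q' by (simp add: inverses_def)
  also have "\<dots> = (c - 1) *\<^sub>R (Q' * U' * Q)"
    by (simp add: U algebra_simps)
  finally show "Q - Q' = (c - 1) *\<^sub>R ((Q' - 1) * Q)" by (simp only: 1)
qed

text \<open>
  For exponentials over time \<open>t\<close> this is the shift \<open>e - e' = 1 / t\<close>, just large enough for the factor \<open>c - 1\<close> to stay away from \<open>0\<close>, and small
  enough for \<open>Q\<close> and \<open>Q'\<close> to differ only by a multiple of \<open>1 / t\<close>. Replacing \<open>Q\<close> by \<open>Q'\<close> in
  \<open>Q (Q' - 1)\<close> costs the bounded factor \<open>Q' (1 - U)\<close>.
\<close>

lemma almost_idempotent:
  fixes U U' :: "'a::unital_banach_algebra"
  assumes Q: "inverses (1 - U) Q" and Q': "inverses (1 - U') Q'" and U: "U = exp 1 *\<^sub>R U'"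
    and K: "norm Q' \<le> K" and d: "norm (Q - Q') \<le> d"
  shows "norm (Q' * (Q' - 1)) \<le> (K + exp 1 * (K + norm (1::'a))) * d"
proof -
  have c: "exp 1 - 1 \<ge> (1::real)" using exp_ge_add_one_self[of 1] by simp
  have U'Q': "Q' * U' = Q' - 1"
    using Q' by (auto simp: inverses_def algebra_simps)
  have "1 * norm (Q * (Q' - 1)) \<le> (exp 1 - 1) * norm (Q * (Q' - 1))"
    using c by (intro mult_right_mono) auto
  also have "\<dots> = norm (Q - Q')"
    using resolvent_identity(1)[OF Q Q' U] c by simp
  finally have 1: "norm (Q * (Q' - 1)) \<le> d" using d by simp
  have "Q' * (Q' - 1) = Q' * ((1 - U) * Q) * (Q' - 1)"
    using Q by (simp add: inverses_def)
  also have "\<dots> = (Q' * (1 - U)) * (Q * (Q' - 1))" by (simp add: mult.assoc)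
  also have "Q' * (1 - U) = Q' - exp 1 *\<^sub>R (Q' - 1)"
    by (simp add: U right_diff_distrib U'Q')
  finally have eq: "Q' * (Q' - 1) = (Q' - exp 1 *\<^sub>R (Q' - 1)) * (Q * (Q' - 1))" .
  have K0: "K \<ge> 0" using K norm_ge_zero order.trans by blast
  have "norm (Q' - 1) \<le> K + norm (1::'a)" using K by (intro order.trans[OF norm_triangle_ineq4]) simp
  then have "norm (Q' - exp 1 *\<^sub>R (Q' - 1)) \<le> K + exp 1 * (K + norm (1::'a))"
    using K by (intro order.trans[OF norm_triangle_ineq4] add_mono) auto
  then show ?thesis
    unfolding eq using 1 K0 by (rule_tac order.trans[OF norm_mult_ineq mult_mono]) auto
qed

text \<open>
  Doubling the time changes the inverse only by a multiple of its idempotency defect. (In terms of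
  \<open>2 Q - 1\<close> this is a Newton step for the sign function.)
\<close>

lemma inverses_doubling:
  fixes U :: "'a::{real_algebra, monoid_mult}"
  assumes Q: "inverses (1 - U) Q" and Q2: "inverses (1 - U * U) Q2"
  shows "Q - Q2 = (4 *\<^sub>R Q2 - 2 *\<^sub>R Q - 1) * ((Q - 1) * Q)"
proof -
  have UQ: "U * Q = Q - 1" using Q by (simp add: inverses_def algebra_simps)
  have "Q - Q2 = Q2 * (1 - U * U) * Q - Q2 * ((1 - U) * Q)"
    using Q Q2 by (simp add: inverses_def)
  also have "\<dots> = Q2 * U * ((1 - U) * Q)" by (simp add: algebra_simps)
  also have "\<dots> = Q2 * U" using Q by (simp add: inverses_def)
  finally have Q2U: "Q - Q2 = Q2 * U" .
  have "Q2 * ((1 - U) * (1 - U)) = 2 *\<^sub>R (Q2 - Q2 * U) - Q2 * (1 - U * U)"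
    by (simp add: algebra_simps scaleR_2)
  also have "\<dots> = 4 *\<^sub>R Q2 - 2 *\<^sub>R Q - 1"
    using Q2 scaleR_left_distrib[of 2 2 Q2]
    by (simp add: Q2U[symmetric] inverses_def scaleR_right_diff_distrib)
  finally have 1: "Q2 * ((1 - U) * (1 - U)) = 4 *\<^sub>R Q2 - 2 *\<^sub>R Q - 1" .
  have "Q2 * U = Q2 * U * ((1 - U) * ((1 - U) * Q) * Q)"
    using Q by (simp add: inverses_def)
  also have "\<dots> = Q2 * ((1 - U) * (1 - U)) * (U * Q * Q)"
    by (simp add: algebra_simps)
  finally show ?thesis unfolding Q2U 1 UQ .
qed

lemma convergent_geometric_steps:
  fixes a :: "nat \<Rightarrow> 'a::banach"
  assumes "\<And>j. norm (a (Suc j) - a j) \<le> c * (1 / 2) ^ j"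
  shows "convergent a"
proof -
  have "summable (\<lambda>j. a (Suc j) - a j)"
    by (rule summable_comparison_test'[where g = "\<lambda>j. c * (1 / 2) ^ j" and N = 0])
       (use assms in \<open>auto intro!: summable_mult summable_geometric\<close>)
  from summable_LIMSEQ[OF this] have "(\<lambda>n. a n - a 0) \<longlonglongrightarrow> (\<Sum>j. a (Suc j) - a j)"
    by (simp add: sum_lessThan_telescope)
  then have "(\<lambda>n. a n - a 0 + a 0) \<longlonglongrightarrow> (\<Sum>j. a (Suc j) - a j) + a 0"
    by (intro tendsto_intros)
  then show ?thesis by (auto simp: convergent_def)
qed

lemma small_idempotent_eq_0:
  fixes D :: "'a::real_normed_algebra"
  assumes "D * D = D" "norm D < 1"
  shows "D = 0"
proof (rule ccontr)
  assume "D \<noteq> 0"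
  then have "norm D * norm D < norm D" using assms(2) by simp
  moreover have "norm D \<le> norm D * norm D" using norm_mult_ineq[of D D] assms(1) by simp
  ultimately show False by simp
qed

text \<open>
  For \<open>v = (1 - U) P\<close> the product \<open>Q v = P\<close> is known, while \<open>Q\<close> is within \<open>1 / 2\<close> of the identity on the
  range of \<open>P\<close>; hence \<open>v\<close> is at most twice as large as \<open>P\<close>.
\<close>

lemma idempotent_range_bound:
  fixes U :: "'a::unital_banach_algebra"
  assumes Q: "inverses (1 - U) Q" and P: "P * P = P" "P * U = U * P" and QP: "norm (Q - P) \<le> 1 / 2"
  shows "norm (U * P) \<le> 3 * norm P"
proof -
  define v where "v = (1 - U) * P"
  have "Q * v = Q * (1 - U) * P" by (simp add: v_def mult.assoc)
  then have Qv: "Q * v = P" using Q by (simp add: inverses_def)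
  have "P * v = (1 - U) * (P * P)"
    unfolding v_def by (simp add: algebra_simps P(2)) (metis P(2) mult.assoc)
  then have Pv: "P * v = v" by (simp add: P v_def)
  have "v = P - (Q - P) * v" by (simp add: left_diff_distrib Qv Pv)
  then have "norm v \<le> norm P + norm ((Q - P) * v)" by (metis norm_triangle_ineq4)
  moreover have "norm ((Q - P) * v) \<le> 1 / 2 * norm v"
    using QP by (intro order.trans[OF norm_mult_ineq] mult_right_mono) auto
  ultimately have "norm v \<le> 2 * norm P" by simp
  moreover have "U * P = P - v" by (simp add: v_def algebra_simps)
  ultimately show ?thesis using norm_triangle_ineq4[of P v] by simp
qed

text \<open>
  Dually, \<open>Q\<close> has norm at most \<open>1 / 2\<close> on the kernel of \<open>P\<close>, so that \<open>y = Q (1 - U) y\<close> makes \<open>U\<close>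
  nowhere contracting there.
\<close>

lemma idempotent_kernel_bound:
  fixes U :: "'a::unital_banach_algebra"
  assumes Q: "inverses (1 - U) Q" and V: "inverses U V" and P: "P * P = P" "P * U = U * P"
    and QP: "norm (Q - P) \<le> 1 / 2"
  shows "norm (V * (1 - P)) \<le> norm (1 - P)"
proof -
  define y where "y = V * (1 - P)"
  define v where "v = (1 - U) * y"
  have "U * y = (U * V) * (1 - P)" by (simp add: y_def mult.assoc)
  then have v: "v = y - (1 - P)" using V by (simp add: v_def left_diff_distrib inverses_def)
  have "Q * v = Q * (1 - U) * y" by (simp add: v_def mult.assoc)
  then have Qv: "Q * v = y" using Q by (simp add: inverses_def)
  have PP: "P * (1 - P) = 0" by (simp add: right_diff_distrib P)
  have "P * V = V * P" by (rule inverses_commute[OF V P(2)])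
  then have "P * y = V * (P * (1 - P))" unfolding y_def by (metis mult.assoc)
  then have "P * v = 0" by (simp add: v right_diff_distrib[of P y] PP)
  then have "y = (Q - P) * v" by (simp add: left_diff_distrib Qv)
  then have "norm y \<le> 1 / 2 * norm v"
    using QP by (metis norm_mult_ineq mult_right_mono norm_ge_zero order.trans)
  moreover have "norm v \<le> norm y + norm (1 - P)" unfolding v by (rule norm_triangle_ineq4)
  ultimately show ?thesis unfolding y_def by simp
qed

text \<open>
  Let \<open>Q e t\<close> be the inverse of \<open>1 - e\<^bsup>t(T + e)\<^esup>\<close>. Along the times \<open>2\<^sup>j\<close> the idempotency defects are
  summable, so the doubling identity makes \<open>Q e\<close> converge to an idempotent \<open>p e\<close>. The resolvent
  identity gives \<open>p e p e' = p e\<close> for \<open>e' < e\<close>, hence \<open>p e' - p e\<close> is idempotent; it is small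
  for close shifts, so it is \<open>0\<close>. Thus one projection serves the shifts \<open>\<epsilon>\<close> and \<open>- \<epsilon>\<close>, and these supply
  the exponential rates on its range and its kernel.
\<close>

theorem exponential_dichotomy:
  fixes T :: "'a::unital_banach_algebra"
  assumes T: "hyperbolic T"
  obtains P where "P * P = P" "\<And>J. J * T = T * J \<Longrightarrow> J * P = P * J"
    "\<And>\<eta>. \<eta> > 0 \<Longrightarrow> \<exists>t\<ge>1. norm (expo (t *\<^sub>R T) * P) \<le> \<eta> \<and> norm (expo (- (t *\<^sub>R T)) * (1 - P)) \<le> \<eta>"
proof -
  obtain r K L Q where r: "r > 0" and K: "K \<ge> 0" and L: "L \<ge> 0"
    and Q: "\<And>e t. \<bar>e\<bar> < r \<Longrightarrow> 1 \<le> t \<Longrightarrow> inverses (1 - expo (t *\<^sub>R (T + e *\<^sub>R 1))) (Q e t)"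
    and QK: "\<And>e t. \<bar>e\<bar> < r \<Longrightarrow> 1 \<le> t \<Longrightarrow> norm (Q e t) \<le> K"
    and QL: "\<And>e e' t. \<bar>e\<bar> < r \<Longrightarrow> \<bar>e'\<bar> < r \<Longrightarrow> 1 \<le> t \<Longrightarrow> norm (Q e t - Q e' t) \<le> L * \<bar>e - e'\<bar>"
    using periodic_resolvent_bound[OF T] by metis
  define U where "U e t = expo (t *\<^sub>R (T + e *\<^sub>R 1))" for e t
  note Q = Q[folded U_def]
  have U: "U e t = exp (t * e) *\<^sub>R expo (t *\<^sub>R T)" for e t
    using expo_shift[of "t *\<^sub>R T" "t * e"] by (simp add: U_def scaleR_right_distrib)
  have UU: "U e t = exp (t * (e - e')) *\<^sub>R U e' t" for e e' t
    by (simp add: U exp_add[symmetric] algebra_simps)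
  have U2: "U e (2 * t) = U e t * U e t" for e t
    using expo_add[of "t *\<^sub>R (T + e *\<^sub>R 1)" "t *\<^sub>R (T + e *\<^sub>R 1)"]
    by (simp add: U_def scaleR_2[symmetric])
  \<comment> \<open>Starting at \<open>2 ^ j0\<close> keeps the shifts by \<open>1 / \<tau> j\<close> within the admissible range.\<close>
  obtain j0 where j0: "(2::real) ^ j0 > max 1 (2 / r)"
    using real_arch_pow[of 2 "max 1 (2 / r)"] by auto
  define \<tau> where "\<tau> j = (2::real) ^ (j0 + j)" for j
  have \<tau>: "\<tau> j \<ge> 1" "1 / \<tau> j < r / 2" "2 ^ j \<le> \<tau> j" for j
  proof -
    have 1: "(1::real) \<le> 2 ^ j" by simp
    have 2: "\<tau> j = 2 ^ j0 * 2 ^ j" by (simp add: \<tau>_def power_add)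
    have "2 ^ j0 * 1 \<le> \<tau> j" unfolding 2 by (intro mult_left_mono) auto
    then have "2 / r < \<tau> j" "1 \<le> \<tau> j" using j0 by auto
    then show "\<tau> j \<ge> 1" "1 / \<tau> j < r / 2" using r by (auto simp: field_simps)
    show "2 ^ j \<le> \<tau> j" by (simp add: \<tau>_def)
  qed
  have \<tau>_top: "filterlim \<tau> at_top sequentially"
  proof (rule filterlim_at_top_mono[OF filterlim_real_sequentially])
    have "real j \<le> \<tau> j" for j
      using of_nat_less_two_power[of j, where ?'a = real] \<tau>(3)[of j] by linarith
    then show "\<forall>\<^sub>F j in sequentially. real j \<le> \<tau> j" by simp
  qed
  define E where "E = K + exp 1 * (K + norm (1::'a))"
  have E0: "E \<ge> 0" using K by (simp add: E_def)
  have idem: "norm (Q e (\<tau> j) * (Q e (\<tau> j) - 1)) \<le> E * L / \<tau> j" if e: "\<bar>e\<bar> \<le> r / 2" for e j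
  proof -
    have e1: "\<bar>e\<bar> < r" and e2: "\<bar>e + 1 / \<tau> j\<bar> < r"
    proof -
      have "0 < 1 / \<tau> j" using \<tau>(1)[of j] by simp
      then show "\<bar>e\<bar> < r" "\<bar>e + 1 / \<tau> j\<bar> < r" using e r \<tau>(2)[of j] by linarith+
    qed
    have "U (e + 1 / \<tau> j) (\<tau> j) = exp 1 *\<^sub>R U e (\<tau> j)"
      using UU[of "e + 1 / \<tau> j" "\<tau> j" e] \<tau>(1)[of j] by simp
    moreover have "norm (Q (e + 1 / \<tau> j) (\<tau> j) - Q e (\<tau> j)) \<le> L / \<tau> j"
      using QL[OF e2 e1 \<tau>(1)[of j]] \<tau>(1)[of j] by simp
    ultimately have "norm (Q e (\<tau> j) * (Q e (\<tau> j) - 1)) \<le> E * (L / \<tau> j)"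
      unfolding E_def using almost_idempotent[OF Q[OF e2 \<tau>(1)] Q[OF e1 \<tau>(1)]] QK[OF e1 \<tau>(1)] by blast
    then show ?thesis by simp
  qed
  have conv: "convergent (\<lambda>j. Q e (\<tau> j))" if e: "\<bar>e\<bar> \<le> r / 2" for e
  proof (rule convergent_geometric_steps)
    fix j
    have e1: "\<bar>e\<bar> < r" using e r by simp
    define q q2 where "q = Q e (\<tau> j)" and "q2 = Q e (\<tau> (Suc j))"
    have q: "inverses (1 - U e (\<tau> j)) q" unfolding q_def by (rule Q[OF e1 \<tau>(1)])
    have "\<tau> (Suc j) = 2 * \<tau> j" by (simp add: \<tau>_def)
    then have q2: "inverses (1 - U e (\<tau> j) * U e (\<tau> j)) q2"
      using Q[OF e1 \<tau>(1), of "Suc j"] by (simp add: U2 q2_def)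
    have K': "norm q \<le> K" "norm q2 \<le> K" unfolding q_def q2_def by (rule QK[OF e1 \<tau>(1)])+
    have "norm (4 *\<^sub>R q2 - 2 *\<^sub>R q - 1) \<le> 4 * K + 2 * K + norm (1::'a)"
      using K' by (intro order.trans[OF norm_triangle_ineq4] add_mono) auto
    moreover have "norm ((q - 1) * q) \<le> E * L / \<tau> j"
      using idem[OF e, of j] by (simp add: q_def algebra_simps)
    ultimately have "norm (q - q2) \<le> (6 * K + norm (1::'a)) * (E * L / \<tau> j)"
      unfolding inverses_doubling[OF q q2] using K
      by (rule_tac order.trans[OF norm_mult_ineq mult_mono]) auto
    also have "\<dots> \<le> (6 * K + norm (1::'a)) * (E * L * (1 / 2) ^ j)"
    proof (rule mult_left_mono)
      have "E * L / \<tau> j \<le> E * L / 2 ^ j"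
        using E0 L \<tau>(3)[of j] by (intro divide_left_mono) (auto simp: \<tau>_def)
      then show "E * L / \<tau> j \<le> E * L * (1 / 2) ^ j" by (simp add: power_divide)
    qed (use K in auto)
    finally show "norm (q2 - q) \<le> (6 * K + norm (1::'a)) * (E * L) * (1 / 2) ^ j"
      by (simp add: norm_minus_commute mult.assoc)
  qed
  define p where "p e = lim (\<lambda>j. Q e (\<tau> j))" for e
  have p: "(\<lambda>j. Q e (\<tau> j)) \<longlonglongrightarrow> p e" if "\<bar>e\<bar> \<le> r / 2" for e
    using conv[OF that] by (simp add: p_def convergent_LIMSEQ_iff)
  have inv_\<tau>: "(\<lambda>j. c / \<tau> j) \<longlonglongrightarrow> 0" for c
    by (rule real_tendsto_divide_at_top[OF tendsto_const \<tau>_top])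
  have pp: "p e * p e = p e" if e: "\<bar>e\<bar> \<le> r / 2" for e
  proof -
    have "(\<lambda>j. Q e (\<tau> j) * (Q e (\<tau> j) - 1)) \<longlonglongrightarrow> p e * (p e - 1)"
      by (intro tendsto_intros p[OF e])
    moreover have "(\<lambda>j. Q e (\<tau> j) * (Q e (\<tau> j) - 1)) \<longlonglongrightarrow> 0"
      by (rule Lim_null_comparison[OF _ inv_\<tau>[of "E * L"]]) (simp add: idem[OF e])
    ultimately have "p e * (p e - 1) = 0" by (rule LIMSEQ_unique)
    then show ?thesis by (simp add: right_diff_distrib)
  qed
  have nest: "p e * (p e' - 1) = 0 \<and> (p e' - 1) * p e = 0"
    if e: "\<bar>e\<bar> \<le> r / 2" and e': "\<bar>e'\<bar> \<le> r / 2" and less: "e' < e" for e e'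
  proof -
    have e1: "\<bar>e\<bar> < r" "\<bar>e'\<bar> < r" using e e' r by auto
    have small: "norm x \<le> 2 * K / (e - e') / \<tau> j"
      if x: "Q e (\<tau> j) - Q e' (\<tau> j) = (exp (\<tau> j * (e - e')) - 1) *\<^sub>R x" for x j
    proof -
      have pos: "0 < \<tau> j * (e - e')" using \<tau>(1)[of j] less by simp
      have "\<tau> j * (e - e') * norm x \<le> \<bar>exp (\<tau> j * (e - e')) - 1\<bar> * norm x"
        using exp_ge_add_one_self[of "\<tau> j * (e - e')"] by (intro mult_right_mono norm_ge_zero) linarith
      also have "\<dots> = norm (Q e (\<tau> j) - Q e' (\<tau> j))" by (simp add: x)
      also have "\<dots> \<le> K + K"
        by (intro order.trans[OF norm_triangle_ineq4] add_mono QK e1 \<tau>(1))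
      finally have "norm x * (\<tau> j * (e - e')) \<le> 2 * K" by (simp add: mult.commute)
      then have "norm x \<le> 2 * K / (\<tau> j * (e - e'))" using pos by (simp only: pos_le_divide_eq)
      then show ?thesis by (simp add: mult.commute)
    qed
    note id = resolvent_identity[OF Q[OF e1(1) \<tau>(1)] Q[OF e1(2) \<tau>(1)] UU]
    have "(\<lambda>j. Q e (\<tau> j) * (Q e' (\<tau> j) - 1)) \<longlonglongrightarrow> p e * (p e' - 1)"
      "(\<lambda>j. (Q e' (\<tau> j) - 1) * Q e (\<tau> j)) \<longlonglongrightarrow> (p e' - 1) * p e"
      by (intro tendsto_intros p[OF e] p[OF e'])+
    moreover have "(\<lambda>j. Q e (\<tau> j) * (Q e' (\<tau> j) - 1)) \<longlonglongrightarrow> 0"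
      "(\<lambda>j. (Q e' (\<tau> j) - 1) * Q e (\<tau> j)) \<longlonglongrightarrow> 0"
      using small[OF id(1)] small[OF id(2)]
      by (auto intro!: Lim_null_comparison[OF _ inv_\<tau>[of "2 * K / (e - e')"]] always_eventually)
    ultimately show ?thesis using LIMSEQ_unique by blast
  qed
  \<comment> \<open>Small enough that \<open>p (- \<epsilon>) - p \<epsilon>\<close>, of norm at most \<open>2 L \<epsilon>\<close>, has norm less than \<open>1\<close>.\<close>
  define \<epsilon> where "\<epsilon> = min (r / 2) (1 / (2 * L + 1) / 2)"
  have \<epsilon>: "0 < \<epsilon>" "\<bar>\<epsilon>\<bar> \<le> r / 2" "\<bar>- \<epsilon>\<bar> \<le> r / 2" using r L by (auto simp: \<epsilon>_def)
  then have \<epsilon>r: "\<bar>\<epsilon>\<bar> < r" "\<bar>- \<epsilon>\<bar> < r" using r by auto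
  have "2 * L * \<epsilon> < 1"
  proof -
    have "2 * L * \<epsilon> \<le> 2 * L * (1 / (2 * L + 1) / 2)"
      using L by (intro mult_left_mono) (auto simp: \<epsilon>_def)
    also have "\<dots> < 1" using L by (simp add: field_simps)
    finally show ?thesis .
  qed
  define D where "D = p (- \<epsilon>) - p \<epsilon>"
  have "norm D \<le> L * \<bar>- \<epsilon> - \<epsilon>\<bar>"
    unfolding D_def
    by (rule LIMSEQ_le_const2[OF tendsto_norm[OF tendsto_diff[OF p[OF \<epsilon>(3)] p[OF \<epsilon>(2)]]]])
       (intro exI allI impI QL \<epsilon>r \<tau>(1))
  then have "norm D < 1" using \<open>2 * L * \<epsilon> < 1\<close> \<epsilon>(1) by simp
  moreover have "D * D = D"
  proof -
    have "p \<epsilon> * p (- \<epsilon>) = p \<epsilon>" "p (- \<epsilon>) * p \<epsilon> = p \<epsilon>"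
      using nest[OF \<epsilon>(2,3)] \<epsilon>(1) by (auto simp: algebra_simps)
    then show ?thesis by (simp add: D_def left_diff_distrib right_diff_distrib pp[OF \<epsilon>(2)] pp[OF \<epsilon>(3)])
  qed
  ultimately have "D = 0" by (rule small_idempotent_eq_0[rotated])
  define P where "P = p \<epsilon>"
  have P: "p (- \<epsilon>) = P" "p \<epsilon> = P" using \<open>D = 0\<close> by (auto simp: D_def P_def)
  have commP: "J * P = P * J" if J: "J * T = T * J" for J
  proof -
    have "J * Q \<epsilon> (\<tau> j) = Q \<epsilon> (\<tau> j) * J" for j
    proof (rule inverses_commute[OF Q[OF \<epsilon>r(1) \<tau>(1)]])
      have "J * U \<epsilon> (\<tau> j) = U \<epsilon> (\<tau> j) * J"
        unfolding U_def by (rule expo_commute) (simp add: J algebra_simps)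
      then show "J * (1 - U \<epsilon> (\<tau> j)) = (1 - U \<epsilon> (\<tau> j)) * J" by (simp add: algebra_simps)
    qed
    moreover have "(\<lambda>j. J * Q \<epsilon> (\<tau> j)) \<longlonglongrightarrow> J * P" "(\<lambda>j. Q \<epsilon> (\<tau> j) * J) \<longlonglongrightarrow> P * J"
      unfolding P_def by (intro tendsto_intros p \<epsilon>)+
    ultimately show ?thesis using LIMSEQ_unique by simp
  qed
  show thesis
  proof (rule that[of P])
    show PP: "P * P = P" unfolding P_def by (rule pp[OF \<epsilon>(2)])
    show "J * P = P * J" if "J * T = T * J" for J by (rule commP[OF that])
    fix \<eta> :: real assume \<eta>: "\<eta> > 0"
    have "(\<lambda>j. Q \<epsilon> (\<tau> j) - P) \<longlonglongrightarrow> 0" "(\<lambda>j. Q (- \<epsilon>) (\<tau> j) - P) \<longlonglongrightarrow> 0"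
      using p[OF \<epsilon>(2)] p[OF \<epsilon>(3)] by (simp_all add: P LIM_zero)
    from this[THEN tendsto_norm_zero, THEN order_tendstoD(2), of "1/2"]
    have "\<forall>\<^sub>F j in sequentially. norm (Q \<epsilon> (\<tau> j) - P) < 1 / 2"
      "\<forall>\<^sub>F j in sequentially. norm (Q (- \<epsilon>) (\<tau> j) - P) < 1 / 2"
      by simp_all
    moreover have "(\<lambda>j. exp (- (\<epsilon> * \<tau> j)) * c) \<longlonglongrightarrow> 0" for c :: real
    proof -
      have "filterlim (\<lambda>j. \<epsilon> * \<tau> j) at_top sequentially"
        by (rule filterlim_tendsto_pos_mult_at_top[OF tendsto_const \<epsilon>(1) \<tau>_top])
      then have "(\<lambda>j. exp (- (\<epsilon> * \<tau> j))) \<longlonglongrightarrow> 0"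
        by (intro filterlim_compose[OF exp_at_bot]) (simp add: filterlim_uminus_at_bot)
      then show ?thesis by (rule tendsto_mult_left_zero)
    qed
    then have "\<forall>\<^sub>F j in sequentially. exp (- (\<epsilon> * \<tau> j)) * c < \<eta>" for c
      using \<eta> order_tendstoD(2) by blast
    ultimately have "\<forall>\<^sub>F j in sequentially. norm (Q \<epsilon> (\<tau> j) - P) < 1 / 2 \<and> norm (Q (- \<epsilon>) (\<tau> j) - P) < 1 / 2
        \<and> exp (- (\<epsilon> * \<tau> j)) * (3 * norm P) < \<eta> \<and> exp (- (\<epsilon> * \<tau> j)) * norm (1 - P) < \<eta>"
      by (intro eventually_conj)
    then obtain j where j: "norm (Q \<epsilon> (\<tau> j) - P) < 1 / 2" "norm (Q (- \<epsilon>) (\<tau> j) - P) < 1 / 2"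
        "exp (- (\<epsilon> * \<tau> j)) * (3 * norm P) < \<eta>" "exp (- (\<epsilon> * \<tau> j)) * norm (1 - P) < \<eta>"
      by (auto simp: eventually_sequentially)
    define t where "t = \<tau> j"
    define M N where "M = expo (t *\<^sub>R T)" and "N = expo (- (t *\<^sub>R T))"
    have U': "U \<epsilon> t = exp (\<epsilon> * t) *\<^sub>R M" "U (- \<epsilon>) t = exp (- (\<epsilon> * t)) *\<^sub>R M"
      by (simp_all add: U M_def mult.commute)
    have "T * M = M * T" unfolding M_def by (rule expo_commute) simp
    then have "M * P = P * M" using commP[of M] by simp
    then have PU: "P * U e t = U e t * P" for e by (simp add: U M_def)
    have MN: "inverses M N" unfolding M_def N_def by (rule expo_minus)
    have "norm (U \<epsilon> t * P) \<le> 3 * norm P"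
      using idempotent_range_bound[OF Q[OF \<epsilon>r(1) \<tau>(1)] PP] PU j(1) by (simp add: t_def)
    then have "norm (M * P) \<le> exp (- (\<epsilon> * t)) * (3 * norm P)"
      by (simp add: U' exp_minus field_simps)
    moreover have "norm ((exp (\<epsilon> * t) *\<^sub>R N) * (1 - P)) \<le> norm (1 - P)"
    proof (rule idempotent_kernel_bound[OF Q[OF \<epsilon>r(2) \<tau>(1), of j] _ PP PU[unfolded t_def]])
      show "inverses (U (- \<epsilon>) (\<tau> j)) (exp (\<epsilon> * t) *\<^sub>R N)"
        using MN U'(2) by (simp add: inverses_def t_def[symmetric] exp_add[symmetric])
    qed (use j in simp)
    then have "norm (N * (1 - P)) \<le> exp (- (\<epsilon> * t)) * norm (1 - P)"
      unfolding mult_scaleR_left norm_scaleR abs_exp_cancel exp_minus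
      by (simp only: inverse_eq_divide times_divide_eq_left mult_1_left pos_le_divide_eq exp_gt_zero mult.commute mult_1_right times_divide_eq_right)
    ultimately show "\<exists>t\<ge>1. norm (expo (t *\<^sub>R T) * P) \<le> \<eta> \<and> norm (expo (- (t *\<^sub>R T)) * (1 - P)) \<le> \<eta>"
      using j(3,4) \<tau>(1)[of j] by (intro exI[of _ t]) (auto simp: t_def M_def N_def)
  qed
qed

section \<open>Recursions near a hyperbolic operator\<close>

text \<open>
  This lemma turns a contraction estimate for a sequence, known to be bounded, into an explicit bound.
\<close>

lemma half_self_bound:
  fixes x :: "'i \<Rightarrow> 'a::real_normed_vector"
  assumes bdd: "bounded (range x)"
    and step: "\<And>b n. (\<And>n. norm (x n) \<le> b) \<Longrightarrow> norm (x n) \<le> a + b / 2"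
  shows "norm (x n) \<le> 2 * a"
proof -
  define b where "b = (SUP n. norm (x n))"
  have "bdd_above (range (\<lambda>n. norm (x n)))"
    using bdd by (auto simp: bounded_iff bdd_above_def)
  then have le: "norm (x n) \<le> b" for n
    unfolding b_def by (rule cSUP_upper[OF UNIV_I])
  have "b \<le> a + b / 2"
    unfolding b_def using step[OF le] by (intro cSUP_least) (auto simp: b_def)
  then show ?thesis using le[of n] by simp
qed

primrec orbit :: "(nat \<Rightarrow> 'a::real_normed_vector \<Rightarrow>\<^sub>L 'a) \<Rightarrow> 'a \<Rightarrow> nat \<Rightarrow> 'a"
  where "orbit F y 0 = y" | "orbit F y (Suc n) = F n (orbit F y n)"

text \<open>
  The operator \<open>M\<close> preserves the splitting given by the projection \<open>P\<close>, contracts the range of \<open>P\<close>, and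
  \<open>N\<close> inverts it on the kernel of \<open>P\<close>, where it expands. The constants \<open>1 / 8\<close> are chosen such that the
  maps below are contractions with constant \<open>1 / 2\<close>.
\<close>

locale perturbed_splitting =
  fixes M N P :: "'a::banach \<Rightarrow>\<^sub>L 'a" and F :: "nat \<Rightarrow> 'a \<Rightarrow>\<^sub>L 'a"
  assumes PP: "P (P x) = P x" and PM: "P (M x) = M (P x)"
    and NM: "N (M x) = x - P x" and MN: "M (N x) = x - P x" and PN: "P (N x) = 0"
    and M_small: "norm (M (P x)) \<le> norm x / 8" and N_small: "norm (N x) \<le> norm x / 8"
    and close_P: "norm (P (F n x - M x)) \<le> norm x / 8" and close: "norm (F n x - M x) \<le> norm x"
begin

lemma shift: "perturbed_splitting M N P (\<lambda>n. F (m + n))"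
  by unfold_locales (fact PP PM NM MN PN M_small N_small close_P close)+

lemma unstable_step: "norm (N (z - (F n y - M y) - g)) \<le> (norm z + norm y + norm g) / 8"
proof -
  have "norm (z - (F n y - M y) - g) \<le> norm z + norm y + norm g"
    using close[of n y] norm_triangle_ineq4[of "z - (F n y - M y)" g] norm_triangle_ineq4[of z "F n y - M y"]
    by linarith
  then show ?thesis using N_small[of "z - (F n y - M y) - g"] by simp
qed

lemma stable_step: "norm (M (P y) + P (F n y - M y)) \<le> norm y / 4"
  using M_small[of y] close_P[of n y] norm_triangle_ineq[of "M (P y)" "P (F n y - M y)"] by simp

text \<open>
  The stable component is computed forwards from the preceding term, the unstable component
  backwards from the following term: \<open>x\<^sub>n - P x\<^sub>n = N (x\<^sub>n\<^sub>+\<^sub>1 - (F\<^sub>n - M) x\<^sub>n - g\<^sub>n)\<close>. Both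
  directions contract, so only \<open>P x\<^sub>0\<close> and the inhomogeneity \<open>g\<close> remain. With \<open>g = 0\<close> the lemma bounds
  orbits, and with the difference of two recursions as \<open>g\<close> it compares them.
\<close>

lemma bounded_solution_bound:
  assumes bdd: "bounded (range x)" and x: "\<And>n. x (Suc n) = F n (x n) + g n" and g: "\<And>n. norm (g n) \<le> c"
  shows "norm (x n) \<le> 2 * (norm (P (x 0)) + (norm P + 1) * c)"
proof (rule half_self_bound[OF bdd])
  fix b n assume b: "\<And>n. norm (x n) \<le> b"
  have c: "0 \<le> c" "0 \<le> norm P * c"
    using order.trans[OF norm_ge_zero g[of 0]] by auto
  have u: "norm (x n - P (x n)) \<le> (2 * b + c) / 8" for n
  proof -
    have "x n - P (x n) = N (x (Suc n) - (F n (x n) - M (x n)) - g n)"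
      by (simp add: x NM)
    then show ?thesis
      using unstable_step[of "x (Suc n)" n "x n" "g n"] b[of n] b[of "Suc n"] g[of n] by simp
  qed
  have s: "norm (P (x n)) \<le> norm (P (x 0)) + b / 4 + norm P * c" for n
  proof (cases n)
    case 0
    then show ?thesis using order.trans[OF norm_ge_zero b[of 0]] c by simp
  next
    case (Suc k)
    have "P (x n) = (M (P (x k)) + P (F k (x k) - M (x k))) + P (g k)"
      by (simp add: Suc x PM blinfun.bilinear_simps)
    moreover have "norm (P (g k)) \<le> norm P * c"
      using g[of k] by (intro order.trans[OF norm_blinfun] mult_left_mono) auto
    ultimately have "norm (P (x n)) \<le> b / 4 + norm P * c"
      using stable_step[of "x k" k] b[of k]
        norm_triangle_ineq[of "M (P (x k)) + P (F k (x k) - M (x k))" "P (g k)"] by simp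
    then show ?thesis using norm_ge_zero[of "P (x 0)"] by linarith
  qed
  have "norm (x n) \<le> norm (P (x n)) + norm (x n - P (x n))"
    using norm_triangle_ineq[of "P (x n)" "x n - P (x n)"] by simp
  also have "\<dots> \<le> norm (P (x 0)) + b / 4 + norm P * c + (2 * b + c) / 8"
    using s[of n] u[of n] by (rule add_mono)
  also have "\<dots> \<le> norm (P (x 0)) + (norm P + 1) * c + b / 2"
  proof -
    have "(2 * b + c) / 8 = b / 4 + c / 8" by (simp add: add_divide_distrib)
    then show ?thesis using c unfolding distrib_right by linarith
  qed
  finally show "norm (x n) \<le> norm (P (x 0)) + (norm P + 1) * c + b / 2" .
qed

lemma orbit_bound:
  assumes "bounded (range (orbit F y))"
  shows "norm (orbit F y n) \<le> 2 * norm (P y)"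
  using bounded_solution_bound[OF assms, of "\<lambda>_. 0" 0 n] by simp

text \<open>
  Applied to the tails of the orbit, the bound says that \<open>P x\<^sub>m\<close> dominates \<open>x\<^sub>m\<close>; then \<open>P x\<^sub>m\<close> decays
  geometrically.
\<close>

lemma orbit_tendsto_0:
  assumes bdd: "bounded (range (orbit F y))"
  shows "orbit F y \<longlonglongrightarrow> 0"
proof -
  have tail: "norm (orbit F y m) \<le> 2 * norm (P (orbit F y m))" for m
  proof -
    have "bounded (range (\<lambda>n. orbit F y (m + n)))"
      by (rule bounded_subset[OF bdd]) auto
    then show ?thesis
      using perturbed_splitting.bounded_solution_bound[OF shift[of m],
          of "\<lambda>n. orbit F y (m + n)" "\<lambda>_. 0" 0 0] by simp
  qed
  have "norm (P (orbit F y m)) \<le> (1 / 2) ^ m * norm (P y)" for m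
  proof (induction m)
    case (Suc m)
    have "P (orbit F y (Suc m)) = M (P (orbit F y m)) + P (F m (orbit F y m) - M (orbit F y m))"
      by (simp add: PM blinfun.bilinear_simps)
    then have "norm (P (orbit F y (Suc m))) \<le> norm (orbit F y m) / 4" by (simp only: stable_step)
    then show ?case using tail[of m] Suc by simp
  qed simp
  then have "norm (orbit F y m) \<le> 2 * ((1 / 2) ^ m * norm (P y))" for m
    using tail[of m] by (meson mult_left_mono order.trans zero_le_numeral)
  moreover have "(\<lambda>m. 2 * ((1 / 2) ^ m * norm (P y))) \<longlonglongrightarrow> 0"
    by (rule tendsto_mult_right_zero[OF tendsto_mult_left_zero[OF LIMSEQ_power_zero]]) simp
  ultimately show ?thesis
    by (rule_tac Lim_null_comparison[where g = "\<lambda>m. 2 * ((1 / 2) ^ m * norm (P y))"]) auto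
qed

text \<open>
  Lyapunov-Perron: the bounded solutions with \<open>P x\<^sub>0 = P \<xi>\<close> are the fixed points of \<open>H0\<close>, which computes
  stable components forwards (\<open>W\<close>) and unstable components backwards (\<open>V\<close>). Its iterates converge
  termwise at a geometric rate.
\<close>

lemma ex_bounded_orbit:
  obtains y where "bounded (range (orbit F y))" "P y = P \<xi>"
proof -
  define V where "V n d = N (d (Suc n) - (F n (d n) - M (d n)))" for n and d :: "nat \<Rightarrow> 'a"
  define W where "W n d = M (P (d n)) + P (F n (d n) - M (d n))" for n and d :: "nat \<Rightarrow> 'a"
  define S where "S n d = (case n of 0 \<Rightarrow> 0 | Suc k \<Rightarrow> W k d) + V n d" for n d
  define H0 where "H0 d n = (if n = 0 then P \<xi> else 0) + S n d" for d n
  have S_le: "norm (S n d) \<le> b / 2" if "\<And>n. norm (d n) \<le> b" for n d b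
  proof -
    have "norm (V n d) \<le> b / 4"
      using unstable_step[of "d (Suc n)" n "d n" 0] that[of n] that[of "Suc n"] by (simp add: V_def)
    moreover have "norm (case n of 0 \<Rightarrow> 0 | Suc k \<Rightarrow> W k d) \<le> b / 4"
    proof (cases n)
      case 0
      then show ?thesis using order.trans[OF norm_ge_zero that[of 0]] by simp
    next
      case (Suc k)
      then show ?thesis using stable_step[of "d k" k] that[of k] by (simp add: W_def)
    qed
    ultimately show ?thesis
      unfolding S_def by (intro norm_triangle_le) simp
  qed
  have S_diff: "S n d - S n e = S n (\<lambda>n. d n - e n)" for n d e
    by (auto simp: S_def V_def W_def blinfun.bilinear_simps algebra_simps split: nat.split)
  define xs where "xs k = (H0 ^^ k) (\<lambda>_. 0)" for k
  have xs0: "xs 0 n = 0" and xsS: "xs (Suc k) n = H0 (xs k) n" for k n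
    by (simp_all add: xs_def)
  have H0_diff: "H0 d n - H0 e n = S n (\<lambda>n. d n - e n)" for d e n
    unfolding S_diff[symmetric] by (simp add: H0_def)
  have xs_le: "norm (xs k n) \<le> 2 * norm (P \<xi>)" for k n
  proof (induction k arbitrary: n)
    case (Suc k)
    have "norm (H0 (xs k) n) \<le> norm (P \<xi>) + (2 * norm (P \<xi>)) / 2"
      unfolding H0_def using S_le[OF Suc, of n] by (rule_tac order.trans[OF norm_triangle_ineq add_mono]) auto
    then show ?case by (simp add: xsS)
  qed (simp add: xs0)
  have xs_step: "norm (xs (Suc k) n - xs k n) \<le> norm (P \<xi>) * (1 / 2) ^ k" for k n
  proof (induction k arbitrary: n)
    case 0
    have "norm (S n (xs 0)) \<le> 0 / 2" by (rule S_le) (simp add: xs0)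
    then show ?case by (simp add: xsS H0_def xs0)
  next
    case (Suc k)
    show ?case using S_le[OF Suc, of n] by (simp add: xsS H0_diff)
  qed
  define x where "x n = lim (\<lambda>k. xs k n)" for n
  have lim: "(\<lambda>k. xs k n) \<longlonglongrightarrow> x n" for n
    unfolding x_def convergent_LIMSEQ_iff[symmetric] by (rule convergent_geometric_steps[OF xs_step])
  have x_le: "norm (x n) \<le> 2 * norm (P \<xi>)" for n
    by (rule LIMSEQ_le_const2[OF tendsto_norm[OF lim]]) (simp add: xs_le)
  have x: "x n = (if n = 0 then P \<xi> else 0) + S n x" for n
  proof -
    have limV: "(\<lambda>k. V n (xs k)) \<longlonglongrightarrow> V n x" and limW: "(\<lambda>k. W n (xs k)) \<longlonglongrightarrow> W n x" for n
      unfolding V_def W_def by (intro tendsto_intros lim)+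
    have "(\<lambda>k. S n (xs k)) \<longlonglongrightarrow> S n x"
      unfolding S_def by (cases n) (auto intro!: tendsto_intros limV limW)
    then have "(\<lambda>k. xs (Suc k) n) \<longlonglongrightarrow> (if n = 0 then P \<xi> else 0) + S n x"
      unfolding xsS H0_def by (intro tendsto_intros)
    with LIMSEQ_Suc[OF lim] show ?thesis by (rule LIMSEQ_unique)
  qed
  have PV: "P (V n x) = 0" for n by (simp add: V_def PN)
  have PW: "P (W n x) = W n x" for n
    by (simp add: W_def blinfun.bilinear_simps PM PP)
  have P0: "P (x 0) = P \<xi>" and x0: "x 0 - P (x 0) = V 0 x"
    using x[of 0] PV[of 0] by (simp_all add: S_def blinfun.bilinear_simps PP)
  have PS: "P (x (Suc n)) = W n x" and xS: "x (Suc n) - P (x (Suc n)) = V (Suc n) x" for n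
    using x[of "Suc n"] PV[of "Suc n"] by (simp_all add: S_def blinfun.bilinear_simps PW)
  have step: "x (Suc n) = F n (x n)" for n
  proof -
    have "x n - P (x n) = V n x" using x0 xS by (cases n) auto
    then have "M (x n - P (x n)) = M (V n x)" by simp
    also have "\<dots> = (x (Suc n) - (F n (x n) - M (x n))) - P (x (Suc n) - (F n (x n) - M (x n)))"
      by (simp add: V_def MN)
    finally show ?thesis
      using PS[of n] by (simp add: W_def blinfun.bilinear_simps PM algebra_simps)
  qed
  have "orbit F (x 0) n = x n" for n
    by (induction n) (auto simp: step)
  then have "orbit F (x 0) = x" by auto
  moreover have "bounded (range x)" using x_le by (auto intro: boundedI)
  ultimately show thesis using that[of "x 0"] P0 by simp
qed

end

lemma bounded_orbits_diff:
  assumes F: "perturbed_splitting M N P F" and F': "perturbed_splitting M N P F'"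
    and y: "bounded (range (orbit F y))" and y': "bounded (range (orbit F' y'))" and eq: "P y = P y'"
    and d: "\<And>n x. norm (F n x - F' n x) \<le> d * norm x" and d0: "0 \<le> d"
  shows "norm (y - y') \<le> 4 * (norm P + 1) * norm P * d * norm y"
proof -
  interpret F: perturbed_splitting M N P F by fact
  interpret F': perturbed_splitting M N P F' by fact
  have "bounded (range (\<lambda>n. orbit F y n - orbit F' y' n))"
    by (rule bounded_minus_comp[OF y y'])
  then have "norm (orbit F y 0 - orbit F' y' 0)
      \<le> 2 * (norm (P (orbit F y 0 - orbit F' y' 0)) + (norm P + 1) * (d * (2 * norm (P y))))"
  proof (rule F'.bounded_solution_bound[where g = "\<lambda>n. F n (orbit F y n) - F' n (orbit F y n)"])
    show "norm (F n (orbit F y n) - F' n (orbit F y n)) \<le> d * (2 * norm (P y))" for n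
      using mult_left_mono[OF F.orbit_bound[OF y, of n] d0] d[of n "orbit F y n"] by linarith
  qed (simp add: blinfun.bilinear_simps)
  also have "\<dots> = 4 * (norm P + 1) * d * norm (P y)"
    by (simp add: eq blinfun.bilinear_simps)
  also have "\<dots> \<le> 4 * (norm P + 1) * d * (norm P * norm y)"
    using d0 by (intro mult_left_mono norm_blinfun) auto
  finally show ?thesis by (simp add: mult_ac)
qed

section \<open>Bounded operators as a Banach algebra\<close>

text \<open>
  A copy of the type of bounded operators that carries composition as its multiplication.
\<close>

typedef (overloaded) 'a bop = "UNIV :: ('a::real_normed_vector \<Rightarrow>\<^sub>L 'a) set"
  morphisms rep_bop Bop ..

setup_lifting type_definition_bop

instantiation bop :: (real_normed_vector) real_vector
begin

lift_definition zero_bop :: "'a bop" is 0 .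
lift_definition plus_bop :: "'a bop \<Rightarrow> 'a bop \<Rightarrow> 'a bop" is "(+)" .
lift_definition minus_bop :: "'a bop \<Rightarrow> 'a bop \<Rightarrow> 'a bop" is "(-)" .
lift_definition uminus_bop :: "'a bop \<Rightarrow> 'a bop" is uminus .
lift_definition scaleR_bop :: "real \<Rightarrow> 'a bop \<Rightarrow> 'a bop" is "(*\<^sub>R)" .

instance
  by (intro_classes; transfer; simp add: algebra_simps)

end

instantiation bop :: (real_normed_vector) real_normed_algebra
begin

lift_definition times_bop :: "'a bop \<Rightarrow> 'a bop \<Rightarrow> 'a bop" is "(o\<^sub>L)" .
lift_definition norm_bop :: "'a bop \<Rightarrow> real" is norm .

definition dist_bop :: "'a bop \<Rightarrow> 'a bop \<Rightarrow> real" where "dist_bop S T = norm (S - T)"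
definition sgn_bop :: "'a bop \<Rightarrow> 'a bop" where "sgn_bop T = T /\<^sub>R norm T"
definition uniformity_bop :: "('a bop \<times> 'a bop) filter"
  where "uniformity_bop = (INF e\<in>{0<..}. principal {(S, T). dist S T < e})"
definition open_bop :: "'a bop set \<Rightarrow> bool"
  where "open_bop U \<longleftrightarrow> (\<forall>S\<in>U. \<forall>\<^sub>F (S', T) in uniformity. S' = S \<longrightarrow> T \<in> U)"

instance
proof
  fix S T U :: "'a bop" and a b :: real
  show "dist S T = norm (S - T)" by (rule dist_bop_def)
  show "sgn T = T /\<^sub>R norm T" by (rule sgn_bop_def)
  show "(uniformity :: ('a bop \<times> 'a bop) filter) = (INF e\<in>{0<..}. principal {(S, T). dist S T < e})"
    by (rule uniformity_bop_def)
  show "open V \<longleftrightarrow> (\<forall>S\<in>V. \<forall>\<^sub>F (S', T) in uniformity. S' = S \<longrightarrow> T \<in> V)" for V :: "'a bop set"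
    by (rule open_bop_def)
  show "S * T * U = S * (T * U)" "(S + T) * U = S * U + T * U" "S * (T + U) = S * T + S * U"
    "a *\<^sub>R S * T = a *\<^sub>R (S * T)" "S * a *\<^sub>R T = a *\<^sub>R (S * T)"
    by (transfer, rule blinfun_eqI, simp add: blinfun.bilinear_simps)+
  show "(norm S = 0) = (S = 0)" "norm (S + T) \<le> norm S + norm T" "norm (a *\<^sub>R S) = \<bar>a\<bar> * norm S"
    by (transfer, simp add: norm_triangle_ineq)+
  show "norm (S * T) \<le> norm S * norm T"
    by transfer (rule norm_blinfun_compose)
qed

end

instantiation bop :: (real_normed_vector) monoid_mult
begin
lift_definition one_bop :: "'a bop" is id_blinfun .
instance by (intro_classes; transfer; rule blinfun_eqI; simp)
end

lemma bounded_linear_rep_bop: "bounded_linear rep_bop"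
  by (rule bounded_linear_intro[of _ 1]) (transfer, simp)+

lemma bounded_linear_Bop: "bounded_linear Bop"
  by (rule bounded_linear_intro[of _ 1]) (auto simp: plus_bop.abs_eq scaleR_bop.abs_eq norm_bop.abs_eq eq_onp_def)

lemma rep_Bop [simp]: "rep_bop (Bop T) = T"
  by (simp add: Bop_inverse)

lemma norm_Bop [simp]: "norm (Bop T) = norm T"
  by (simp add: norm_bop.rep_eq)

instance bop :: (banach) banach
proof
  fix X :: "nat \<Rightarrow> 'a bop" assume X: "Cauchy X"
  have "Cauchy (\<lambda>n. rep_bop (X n))"
    by (rule bounded_linear.Cauchy[OF bounded_linear_rep_bop X])
  then obtain L where "(\<lambda>n. rep_bop (X n)) \<longlonglongrightarrow> L"
    using Cauchy_convergent_iff convergent_def by blast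
  from bounded_linear.tendsto[OF bounded_linear_Bop this] show "convergent X"
    by (auto simp: convergent_def rep_bop_inverse)
qed

instance bop :: (banach) unital_banach_algebra ..

lemma norm_1_bop_le: "norm (1 :: 'a::real_normed_vector bop) \<le> 1"
  by transfer (rule norm_blinfun_id_le)

lemma bounded_path_Bop: "bounded_path A K \<Longrightarrow> bounded_path (\<lambda>t. Bop (A t)) K"
  unfolding bounded_path_def by (auto intro: bounded_linear.continuous_on[OF bounded_linear_Bop])

text \<open>
  The unique existence behind the description of \<^const>\<open>sol_op\<close> is the theory of fundamental solutions
  in the Banach algebra of operators.
\<close>

lemma sol_op_eq:
  fixes A :: "real \<Rightarrow> 'a::banach \<Rightarrow>\<^sub>L 'a"
  assumes A: "bounded_path A K" and t: "0 \<le> t"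
  shows "sol_op A t = rep_bop (fundsol (\<lambda>t. Bop (A t)) t)"
proof -
  define Y where "Y = fundsol (\<lambda>t. Bop (A t))"
  define X where "X = restrict (\<lambda>t. rep_bop (Y t)) {0..}"
  have A': "bounded_path (\<lambda>t. Bop (A t)) K" by (rule bounded_path_Bop[OF A])
  have "sol_op A = X"
    unfolding sol_op_def
  proof (rule the_equality, intro conjI allI impI)
    show "X \<in> extensional {0..}" by (simp add: X_def)
    show "X 0 = id_blinfun"
      using fundsol_0[OF A'] by (simp add: X_def Y_def one_bop.rep_eq)
    fix s :: real assume s: "0 \<le> s"
    have "((\<lambda>t. rep_bop (Y t)) has_vector_derivative rep_bop (Bop (A s) * Y s)) (at s within {0..})"
      unfolding Y_def
      by (rule bounded_linear.has_vector_derivative[OF bounded_linear_rep_bop fundsol_derivative[OF A' s]])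
    then have "(X has_vector_derivative rep_bop (Bop (A s) * Y s)) (at s within {0..})"
      by (rule has_vector_derivative_transform[rotated 2]) (use s in \<open>auto simp: X_def\<close>)
    then show "(X has_vector_derivative A s o\<^sub>L X s) (at s within {0..})"
      using s by (simp add: X_def times_bop.rep_eq)
  next
    fix Z assume Z: "Z \<in> extensional {0..} \<and> Z 0 = id_blinfun \<and>
      (\<forall>t\<ge>0. (Z has_vector_derivative A t o\<^sub>L Z t) (at t within {0..}))"
    have "Bop (Z s) = Y s * Bop (Z 0)" if s: "0 \<le> s" for s
      unfolding Y_def
    proof (rule fundsol_unique[OF A' s])
      fix u assume u: "u \<in> {0..s}"
      have "((\<lambda>t. Bop (Z t)) has_vector_derivative Bop (A u o\<^sub>L Z u)) (at u within {0..})"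
        using Z u by (intro bounded_linear.has_vector_derivative[OF bounded_linear_Bop]) auto
      then have "((\<lambda>t. Bop (Z t)) has_vector_derivative Bop (A u o\<^sub>L Z u)) (at u within {0..s})"
        by (rule has_vector_derivative_within_subset) auto
      then show "((\<lambda>t. Bop (Z t)) has_vector_derivative Bop (A u) * Bop (Z u)) (at u within {0..s})"
        by (simp add: times_bop.abs_eq)
    qed
    moreover have "Bop (Z 0) = 1" using Z by (simp add: one_bop.abs_eq)
    ultimately have "Z s = rep_bop (Y s)" if "0 \<le> s" for s
      using that by (metis mult_1_right rep_Bop)
    then show "Z = X"
      using Z by (intro extensionalityI[of Z "{0..}" X]) (auto simp: X_def)
  qed
  then show ?thesis using t by (simp add: X_def Y_def)
qed

lemma sol_op_add:
  fixes A :: "real \<Rightarrow> 'a::banach \<Rightarrow>\<^sub>L 'a"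
  assumes A: "bounded_path A K" and s: "0 \<le> s" and t: "0 \<le> t"
  shows "sol_op A (s + t) x = sol_op (\<lambda>u. A (s + u)) t (sol_op A s x)"
  using fundsol_add[OF bounded_path_Bop[OF A] s t] s t
  by (simp add: sol_op_eq[OF A] sol_op_eq[OF bounded_path_shift[OF A s]] times_bop.rep_eq)

lemma norm_sol_op_le:
  fixes A :: "real \<Rightarrow> 'a::banach \<Rightarrow>\<^sub>L 'a"
  assumes A: "bounded_path A K" and t: "0 \<le> t"
  shows "norm (sol_op A t) \<le> 2 * exp (2 * K * t)"
proof -
  have "norm (sol_op A t) \<le> 2 * norm (1 :: 'a bop) * exp (2 * K * t)"
    using norm_fundsol_le[OF bounded_path_Bop[OF A] t] by (simp add: sol_op_eq[OF A t] norm_bop.rep_eq)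
  also have "\<dots> \<le> 2 * 1 * exp (2 * K * t)"
    using norm_1_bop_le by (intro mult_right_mono mult_left_mono) auto
  finally show ?thesis by simp
qed

lemma norm_sol_op_diff_le:
  fixes A B :: "real \<Rightarrow> 'a::banach \<Rightarrow>\<^sub>L 'a"
  assumes A: "bounded_path A K" and B: "bounded_path B K" and t: "0 \<le> t"
    and d: "\<And>t. 0 \<le> t \<Longrightarrow> norm (A t - B t) \<le> d"
  shows "norm (sol_op A t - sol_op B t) \<le> 4 * t * exp (4 * K * t) * d"
proof -
  have d0: "0 \<le> d" using d[of 0] norm_ge_zero order.trans by blast
  have "norm (fundsol (\<lambda>t. Bop (A t)) t - fundsol (\<lambda>t. Bop (B t)) t)
      \<le> 4 * norm (1 :: 'a bop) * t * exp (4 * K * t) * d"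
    by (rule norm_fundsol_diff_le[OF bounded_path_Bop[OF A] bounded_path_Bop[OF B] t])
       (use d in \<open>simp add: norm_bop.rep_eq minus_bop.rep_eq\<close>)
  then have "norm (sol_op A t - sol_op B t) \<le> 4 * norm (1 :: 'a bop) * t * exp (4 * K * t) * d"
    by (simp add: sol_op_eq[OF A t] sol_op_eq[OF B t] norm_bop.rep_eq minus_bop.rep_eq)
  also have "\<dots> \<le> 4 * 1 * t * exp (4 * K * t) * d"
    using norm_1_bop_le t d0 by (intro mult_right_mono mult_left_mono) auto
  finally show ?thesis by simp
qed

lemma sol_op_reverse:
  fixes A :: "real \<Rightarrow> 'a::banach \<Rightarrow>\<^sub>L 'a"
  assumes A: "bounded_path A K" and b: "0 \<le> b"
  shows "sol_op (\<lambda>u. - A (max 0 (b - u))) b (sol_op A b x) = x"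
    and "sol_op A b (sol_op (\<lambda>u. - A (max 0 (b - u))) b x) = x"
proof -
  define B where "B u = - A (max 0 (b - u))" for u
  have B: "bounded_path B K" unfolding B_def by (rule bounded_path_reverse[OF A])
  have "(\<lambda>u. Bop (B u)) = (\<lambda>u. - Bop (A (max 0 (b - u))))"
    by (auto simp: B_def uminus_bop.abs_eq)
  then have inv: "inverses (fundsol (\<lambda>t. Bop (A t)) b) (fundsol (\<lambda>t. Bop (B t)) b)"
    using fundsol_reverse[OF bounded_path_Bop[OF A] b] by simp
  have rep: "rep_bop S (rep_bop T x) = rep_bop (S * T) x" for S T :: "'a bop"
    by (simp add: times_bop.rep_eq)
  show "sol_op (\<lambda>u. - A (max 0 (b - u))) b (sol_op A b x) = x"
    and "sol_op A b (sol_op (\<lambda>u. - A (max 0 (b - u))) b x) = x"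
    using inv unfolding B_def[symmetric]
    by (simp_all add: sol_op_eq[OF A b] sol_op_eq[OF B b] rep inverses_def one_bop.rep_eq)
qed

lemma sol_op_commute:
  fixes A :: "real \<Rightarrow> 'a::banach \<Rightarrow>\<^sub>L 'a" and J :: "'a \<Rightarrow>\<^sub>L 'a"
  assumes A: "bounded_path A K" and b: "0 \<le> b" and J: "\<And>t x. 0 \<le> t \<Longrightarrow> J (A t x) = A t (J x)"
  shows "J (sol_op A b x) = sol_op A b (J x)"
proof -
  have "Bop J * fundsol (\<lambda>t. Bop (A t)) b = fundsol (\<lambda>t. Bop (A t)) b * Bop J"
  proof (rule fundsol_commute[OF bounded_path_Bop[OF A] b])
    fix t :: real assume "0 \<le> t"
    then have "J o\<^sub>L A t = A t o\<^sub>L J" by (intro blinfun_eqI) (simp add: J)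
    then show "Bop J * Bop (A t) = Bop (A t) * Bop J" by (simp add: times_bop.abs_eq)
  qed
  then have "rep_bop (Bop J * fundsol (\<lambda>t. Bop (A t)) b) x = rep_bop (fundsol (\<lambda>t. Bop (A t)) b * Bop J) x"
    by simp
  then show ?thesis by (simp add: sol_op_eq[OF A b] times_bop.rep_eq)
qed

text \<open>
  Hyperbolicity of the corresponding element of the algebra, written without the copy of the
  operator type.
\<close>

definition hyperbolic_op :: "('a::real_normed_vector \<Rightarrow>\<^sub>L 'a) \<Rightarrow> bool"
  where "hyperbolic_op T \<longleftrightarrow> (\<forall>w::real. \<exists>R :: 'a \<Rightarrow>\<^sub>L 'a.
    (\<forall>x. T (T (R x)) + w\<^sup>2 *\<^sub>R R x = x) \<and> (\<forall>x. R (T (T x) + w\<^sup>2 *\<^sub>R x) = x))"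

lemma hyperbolic_Bop:
  assumes "hyperbolic_op T"
  shows "hyperbolic (Bop T)"
  unfolding hyperbolic_def
proof
  fix w :: real
  obtain R :: "'a \<Rightarrow>\<^sub>L 'a" where R: "\<And>x. T (T (R x)) + w\<^sup>2 *\<^sub>R R x = x" "\<And>x. R (T (T x) + w\<^sup>2 *\<^sub>R x) = x"
    using assms[unfolded hyperbolic_op_def, rule_format, of w] by blast
  have "rep_bop ((Bop T * Bop T + w\<^sup>2 *\<^sub>R 1) * Bop R) = rep_bop 1"
    "rep_bop (Bop R * (Bop T * Bop T + w\<^sup>2 *\<^sub>R 1)) = rep_bop 1"
    by (rule blinfun_eqI; simp add: times_bop.rep_eq plus_bop.rep_eq scaleR_bop.rep_eq one_bop.rep_eq
        blinfun.bilinear_simps R R(2)[unfolded blinfun.bilinear_simps])+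
  then show "\<exists>R. inverses (Bop T * Bop T + w\<^sup>2 *\<^sub>R 1) R"
    by (auto simp: inverses_def rep_bop_inject)
qed

text \<open>
  Dichotomy in the form used below: \<open>N\<close> is the inverse of \<open>M = e\<^bsup>tT\<^esup>\<close> on the kernel of \<open>P\<close>, extended by
  \<open>0\<close> to the range of \<open>P\<close>.
\<close>

theorem operator_dichotomy:
  fixes T :: "'a::banach \<Rightarrow>\<^sub>L 'a"
  assumes T: "hyperbolic_op T"
  obtains P :: "'a \<Rightarrow>\<^sub>L 'a" where "\<And>x. P (P x) = P x"
    "\<And>(J :: 'a \<Rightarrow>\<^sub>L 'a) x. (\<And>x. J (T x) = T (J x)) \<Longrightarrow> J (P x) = P (J x)"
    "\<And>\<eta>. \<eta> > 0 \<Longrightarrow> \<exists>t\<ge>1. \<exists>N :: 'a \<Rightarrow>\<^sub>L 'a. \<forall>x. let M = sol_op (\<lambda>_. T) t in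
      P (M x) = M (P x) \<and> N (M x) = x - P x \<and> M (N x) = x - P x \<and> P (N x) = 0 \<and>
      norm (M (P x)) \<le> \<eta> * norm x \<and> norm (N x) \<le> \<eta> * norm x"
proof -
  define b where "b = Bop T"
  obtain p where p: "p * p = p" "\<And>j. j * b = b * j \<Longrightarrow> j * p = p * j"
    "\<And>\<eta>. \<eta> > 0 \<Longrightarrow> \<exists>t\<ge>1. norm (expo (t *\<^sub>R b) * p) \<le> \<eta> \<and> norm (expo (- (t *\<^sub>R b)) * (1 - p)) \<le> \<eta>"
    using exponential_dichotomy[OF hyperbolic_Bop[OF T]] unfolding b_def by blast
  define P where "P = rep_bop p"
  have rep: "rep_bop (s * u) x = rep_bop s (rep_bop u x)" for s u :: "'a bop" and x
    by (simp add: times_bop.rep_eq)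
  show thesis
  proof (rule that[of P])
    show "P (P x) = P x" for x using p(1) by (metis P_def rep)
    show "J (P x) = P (J x)" if J: "\<And>x. J (T x) = T (J x)" for J :: "'a \<Rightarrow>\<^sub>L 'a" and x
    proof -
      have "J o\<^sub>L T = T o\<^sub>L J" by (intro blinfun_eqI) (simp add: J)
      then have "Bop J * p = p * Bop J"
        by (intro p(2)) (simp add: b_def times_bop.abs_eq)
      then have "rep_bop (Bop J * p) x = rep_bop (p * Bop J) x" by simp
      then show ?thesis by (simp add: rep P_def)
    qed
    fix \<eta> :: real assume "\<eta> > 0"
    then obtain t where t: "t \<ge> 1" "norm (expo (t *\<^sub>R b) * p) \<le> \<eta>" "norm (expo (- (t *\<^sub>R b)) * (1 - p)) \<le> \<eta>"
      using p(3) by blast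
    define m n where "m = expo (t *\<^sub>R b)" and "n = expo (- (t *\<^sub>R b)) * (1 - p)"
    have "p * b = b * p" using p(2)[of b] by simp
    then have pm: "p * m = m * p" unfolding m_def by (intro expo_commute) simp
    have pn': "p * expo (- (t *\<^sub>R b)) = expo (- (t *\<^sub>R b)) * p"
      by (intro expo_commute) (simp add: \<open>p * b = b * p\<close>)
    have inv: "m * expo (- (t *\<^sub>R b)) = 1" "expo (- (t *\<^sub>R b)) * m = 1"
      using expo_minus[of "t *\<^sub>R b"] by (auto simp: inverses_def m_def)
    have mn: "m * n = 1 - p" unfolding n_def mult.assoc[symmetric] inv by simp
    have "(1 - p) * m = m * (1 - p)" by (simp add: left_diff_distrib right_diff_distrib pm)
    then have nm: "n * m = 1 - p"
      unfolding n_def mult.assoc by (simp only: mult.assoc[symmetric] inv mult_1_left)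
    have pn: "p * n = 0"
      unfolding n_def mult.assoc[symmetric] pn' unfolding mult.assoc by (simp add: right_diff_distrib p)
    have M: "sol_op (\<lambda>_. T) t = rep_bop m"
      using t(1) by (simp add: sol_op_eq[OF bounded_path_const] fundsol_const m_def b_def)
    have le: "norm (rep_bop s x) \<le> \<eta> * norm x" if "norm s \<le> \<eta>" for s x
      using that norm_blinfun[of "rep_bop s" x] mult_right_mono[of "norm (rep_bop s)" \<eta> "norm x"]
      by (simp add: norm_bop.rep_eq)
    have one: "rep_bop (1 - p) x = x - P x" for x
      by (simp add: minus_bop.rep_eq one_bop.rep_eq P_def blinfun.bilinear_simps)
    show "\<exists>t\<ge>1. \<exists>N :: 'a \<Rightarrow>\<^sub>L 'a. \<forall>x. let M = sol_op (\<lambda>_. T) t in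
      P (M x) = M (P x) \<and> N (M x) = x - P x \<and> M (N x) = x - P x \<and> P (N x) = 0 \<and>
      norm (M (P x)) \<le> \<eta> * norm x \<and> norm (N x) \<le> \<eta> * norm x"
    proof (intro exI[of _ t] conjI t(1) exI[of _ "rep_bop n"] allI, unfold Let_def M, intro conjI)
      fix x
      show "P (rep_bop m x) = rep_bop m (P x)" using pm by (metis P_def rep)
      show "rep_bop n (rep_bop m x) = x - P x" "rep_bop m (rep_bop n x) = x - P x"
        unfolding rep[symmetric] nm mn by (rule one)+
      show "P (rep_bop n x) = 0" unfolding P_def rep[symmetric] pn by (simp add: zero_bop.rep_eq)
      show "norm (rep_bop m (P x)) \<le> \<eta> * norm x"
        unfolding P_def rep[symmetric] using t(2) by (intro le) (simp add: m_def)
      show "norm (rep_bop n x) \<le> \<eta> * norm x"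
        using t(3) by (intro le) (simp add: n_def)
    qed
  qed
qed

section \<open>Stable spaces of nearby paths\<close>

lemma subspace_stable_space: "subspace (stable_space A)"
  unfolding stable_space_def
proof (rule subspaceI)
  fix x y and c :: real
  assume x: "x \<in> {x. ((\<lambda>t. sol_op A t x) \<longlongrightarrow> 0) at_top}"
  then show "c *\<^sub>R x \<in> {x. ((\<lambda>t. sol_op A t x) \<longlongrightarrow> 0) at_top}"
    using tendsto_scaleR[OF tendsto_const, of "\<lambda>t. sol_op A t x" 0 at_top c]
    by (simp add: blinfun.bilinear_simps)
  assume "y \<in> {x. ((\<lambda>t. sol_op A t x) \<longlongrightarrow> 0) at_top}"
  then show "x + y \<in> {x. ((\<lambda>t. sol_op A t x) \<longlongrightarrow> 0) at_top}"
    using x tendsto_add[of "\<lambda>t. sol_op A t x" 0 at_top "\<lambda>t. sol_op A t y" 0]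
    by (simp add: blinfun.bilinear_simps)
qed (simp add: blinfun.bilinear_simps)

lemma stable_space_commute:
  fixes A :: "real \<Rightarrow> 'a::banach \<Rightarrow>\<^sub>L 'a" and J :: "'a \<Rightarrow>\<^sub>L 'a"
  assumes A: "bounded_path A K" and J: "\<And>t x. 0 \<le> t \<Longrightarrow> J (A t x) = A t (J x)"
    and x: "x \<in> stable_space A"
  shows "J x \<in> stable_space A"
proof -
  have "((\<lambda>t. J (sol_op A t x)) \<longlongrightarrow> J 0) at_top"
    using x by (intro tendsto_intros) (simp add: stable_space_def)
  moreover have "\<forall>\<^sub>F t in at_top. J (sol_op A t x) = sol_op A t (J x)"
    using eventually_ge_at_top[of 0] by eventually_elim (rule sol_op_commute[OF A _ J])
  ultimately show ?thesis
    by (simp add: stable_space_def blinfun.bilinear_simps tendsto_cong)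
qed

text \<open>
  The transition operators of \<open>X' = A X\<close> over the intervals \<open>[t\<^sub>0 + n \<tau>, t\<^sub>0 + (n + 1) \<tau>]\<close>.
\<close>

definition steps :: "real \<Rightarrow> real \<Rightarrow> (real \<Rightarrow> 'a::banach \<Rightarrow>\<^sub>L 'a) \<Rightarrow> nat \<Rightarrow> 'a \<Rightarrow>\<^sub>L 'a"
  where "steps t0 \<tau> A n = sol_op (\<lambda>u. A (t0 + real n * \<tau> + u)) \<tau>"

lemma orbit_steps:
  fixes A :: "real \<Rightarrow> 'a::banach \<Rightarrow>\<^sub>L 'a"
  assumes A: "bounded_path A K" and t0: "0 \<le> t0" and \<tau>: "0 < \<tau>"
  shows "orbit (steps t0 \<tau> A) (sol_op A t0 x) n = sol_op A (t0 + real n * \<tau>) x"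
proof (induction n)
  case (Suc n)
  have "sol_op A (t0 + real (Suc n) * \<tau>) x = sol_op A ((t0 + real n * \<tau>) + \<tau>) x"
    by (simp add: algebra_simps)
  also have "\<dots> = steps t0 \<tau> A n (sol_op A (t0 + real n * \<tau>) x)"
    unfolding steps_def by (rule sol_op_add[OF A]) (use t0 \<tau> in auto)
  finally show ?case by (simp add: Suc)
qed simp

text \<open>
  Between two sampling times a solution grows at most by a constant factor, so convergence to \<open>0\<close> can be
  tested at the sampling times.
\<close>

lemma stable_space_iff_orbit:
  fixes A :: "real \<Rightarrow> 'a::banach \<Rightarrow>\<^sub>L 'a"
  assumes A: "bounded_path A K" and t0: "0 \<le> t0" and \<tau>: "0 < \<tau>"
  shows "x \<in> stable_space A \<longleftrightarrow> orbit (steps t0 \<tau> A) (sol_op A t0 x) \<longlonglongrightarrow> 0"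
proof
  assume x: "x \<in> stable_space A"
  have "filterlim (\<lambda>n. t0 + real n * \<tau>) at_top sequentially"
    by (intro filterlim_tendsto_add_at_top[OF tendsto_const]
        filterlim_at_top_mult_tendsto_pos[OF tendsto_const \<tau>] filterlim_real_sequentially)
  then have "(\<lambda>n. sol_op A (t0 + real n * \<tau>) x) \<longlonglongrightarrow> 0"
    using x unfolding stable_space_def by (auto intro: filterlim_compose)
  then show "orbit (steps t0 \<tau> A) (sol_op A t0 x) \<longlonglongrightarrow> 0"
    unfolding orbit_steps[OF A t0 \<tau>, abs_def] by (simp add: orbit_steps[OF A t0 \<tau>])
next
  assume lim: "orbit (steps t0 \<tau> A) (sol_op A t0 x) \<longlonglongrightarrow> 0"
  define C where "C = 2 * exp (2 * K * \<tau>)"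
  have C: "C > 0" by (simp add: C_def)
  have K: "0 \<le> K" by (rule bounded_path_nonneg[OF A])
  show "x \<in> stable_space A"
    unfolding stable_space_def mem_Collect_eq
  proof (rule tendstoI)
    fix e :: real assume e: "e > 0"
    then have "e / C > 0" using C by simp
    from LIMSEQ_D[OF lim this] obtain n0 where n0:
      "\<And>n. n \<ge> n0 \<Longrightarrow> norm (orbit (steps t0 \<tau> A) (sol_op A t0 x) n) < e / C" by auto
    have "dist (sol_op A t x) 0 < e" if t: "t \<ge> t0 + real n0 * \<tau>" for t
    proof -
      \<comment> \<open>The last sampling time before \<open>t\<close> is \<open>s\<close>.\<close>
      define n where "n = nat \<lfloor>(t - t0) / \<tau>\<rfloor>"
      define s where "s = t0 + real n * \<tau>"
      have q: "real n0 \<le> (t - t0) / \<tau>" using t \<tau> by (simp add: field_simps)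
      then have "0 \<le> (t - t0) / \<tau>" using of_nat_0_le_iff order.trans by blast
      then have "real n \<le> (t - t0) / \<tau>" "(t - t0) / \<tau> < real n + 1"
        by (auto simp: n_def)
      then have s: "s \<le> t" "t \<le> s + \<tau>" using \<tau> by (auto simp: s_def field_simps)
      have nn: "n \<ge> n0" using q by (simp add: n_def le_nat_floor)
      have s0: "0 \<le> s" using t0 \<tau> by (simp add: s_def)
      have "sol_op A t x = sol_op (\<lambda>u. A (s + u)) (t - s) (sol_op A s x)"
        using sol_op_add[OF A s0, of "t - s" x] s by simp
      moreover have "norm (sol_op (\<lambda>u. A (s + u)) (t - s)) \<le> C"
      proof -
        have "norm (sol_op (\<lambda>u. A (s + u)) (t - s)) \<le> 2 * exp (2 * K * (t - s))"
          by (rule norm_sol_op_le[OF bounded_path_shift[OF A s0]]) (use s in simp)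
        also have "\<dots> \<le> C"
          unfolding C_def using s K by (intro mult_left_mono) (auto intro: mult_left_mono)
        finally show ?thesis .
      qed
      ultimately have "norm (sol_op A t x) \<le> C * norm (sol_op A s x)"
        using norm_blinfun[of "sol_op (\<lambda>u. A (s + u)) (t - s)" "sol_op A s x"]
          mult_right_mono[of "norm (sol_op (\<lambda>u. A (s + u)) (t - s))" C "norm (sol_op A s x)"] by simp
      also have "\<dots> < C * (e / C)"
        using n0[OF nn] C unfolding orbit_steps[OF A t0 \<tau>] s_def by (intro mult_strict_left_mono)
      finally show ?thesis using C by simp
    qed
    then show "\<forall>\<^sub>F t in at_top. dist (sol_op A t x) 0 < e"
      by (auto simp: eventually_at_top_linorder)
  qed
qed

text \<open>
  All paths bounded by \<open>K\<close> that stay within \<open>d0\<close> of \<open>T\<close> from time \<open>t0\<close> on are treated with the same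
  constants and the same projection \<open>P\<close>; this gives the uniformity needed for continuity.
\<close>

locale hyperbolic_tail =
  fixes P N T :: "'a::banach \<Rightarrow>\<^sub>L 'a" and K t0 \<tau> d0 :: real
  assumes split: "\<And>A. bounded_path A K \<Longrightarrow> (\<And>t. t0 \<le> t \<Longrightarrow> norm (A t - T) \<le> d0) \<Longrightarrow>
      perturbed_splitting (sol_op (\<lambda>_. T) \<tau>) N P (steps t0 \<tau> A)"
    and t0: "0 \<le> t0" and \<tau>: "0 < \<tau>" and K: "0 \<le> K"
begin

definition admissible :: "(real \<Rightarrow> 'a \<Rightarrow>\<^sub>L 'a) \<Rightarrow> bool"
  where "admissible A \<longleftrightarrow> bounded_path A K \<and> (\<forall>t\<ge>t0. norm (A t - T) \<le> d0)"

lemma admissible_path: "admissible A \<Longrightarrow> bounded_path A K"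
  by (simp add: admissible_def)

lemma admissible_split: "admissible A \<Longrightarrow> perturbed_splitting (sol_op (\<lambda>_. T) \<tau>) N P (steps t0 \<tau> A)"
  by (auto simp: admissible_def intro: split)

lemma stable_space_iff_bounded:
  assumes A: "admissible A"
  shows "x \<in> stable_space A \<longleftrightarrow> bounded (range (orbit (steps t0 \<tau> A) (sol_op A t0 x)))"
  unfolding stable_space_iff_orbit[OF admissible_path[OF A] t0 \<tau>]
  using perturbed_splitting.orbit_tendsto_0[OF admissible_split[OF A]]
    convergent_imp_bounded by blast

text \<open>
  Expressing stability by non-strict inequalities shows that the stable space is closed.
\<close>

lemma stable_space_orbit_bound:
  assumes A: "admissible A"
  shows "stable_space A = {x. \<forall>n. norm (sol_op A (t0 + real n * \<tau>) x) \<le> 2 * norm (P (sol_op A t0 x))}"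
    (is "_ = ?R")
proof (intro set_eqI iffI)
  fix x assume "x \<in> stable_space A"
  then have "bounded (range (orbit (steps t0 \<tau> A) (sol_op A t0 x)))"
    by (simp add: stable_space_iff_bounded[OF A])
  from perturbed_splitting.orbit_bound[OF admissible_split[OF A] this] show "x \<in> ?R"
    by (simp add: orbit_steps[OF admissible_path[OF A] t0 \<tau>])
next
  fix x assume "x \<in> ?R"
  then show "x \<in> stable_space A"
    unfolding stable_space_iff_bounded[OF A]
    by (auto simp: orbit_steps[OF admissible_path[OF A] t0 \<tau>] intro: boundedI)
qed

lemma closed_stable_space:
  assumes A: "admissible A"
  shows "closed (stable_space A)"
  unfolding stable_space_orbit_bound[OF A]
  by (intro closed_Collect_all closed_Collect_le continuous_intros)

text \<open>
  The complement to the stable space: the preimage of the kernel of \<open>P\<close> under the solution operator at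
  time \<open>t0\<close>.
\<close>

definition complement :: "(real \<Rightarrow> 'a \<Rightarrow>\<^sub>L 'a) \<Rightarrow> 'a set"
  where "complement A = {x. P (sol_op A t0 x) = 0}"

lemma subspace_complement: "subspace (complement A)"
  by (auto simp: complement_def subspace_def blinfun.bilinear_simps)

lemma closed_complement: "closed (complement A)"
  unfolding complement_def by (intro closed_Collect_eq continuous_intros)

lemma sol_op_inverse:
  assumes A: "admissible A"
  obtains S :: "'a \<Rightarrow>\<^sub>L 'a" where "\<And>x. S (sol_op A t0 x) = x" "\<And>x. sol_op A t0 (S x) = x"
  using sol_op_reverse[OF admissible_path[OF A] t0] by metis

lemma stable_Int_complement:
  assumes A: "admissible A"
  shows "stable_space A \<inter> complement A = {0}"
proof -
  obtain S :: "'a \<Rightarrow>\<^sub>L 'a" where S: "\<And>x. S (sol_op A t0 x) = x" using sol_op_inverse[OF A] by metis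
  have "x = 0" if "x \<in> stable_space A" "x \<in> complement A" for x
  proof -
    have "norm (sol_op A (t0 + real 0 * \<tau>) x) \<le> 2 * norm (P (sol_op A t0 x))"
      using that(1) unfolding stable_space_orbit_bound[OF A] by blast
    then have "sol_op A t0 x = 0" using that(2) by (simp add: complement_def)
    then show ?thesis using S[of x] by (simp add: blinfun.bilinear_simps)
  qed
  moreover have "0 \<in> stable_space A" "0 \<in> complement A"
    by (auto intro: subspace_0 subspace_stable_space subspace_complement)
  ultimately show ?thesis by auto
qed

lemma stable_plus_complement:
  assumes A: "admissible A"
  shows "{y + z | y z. y \<in> stable_space A \<and> z \<in> complement A} = UNIV"
proof -
  obtain S :: "'a \<Rightarrow>\<^sub>L 'a" where S: "\<And>x. S (sol_op A t0 x) = x" "\<And>x. sol_op A t0 (S x) = x"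
    using sol_op_inverse[OF A] by metis
  have "\<exists>y z. x = y + z \<and> y \<in> stable_space A \<and> z \<in> complement A" for x
  proof -
    obtain y where y: "bounded (range (orbit (steps t0 \<tau> A) y))" "P y = P (sol_op A t0 x)"
      using perturbed_splitting.ex_bounded_orbit[OF admissible_split[OF A]] by metis
    have "S y \<in> stable_space A" using y(1) by (simp add: stable_space_iff_bounded[OF A] S)
    moreover have "x - S y \<in> complement A" by (simp add: complement_def blinfun.bilinear_simps S y(2))
    ultimately show ?thesis by (intro exI[of _ "S y"] exI[of _ "x - S y"]) simp
  qed
  then show ?thesis by blast
qed

lemma complement_commute:
  fixes J :: "'a \<Rightarrow>\<^sub>L 'a"
  assumes A: "admissible A" and J: "\<And>t x. 0 \<le> t \<Longrightarrow> J (A t x) = A t (J x)" and JP: "\<And>x. J (P x) = P (J x)"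
    and x: "x \<in> complement A"
  shows "J x \<in> complement A"
proof -
  have "P (sol_op A t0 (J x)) = J (P (sol_op A t0 x))"
    by (simp add: sol_op_commute[OF admissible_path[OF A] t0 J, symmetric] JP)
  then show ?thesis using x by (simp add: complement_def blinfun.bilinear_simps)
qed

text \<open>
  The two summands account for the change of the isomorphism \<open>X\<^sub>A(t\<^sub>0)\<close> and of the space of initial
  values of bounded orbits.
\<close>

definition lip :: real
  where "lip = (4 * t0 * exp (4 * K * t0) + 2 * exp (2 * K * t0) * (4 * (norm P + 1) * norm P * (4 * \<tau> * exp (4 * K * \<tau>))))
    * (2 * exp (2 * K * t0))"

lemma lip_nonneg: "0 \<le> lip"
  using t0 \<tau> by (simp add: lip_def)

text \<open>
  Transport \<open>x\<close> to time \<open>t\<^sub>0\<close> along \<open>A\<close>, replace the result by the initial value of a bounded orbit for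
  \<open>B\<close> with the same stable component, and transport that back along \<open>B\<close>.
\<close>

lemma stable_space_Lipschitz:
  assumes A: "admissible A" and B: "admissible B" and d: "\<And>t. 0 \<le> t \<Longrightarrow> norm (A t - B t) \<le> d"
    and x: "x \<in> stable_space A"
  shows "\<exists>z\<in>stable_space B. norm (x - z) \<le> lip * d * norm x"
proof -
  note pA = admissible_path[OF A] and pB = admissible_path[OF B]
  have d0: "0 \<le> d" using d[of 0] norm_ge_zero order.trans by blast
  define y where "y = sol_op A t0 x"
  obtain z where z: "bounded (range (orbit (steps t0 \<tau> B) z))" "P z = P y"
    using perturbed_splitting.ex_bounded_orbit[OF admissible_split[OF B]] by metis
  define A' B' where "A' = (\<lambda>u. - A (max 0 (t0 - u)))" and "B' = (\<lambda>u. - B (max 0 (t0 - u)))"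
  have pA': "bounded_path A' K" and pB': "bounded_path B' K"
    unfolding A'_def B'_def by (rule bounded_path_reverse pA pB)+
  define c where "c = 4 * \<tau> * exp (4 * K * \<tau>) * d"
  define e where "e = 4 * (norm P + 1) * norm P * c"
  have c0: "0 \<le> c" using \<tau> d0 by (simp add: c_def)
  have yz: "norm (y - z) \<le> e * norm y"
    unfolding e_def
  proof (rule bounded_orbits_diff[OF admissible_split[OF A] admissible_split[OF B] _ z(1) z(2)[symmetric]])
    show "bounded (range (orbit (steps t0 \<tau> A) y))"
      using x by (simp add: stable_space_iff_bounded[OF A] y_def)
    fix n v
    have s: "0 \<le> t0 + real n * \<tau>" using t0 \<tau> by simp
    have "norm (steps t0 \<tau> A n - steps t0 \<tau> B n) \<le> c"
      unfolding steps_def c_def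
      by (rule norm_sol_op_diff_le[OF bounded_path_shift[OF pA s] bounded_path_shift[OF pB s]])
         (use \<tau> d s in auto)
    then show "norm (steps t0 \<tau> A n v - steps t0 \<tau> B n v) \<le> c * norm v"
      using norm_blinfun[of "steps t0 \<tau> A n - steps t0 \<tau> B n" v]
        mult_right_mono[of _ c "norm v"] by (fastforce simp: blinfun.bilinear_simps)
  qed (rule c0)
  define w where "w = sol_op B' t0 z"
  have "sol_op B t0 w = z" unfolding w_def B'_def by (rule sol_op_reverse(2)[OF pB t0])
  then have w: "w \<in> stable_space B" using z(1) by (simp add: stable_space_iff_bounded[OF B])
  have "x = sol_op A' t0 y" unfolding y_def A'_def by (rule sol_op_reverse(1)[OF pA t0, symmetric])
  then have "x - w = (sol_op A' t0 - sol_op B' t0) y + sol_op B' t0 (y - z)"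
    by (simp add: w_def blinfun.bilinear_simps)
  also have "norm \<dots> \<le> norm (sol_op A' t0 - sol_op B' t0) * norm y + norm (sol_op B' t0) * norm (y - z)"
    by (intro order.trans[OF norm_triangle_ineq] add_mono norm_blinfun)
  also have "\<dots> \<le> (4 * t0 * exp (4 * K * t0) * d) * norm y + (2 * exp (2 * K * t0)) * (e * norm y)"
  proof (intro add_mono mult_mono yz)
    show "norm (sol_op A' t0 - sol_op B' t0) \<le> 4 * t0 * exp (4 * K * t0) * d"
    proof (rule norm_sol_op_diff_le[OF pA' pB' t0])
      show "norm (A' t - B' t) \<le> d" if "0 \<le> t" for t
        using d[of "max 0 (t0 - t)"] by (simp add: A'_def B'_def norm_minus_commute)
    qed
    show "norm (sol_op B' t0) \<le> 2 * exp (2 * K * t0)" by (rule norm_sol_op_le[OF pB' t0])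
  qed (use t0 d0 in auto)
  also have "\<dots> = (4 * t0 * exp (4 * K * t0) * d + 2 * exp (2 * K * t0) * e) * norm y"
    by (simp add: algebra_simps)
  also have "\<dots> \<le> (4 * t0 * exp (4 * K * t0) * d + 2 * exp (2 * K * t0) * e) * (2 * exp (2 * K * t0) * norm x)"
  proof (rule mult_left_mono)
    show "norm y \<le> 2 * exp (2 * K * t0) * norm x"
      unfolding y_def using norm_sol_op_le[OF pA t0]
      by (intro order.trans[OF norm_blinfun] mult_right_mono) auto
    show "0 \<le> 4 * t0 * exp (4 * K * t0) * d + 2 * exp (2 * K * t0) * e"
      using t0 d0 c0 by (auto simp: e_def intro!: add_nonneg_nonneg mult_nonneg_nonneg)
  qed
  also have "\<dots> = lip * d * norm x"
    by (simp add: lip_def e_def c_def algebra_simps)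
  finally show ?thesis using w by blast
qed

end

text \<open>
  The time \<open>\<tau>\<close> is taken from the dichotomy of \<open>T\<close>; afterwards \<open>d0\<close> is chosen so small that the transition
  operators over time \<open>\<tau>\<close> differ little from \<open>e\<^bsup>\<tau>T\<^esup>\<close>.
\<close>

lemma ex_hyperbolic_tail:
  fixes T :: "'a::banach \<Rightarrow>\<^sub>L 'a"
  assumes T: "hyperbolic_op T" and TK: "norm T \<le> K"
  obtains P N :: "'a \<Rightarrow>\<^sub>L 'a" and \<tau> d0 where "d0 > 0"
    "\<And>t0. 0 \<le> t0 \<Longrightarrow> hyperbolic_tail P N T K t0 \<tau> d0"
    "\<And>(J :: 'a \<Rightarrow>\<^sub>L 'a) x. (\<And>x. J (T x) = T (J x)) \<Longrightarrow> J (P x) = P (J x)"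
proof -
  have K: "0 \<le> K" using TK norm_ge_zero order.trans by blast
  obtain P :: "'a \<Rightarrow>\<^sub>L 'a" where P: "\<And>x. P (P x) = P x"
    "\<And>(J :: 'a \<Rightarrow>\<^sub>L 'a) x. (\<And>x. J (T x) = T (J x)) \<Longrightarrow> J (P x) = P (J x)"
    and dich: "\<And>\<eta>. \<eta> > 0 \<Longrightarrow> \<exists>t\<ge>1. \<exists>N :: 'a \<Rightarrow>\<^sub>L 'a. \<forall>x. let M = sol_op (\<lambda>_. T) t in
      P (M x) = M (P x) \<and> N (M x) = x - P x \<and> M (N x) = x - P x \<and> P (N x) = 0 \<and>
      norm (M (P x)) \<le> \<eta> * norm x \<and> norm (N x) \<le> \<eta> * norm x"
    using operator_dichotomy[OF T] by blast
  obtain \<tau> and N :: "'a \<Rightarrow>\<^sub>L 'a" where \<tau>: "\<tau> \<ge> 1" and N: "\<And>x. let M = sol_op (\<lambda>_. T) \<tau> in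
      P (M x) = M (P x) \<and> N (M x) = x - P x \<and> M (N x) = x - P x \<and> P (N x) = 0 \<and>
      norm (M (P x)) \<le> 1 / 8 * norm x \<and> norm (N x) \<le> 1 / 8 * norm x"
    using dich[of "1 / 8"] by auto
  define M where "M = sol_op (\<lambda>_. T) \<tau>"
  \<comment> \<open>Closeness \<open>\<eta>\<close> of the transition operators yields both closeness conditions of the splitting,
    and \<open>d0\<close> is the closeness of the paths that ensures it.\<close>
  define \<eta> where "\<eta> = 1 / (8 * (1 + norm P))"
  define d0 where "d0 = \<eta> / (4 * \<tau> * exp (4 * K * \<tau>))"
  have pos: "0 < 1 + norm P" by (simp add: add_pos_nonneg)
  then have \<eta>: "\<eta> > 0" "\<eta> \<le> 1" "norm P * \<eta> \<le> 1 / 8"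
    by (auto simp: \<eta>_def field_simps)
  have d0: "d0 > 0" using \<tau> \<eta> by (simp add: d0_def)
  show thesis
  proof (rule that[OF d0 _ P(2)])
    fix t0 :: real assume t0: "0 \<le> t0"
    show "hyperbolic_tail P N T K t0 \<tau> d0"
    proof (rule hyperbolic_tail.intro)
      fix A assume A: "bounded_path A K" and near: "\<And>t. t0 \<le> t \<Longrightarrow> norm (A t - T) \<le> d0"
      have step: "norm (steps t0 \<tau> A n x - M x) \<le> \<eta> * norm x" for n x
      proof -
        have s: "0 \<le> t0 + real n * \<tau>" "t0 \<le> t0 + real n * \<tau>" using t0 \<tau> by auto
        have "norm (steps t0 \<tau> A n - M) \<le> 4 * \<tau> * exp (4 * K * \<tau>) * d0"
          unfolding steps_def M_def
        proof (rule norm_sol_op_diff_le[OF bounded_path_shift[OF A s(1)]])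
          show "bounded_path (\<lambda>_. T) K" using TK by (simp add: bounded_path_def)
          show "norm (A (t0 + real n * \<tau> + t) - T) \<le> d0" if "0 \<le> t" for t
            using s that by (intro near) auto
        qed (use \<tau> in simp)
        also have "\<dots> = \<eta>" using \<tau> by (simp add: d0_def)
        finally show ?thesis
          using norm_blinfun[of "steps t0 \<tau> A n - M" x] mult_right_mono[of _ \<eta> "norm x"]
          by (fastforce simp: blinfun.bilinear_simps)
      qed
      show "perturbed_splitting (sol_op (\<lambda>_. T) \<tau>) N P (steps t0 \<tau> A)"
      proof
        fix n x
        show "P (P x) = P x" by (rule P)
        show "norm (steps t0 \<tau> A n x - sol_op (\<lambda>_. T) \<tau> x) \<le> norm x"
          using step[of n x] mult_right_mono[OF \<eta>(2), of "norm x"] by (simp add: M_def)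
        have "norm (P (steps t0 \<tau> A n x - M x)) \<le> norm P * (\<eta> * norm x)"
          by (intro order.trans[OF norm_blinfun] mult_left_mono step) simp
        also have "\<dots> \<le> 1 / 8 * norm x"
          using mult_right_mono[OF \<eta>(3), of "norm x"] by (simp add: mult.assoc)
        finally show "norm (P (steps t0 \<tau> A n x - sol_op (\<lambda>_. T) \<tau> x)) \<le> norm x / 8"
          by (simp add: M_def)
      qed (use N in \<open>auto simp: Let_def\<close>)
    next
      show "0 \<le> t0" "0 < \<tau>" "0 \<le> K" using t0 \<tau> K by auto
    qed
  qed
qed

text \<open>
  Radial projection to the unit ball moves a point \<open>z\<close> near a unit ball vector \<open>y\<close> by at most \<open>\<parallel>y - z\<parallel>\<close>,
  whence the factor \<open>2\<close>.
\<close>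

lemma gap_excess_le:
  assumes Y: "subspace Y" and Z: "subspace Z" and e: "0 \<le> e"
    and le: "\<And>y. y \<in> Y \<Longrightarrow> \<exists>z\<in>Z. norm (y - z) \<le> e * norm y"
  shows "gap_excess Y Z \<le> 2 * e"
  unfolding gap_excess_eq[OF subspace_0[OF Y]]
proof (rule cSUP_least)
  show "Y \<inter> cball 0 1 \<noteq> {}" using subspace_0[OF Y] by auto
  fix y assume y: "y \<in> Y \<inter> cball 0 1"
  then obtain z where z: "z \<in> Z" "norm (y - z) \<le> e * norm y" using le by blast
  have "e * norm y \<le> e" using y e by (intro mult_left_le) auto
  with z have ze: "norm (y - z) \<le> e" by simp
  define m where "m = max 1 (norm z)"
  define u where "u = z /\<^sub>R m"
  have m: "m \<ge> 1" "norm z \<le> m" "m \<le> 1 + e"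
    using ze y norm_triangle_ineq2[of z y] e by (auto simp: m_def norm_minus_commute)
  have u: "u \<in> Z \<inter> cball 0 1"
    using m by (auto simp: u_def subspace_scale[OF Z z(1)] divide_simps)
  have "(m - 1) / m = 1 - inverse m" using m by (simp add: field_simps)
  then have "z - u = ((m - 1) / m) *\<^sub>R z"
    by (simp add: u_def scaleR_left_diff_distrib)
  then have "norm (z - u) = (m - 1) * (norm z / m)" using m by simp
  also have "\<dots> \<le> (m - 1) * 1" using m by (intro mult_left_mono) auto
  finally have "norm (z - u) \<le> e" using m by simp
  then have "dist y u \<le> 2 * e"
    using ze norm_triangle_ineq[of "y - z" "z - u"] by (simp add: dist_norm)
  then show "infdist y (Z \<inter> cball 0 1) \<le> 2 * e" using u by (rule infdist_le2[rotated])
qed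

section \<open>Spectra and the continuity theorem\<close>

text \<open>
  The product of the inverses of \<open>T - i w\<close> and \<open>T + i w\<close> inverts \<open>T\<^sup>2 + w\<^sup>2\<close>.
\<close>

lemma hyperbolic_op_if_spectrum:
  fixes smul :: "complex \<Rightarrow> 'a::real_normed_vector \<Rightarrow> 'a" and T :: "'a \<Rightarrow>\<^sub>L 'a"
  assumes vs: "vector_space smul" and of_real: "\<And>r x. smul (complex_of_real r) x = r *\<^sub>R x"
    and T: "T \<in> linops smul" and sp: "spectrum smul T \<inter> {z. Re z = 0} = {}"
  shows "hyperbolic_op T"
  unfolding hyperbolic_op_def
proof
  fix w :: real
  interpret vector_space smul by (rule vs)
  define D where "D z x = T x - smul z x" for z x
  have inv: "\<exists>S :: 'a \<Rightarrow>\<^sub>L 'a. (\<forall>x. S (D z x) = x) \<and> (\<forall>x. D z (S x) = x)" if "Re z = 0" for z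
  proof -
    have "z \<notin> spectrum smul T" using sp that by auto
    then show ?thesis by (auto simp: spectrum_def D_def)
  qed
  obtain S where S: "\<And>x. blinfun_apply S (D (\<i> * w) x) = x" "\<And>x. D (\<i> * w) (blinfun_apply S x) = x"
    using inv[of "\<i> * w"] by auto
  obtain S' where S': "\<And>x. blinfun_apply S' (D (- (\<i> * w)) x) = x" "\<And>x. D (- (\<i> * w)) (blinfun_apply S' x) = x"
    using inv[of "- (\<i> * w)"] by auto
  have Tz: "T (smul z x) = smul z (T x)" for z x
    using T by (auto simp: linops_def Vector_Spaces.linear_iff)
  have D: "D (\<i> * w) (D (- (\<i> * w)) x) = T (T x) + w\<^sup>2 *\<^sub>R x" for x
  proof -
    have "(\<i> * w) * (\<i> * w) = - complex_of_real (w\<^sup>2)" by (simp add: power2_eq_square algebra_simps)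
    then have "smul (\<i> * w) (smul (\<i> * w) x) = - (w\<^sup>2 *\<^sub>R x)"
      unfolding scale_scale by (simp only: scale_minus_left of_real)
    then show ?thesis
      by (simp add: D_def blinfun.bilinear_simps Tz scale_minus_left scale_right_diff_distrib scale_right_distrib)
  qed
  show "\<exists>R :: 'a \<Rightarrow>\<^sub>L 'a. (\<forall>x. T (T (R x)) + w\<^sup>2 *\<^sub>R R x = x) \<and> (\<forall>x. R (T (T x) + w\<^sup>2 *\<^sub>R x) = x)"
    by (rule exI[of _ "S' o\<^sub>L S"]) (simp add: D[symmetric] S S')
qed

text \<open>
  The complexification of \<open>T\<^sup>2 + w\<^sup>2\<close> is diagonal, so its inverse restricts to the first component.
\<close>

lemma hyperbolic_op_complexify:
  fixes T :: "'a::real_normed_vector \<Rightarrow>\<^sub>L 'a"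
  assumes "hyperbolic_op (complexify T)"
  shows "hyperbolic_op T"
  unfolding hyperbolic_op_def
proof
  fix w :: real
  obtain R' :: "('a \<times> 'a) \<Rightarrow>\<^sub>L ('a \<times> 'a)" where R': "\<And>p. complexify T (complexify T (R' p)) + w\<^sup>2 *\<^sub>R R' p = p"
      "\<And>p. R' (complexify T (complexify T p) + w\<^sup>2 *\<^sub>R p) = p"
    using assms[unfolded hyperbolic_op_def, rule_format, of w] by blast
  define R where "R = Blinfun (\<lambda>x. fst (R' (x, 0)))"
  have "bounded_linear (\<lambda>x. fst (R' (x, 0)))"
    by (intro bounded_linear_intros)
  then have R: "R x = fst (R' (x, 0))" for x
    unfolding R_def by (simp add: bounded_linear_Blinfun_apply)
  have 1: "T (T (R x)) + w\<^sup>2 *\<^sub>R R x = x" for x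
    using arg_cong[OF R'(1)[of "(x, 0)"], of fst] by (simp add: R)
  have 2: "R (T (T x) + w\<^sup>2 *\<^sub>R x) = x" for x
    using arg_cong[OF R'(2)[of "(x, 0)"], of fst] by (simp add: R blinfun.zero_right)
  show "\<exists>R :: 'a \<Rightarrow>\<^sub>L 'a. (\<forall>x. T (T (R x)) + w\<^sup>2 *\<^sub>R R x = x) \<and> (\<forall>x. R (T (T x) + w\<^sup>2 *\<^sub>R x) = x)"
    using 1 2 by blast
qed

lemma norm_diff_le_mdist_C_h:
  assumes A: "A \<in> C_h smul \<sigma>" and B: "B \<in> C_h smul \<sigma>" and t: "0 \<le> t"
  shows "norm (A t - B t) \<le> mdist (C_h_metric smul \<sigma>) A B"
  unfolding mdist_C_h_metric[OF A B]
proof (rule cSUP_upper)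
  have "bounded ((\<lambda>t. A t - B t) ` {0..})"
    by (rule bounded_minus_comp[OF C_h_bounded[OF A] C_h_bounded[OF B]])
  then show "bdd_above ((\<lambda>t. norm (A t - B t)) ` {0..})"
    by (auto simp: bounded_iff bdd_above_def)
qed (use t in simp)

text \<open>
  Real and complex scalars at once: the scalars enter only as bounded operators that commute with the
  path, and they leave the stable space and its complement invariant.
\<close>

theorem continuous_stable_space:
  fixes smul :: "'k::field \<Rightarrow> 'a::banach \<Rightarrow> 'a"
  assumes bl: "\<And>c. bounded_linear (smul c)"
    and sub: "\<And>Y. module.subspace smul Y \<longleftrightarrow> subspace Y \<and> (\<forall>c. \<forall>y\<in>Y. smul c y \<in> Y)"
    and lin: "\<And>A c x. A \<in> linops smul \<Longrightarrow> blinfun_apply A (smul c x) = smul c (blinfun_apply A x)"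
    and hyp: "\<And>T. T \<in> linops smul \<Longrightarrow> \<sigma> T \<inter> {z. Re z = 0} = {} \<Longrightarrow> hyperbolic_op T"
  shows "continuous_map (mtopology_of (C_h_metric smul \<sigma>)) (mtopology_of (G_s_metric smul)) stable_space"
proof -
  define J where "J c = Blinfun (smul c)" for c
  have J: "blinfun_apply (J c) x = smul c x" for c x
    unfolding J_def using bl by (simp add: bounded_linear_Blinfun_apply)
  define m where "m = C_h_metric smul \<sigma>"
  have G: "Metric_space (G_s smul) gap_dist"
    by (rule Metric_space_G_s) (simp add: sub)
  have key: "stable_space A \<in> G_s smul \<and>
      (\<exists>C\<ge>0. \<exists>\<delta>>0. \<forall>B\<in>C_h smul \<sigma>. mdist m A B < \<delta> \<longrightarrow>
        gap_dist (stable_space A) (stable_space B) \<le> C * mdist m A B)"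
    if A: "A \<in> C_h smul \<sigma>" for A
  proof -
    obtain T where T: "T \<in> linops smul" "(A \<longlongrightarrow> T) at_top" "\<sigma> T \<inter> {z. Re z = 0} = {}"
      using A by (auto simp: C_h_def)
    obtain KA where KA: "\<And>t. 0 \<le> t \<Longrightarrow> norm (A t) \<le> KA"
      using C_h_bounded[OF A] by (auto simp: bounded_iff)
    define K where "K = norm T + KA + 1"
    have "0 \<le> KA" using KA[of 0] norm_ge_zero[of "A 0"] by linarith
    then have TK: "norm T \<le> K" by (simp add: K_def)
    obtain P N :: "'a \<Rightarrow>\<^sub>L 'a" and \<tau> d0 where d0: "d0 > 0"
      and tail: "\<And>t0. 0 \<le> t0 \<Longrightarrow> hyperbolic_tail P N T K t0 \<tau> d0"
      and JP: "\<And>(J :: 'a \<Rightarrow>\<^sub>L 'a) x. (\<And>x. J (T x) = T (J x)) \<Longrightarrow> J (P x) = P (J x)"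
      using ex_hyperbolic_tail[OF hyp[OF T(1,3)] TK] by metis
    have "\<forall>\<^sub>F t in at_top. dist (A t) T < d0 / 2"
      using tendstoD[OF T(2), of "d0 / 2"] d0 by simp
    then obtain t1 where t1: "\<And>t. t \<ge> t1 \<Longrightarrow> dist (A t) T < d0 / 2"
      by (auto simp: eventually_at_top_linorder)
    define t0 where "t0 = max 0 t1"
    interpret hyperbolic_tail P N T K t0 \<tau> d0
      by (rule tail) (simp add: t0_def)
    define \<delta> where "\<delta> = min 1 (d0 / 2)"
    have \<delta>: "\<delta> > 0" using d0 by (simp add: \<delta>_def)
    have adm: "admissible B" if B: "B \<in> C_h smul \<sigma>" and near: "mdist m A B < \<delta>" for B
    proof -
      have AB: "norm (B t - A t) < \<delta>" if "0 \<le> t" for t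
        using norm_diff_le_mdist_C_h[OF A B that] near by (simp add: m_def norm_minus_commute)
      have "norm (B t) \<le> K" if "0 \<le> t" for t
        using AB[OF that] KA[OF that] norm_triangle_sub[of "B t" "A t"] norm_ge_zero[of T]
        unfolding K_def \<delta>_def by linarith
      moreover have "norm (B t - T) \<le> d0" if "t0 \<le> t" for t
        using AB[of t] t1[of t] that norm_triangle_ineq[of "B t - A t" "A t - T"]
        unfolding t0_def \<delta>_def by (simp add: dist_norm)
      ultimately show ?thesis
        using B by (auto simp: admissible_def bounded_path_def C_h_def)
    qed
    have mAA: "mdist m A A = 0" using A by (simp add: m_def)
    then have admA: "admissible A" using adm[OF A] \<delta> by simp
    have JA: "J c (A t x) = A t (J c x)" if "0 \<le> t" for c t x
    proof -
      have "A t \<in> linops smul" using A that by (auto simp: C_h_def)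
      then show ?thesis by (simp add: J lin)
    qed
    have inv_stable: "smul c y \<in> stable_space A" if "y \<in> stable_space A" for c y
      using stable_space_commute[OF admissible_path[OF admA] JA that] by (simp add: J)
    have inv_compl: "smul c y \<in> complement A" if "y \<in> complement A" for c y
    proof -
      have "J c (P x) = P (J c x)" for x
        by (rule JP) (simp add: J lin[OF T(1)])
      then show ?thesis
        using complement_commute[OF admA JA _ that] by (simp add: J)
    qed
    have "stable_space A \<in> G_s smul"
      unfolding G_s_def mem_Collect_eq sub
      using subspace_stable_space[of A] closed_stable_space[OF admA] inv_stable
        subspace_complement[of A] closed_complement[of A] inv_compl
        stable_Int_complement[OF admA] stable_plus_complement[OF admA] by blast
    moreover have "gap_dist (stable_space A) (stable_space B) \<le> 2 * lip * mdist m A B"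
      if B: "B \<in> C_h smul \<sigma>" and near: "mdist m A B < \<delta>" for B
    proof -
      have le: "norm (A t - B t) \<le> mdist m A B" "norm (B t - A t) \<le> mdist m A B" if "0 \<le> t" for t
        using norm_diff_le_mdist_C_h[OF A B that] by (auto simp: m_def norm_minus_commute)
      have pos: "0 \<le> lip * mdist m A B" using lip_nonneg by simp
      have "gap_excess (stable_space A) (stable_space B) \<le> 2 * (lip * mdist m A B)"
        using stable_space_Lipschitz[OF admA adm[OF B near] le(1)]
        by (intro gap_excess_le subspace_stable_space pos) auto
      moreover have "gap_excess (stable_space B) (stable_space A) \<le> 2 * (lip * mdist m A B)"
        using stable_space_Lipschitz[OF adm[OF B near] admA le(2)]
        by (intro gap_excess_le subspace_stable_space pos) auto
      ultimately show ?thesis by (simp add: gap_dist_def)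
    qed
    ultimately show ?thesis
      using lip_nonneg \<delta> by (intro conjI exI[of _ "2 * lip"] exI[of _ \<delta>]) auto
  qed
  have "\<exists>\<delta>>0. \<forall>B. B \<in> C_h smul \<sigma> \<and> mdist m A B < \<delta> \<longrightarrow> gap_dist (stable_space A) (stable_space B) < e"
    if A: "A \<in> C_h smul \<sigma>" and e: "e > 0" for A e
  proof -
    obtain C \<delta> where C: "C \<ge> 0" "\<delta> > 0"
      "\<And>B. B \<in> C_h smul \<sigma> \<Longrightarrow> mdist m A B < \<delta> \<Longrightarrow> gap_dist (stable_space A) (stable_space B) \<le> C * mdist m A B"
      using key[OF A] by blast
    have "gap_dist (stable_space A) (stable_space B) < e"
      if B: "B \<in> C_h smul \<sigma>" and near: "mdist m A B < min \<delta> (e / (C + 1))" for B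
    proof -
      have "gap_dist (stable_space A) (stable_space B) \<le> C * mdist m A B"
        using C(3)[OF B] near by simp
      also have "\<dots> \<le> (C + 1) * mdist m A B" by (intro mult_right_mono) auto
      also have "\<dots> < e" using near C(1) by (simp add: pos_less_divide_eq mult.commute)
      finally show ?thesis .
    qed
    then show ?thesis using C e by (intro exI[of _ "min \<delta> (e / (C + 1))"]) auto
  qed
  moreover have "mspace m = C_h smul \<sigma>" by (simp add: m_def)
  ultimately have "continuous_map (Metric_space.mtopology (mspace m) (mdist m))
      (Metric_space.mtopology (G_s smul) gap_dist) stable_space"
    using key by (subst Metric_space.metric_continuous_map[OF Metric_space_mspace_mdist G]) auto
  then show ?thesis
    by (simp add: mtopology_of_def G_s_metric_def Metric_space.mspace_metric[OF G]
        Metric_space.mdist_metric[OF G] m_def)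
qed

theorem theorem5p1:
  shows "continuous_map (mtopology_of (C_h_metric ((*\<^sub>R) :: real \<Rightarrow> 'a::banach \<Rightarrow> 'a) real_spectrum))
           (mtopology_of (G_s_metric ((*\<^sub>R) :: real \<Rightarrow> 'a \<Rightarrow> 'a))) stable_space \<and>
         (\<forall>smul :: complex \<Rightarrow> 'a \<Rightarrow> 'a. complex_banach smul \<longrightarrow>
           continuous_map (mtopology_of (C_h_metric smul (spectrum smul)))
             (mtopology_of (G_s_metric smul)) stable_space)"
proof (intro conjI allI impI)
  show "continuous_map (mtopology_of (C_h_metric ((*\<^sub>R) :: real \<Rightarrow> 'a \<Rightarrow> 'a) real_spectrum))
           (mtopology_of (G_s_metric ((*\<^sub>R) :: real \<Rightarrow> 'a \<Rightarrow> 'a))) stable_space"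
  proof (rule continuous_stable_space)
    show "module.subspace (*\<^sub>R) Y \<longleftrightarrow> subspace Y \<and> (\<forall>c. \<forall>y\<in>Y. c *\<^sub>R y \<in> Y)" for Y :: "'a set"
      by (auto simp: subspace_raw_def subspace_scale)
    show "hyperbolic_op T" if "real_spectrum T \<inter> {z. Re z = 0} = {}" for T :: "'a \<Rightarrow>\<^sub>L 'a"
    proof (rule hyperbolic_op_complexify,
        rule hyperbolic_op_if_spectrum[OF vector_space_complexify_scale _ complexify_in_linops])
      show "complexify_scale (complex_of_real r) x = r *\<^sub>R x" for r and x :: "'a \<times> 'a"
        by (simp add: complexify_scale_def scaleR_prod_def)
    qed (use that in \<open>simp add: real_spectrum_def\<close>)
  qed (auto simp: blinfun.bilinear_simps bounded_linear_scaleR_right)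
next
  fix smul :: "complex \<Rightarrow> 'a \<Rightarrow> 'a"
  assume "complex_banach smul"
  then interpret complex_banach smul .
  have vs: "vector_space smul" by unfold_locales
  show "continuous_map (mtopology_of (C_h_metric smul (spectrum smul)))
             (mtopology_of (G_s_metric smul)) stable_space"
  proof (rule continuous_stable_space)
    show "bounded_linear (smul c)" for c
    proof (rule bounded_linear_intro[where K = "cmod c"])
      show "smul c (r *\<^sub>R x) = r *\<^sub>R smul c x" for r x
        by (simp add: smul_of_real[symmetric] mult.commute)
    qed (simp_all add: scale_right_distrib norm_smul mult.commute)
    show "module.subspace smul Y \<longleftrightarrow> Real_Vector_Spaces.subspace Y \<and> (\<forall>c. \<forall>y\<in>Y. smul c y \<in> Y)" for Y
      unfolding subspace_def real_vector.subspace_def smul_of_real[symmetric] by blast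
    show "blinfun_apply A (smul c x) = smul c (blinfun_apply A x)" if "A \<in> linops smul" for A c x
      using that by (auto simp: linops_def Vector_Spaces.linear_iff)
    show "hyperbolic_op T" if "T \<in> linops smul" "spectrum smul T \<inter> {z. Re z = 0} = {}" for T
      by (rule hyperbolic_op_if_spectrum[OF vs smul_of_real that])
  qed
qed

end
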